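(* Let $R$ be a complete Noetherian local ring, assume $\mathcal M$ contains the Matlis-dualizable $R$-modules, and let $p$ be a pair operation on a class $\mathcal P$ of pairs of Matlis-dualizable $R$-modules. Let $p^{\smile}$ be the dual pair operation on $\mathcal P^\vee$. Then $p$ is functorial if and only if $p^{\smile}$ is cofunctorial.
   Context: $\mathcal M$ is a category of $R$-modules and $R$-linear maps; here it contains all Noetherian and all Artinian $R$-modules ("Matlis-dualizable" modules), with all $R$-linear maps between them. $\mathcal P$ is a collection of pairs $(L,M)$, with $L$ a submodule of $M$ and $L,M\in\mathcal M$, such that if $\phi:M\to M'$ is an isomorphism in $\mathcal M$ and $(L,M)\in\mathcal P$ then $(\phi(L),M')\in\mathcal P$. A pair operation on $\mathcal P$ is a function $p$ sending each $(L,M)\in\mathcal P$ to a submodule $p(L,M)$ of $M$ with $\phi(p(L,M))=p(\phi(L),M')$ for every isomorphism $\phi:M\to M'$ and $(L,M)\in\mathcal P$. $p$ is functorial if $g(p(L,M))\subseteq p(g(L),M')$ whenever $g:M\to M'$ and $(L,M),(g(L),M')\in\mathcal P$. $p$ is cofunctorial if $p(g^{-1}(L),M)\subseteq g^{-1}(p(L,M'))$ whenever $g:M\to M'$ and $(L,M'),(g^{-1}(L),M)\in\mathcal P$. Let ${}^\vee$ denote Matlis duality $\mathrm{Hom}_R(-,E_R(k))$, $k$ the residue field. Put $\mathcal P^\vee:=\{(A,B)\mid ((B/A)^\vee,B^\vee)\in\mathcal P\}$, where $(B/A)^\vee$ is viewed as a submodule of $B^\vee$ via the dual of $B\twoheadrightarrow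 B/A$. The dual pair operation $p^{\smile}$ on $\mathcal P^\vee$ is $$p^{\smile}(A,B):=\left(\frac{B^\vee}{p((B/A)^\vee,B^\vee)}\right)^\vee,$$ viewed as a submodule of $B\cong B^{\vee\vee}$. *)

theory Defs
  imports "HOL-Algebra.Algebra" "HOL-Library.FuncSet" "HOL-Library.Equipollence"
begin

text \<open>
  An \<open>R\<close>-module is a record of type \<open>('a, 'u) module\<close> satisfying the library locale
  \<^locale>\<open>module\<close>. The fields \<open>mult\<close> and \<open>one\<close> of such a record carry no meaning and are left
  unspecified in the constructions below.
\<close>

section \<open>Linear maps, quotients, chain conditions\<close>

text \<open>
  Linear maps are taken extensional (undefined outside the carrier of the source), so that two of
  them are equal in HOL exactly when they agree on the source.
\<close>

definition linear_maps ::
  "('a, 'r) ring_scheme \<Rightarrow> ('a, 'b) module \<Rightarrow> ('a, 'c) module \<Rightarrow> ('b \<Rightarrow> 'c) set" where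
  "linear_maps R M N =
     {f \<in> carrier M \<rightarrow>\<^sub>E carrier N.
        (\<forall>x\<in>carrier M. \<forall>y\<in>carrier M. f (x \<oplus>\<^bsub>M\<^esub> y) = f x \<oplus>\<^bsub>N\<^esub> f y) \<and>
        (\<forall>r\<in>carrier R. \<forall>x\<in>carrier M. f (r \<odot>\<^bsub>M\<^esub> x) = r \<odot>\<^bsub>N\<^esub> f x)}"

definition linear_isos ::
  "('a, 'r) ring_scheme \<Rightarrow> ('a, 'b) module \<Rightarrow> ('a, 'c) module \<Rightarrow> ('b \<Rightarrow> 'c) set" where
  "linear_isos R M N = {f \<in> linear_maps R M N. bij_betw f (carrier M) (carrier N)}"

definition ring_module :: "('a, 'r) ring_scheme \<Rightarrow> ('a, 'a) module" where
  "ring_module R =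
     \<lparr>carrier = carrier R, monoid.mult = monoid.mult R, one = \<one>\<^bsub>R\<^esub>, ring.zero = \<zero>\<^bsub>R\<^esub>, add = add R, smult = monoid.mult R\<rparr>"

definition quotient_module :: "('a, 'b) module \<Rightarrow> 'b set \<Rightarrow> ('a, 'b set) module" where
  "quotient_module B A =
     \<lparr>carrier = a_rcosets\<^bsub>B\<^esub> A, monoid.mult = undefined, one = undefined, ring.zero = A, add = set_add B,
      smult = (\<lambda>r S. \<Union>x\<in>S. A +>\<^bsub>B\<^esub> (r \<odot>\<^bsub>B\<^esub> x))\<rparr>"

definition projection :: "('a, 'b) module \<Rightarrow> 'b set \<Rightarrow> 'b \<Rightarrow> 'b set" where
  "projection B A = (\<lambda>b\<in>carrier B. A +>\<^bsub>B\<^esub> b)"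

definition noetherian_module :: "('a, 'r) ring_scheme \<Rightarrow> ('a, 'b) module \<Rightarrow> bool" where
  "noetherian_module R M \<longleftrightarrow> module R M \<and>
     (\<forall>S :: nat \<Rightarrow> 'b set. (\<forall>n. submodule (S n) R M \<and> S n \<subseteq> S (Suc n)) \<longrightarrow>
        (\<exists>n. \<forall>k\<ge>n. S k = S n))"

definition artinian_module :: "('a, 'r) ring_scheme \<Rightarrow> ('a, 'b) module \<Rightarrow> bool" where
  "artinian_module R M \<longleftrightarrow> module R M \<and>
     (\<forall>S :: nat \<Rightarrow> 'b set. (\<forall>n. submodule (S n) R M \<and> S (Suc n) \<subseteq> S n) \<longrightarrow>
        (\<exists>n. \<forall>k\<ge>n. S k = S n))"

definition matlis_dualizable :: "('a, 'r) ring_scheme \<Rightarrow> ('a, 'b) module \<Rightarrow> bool" where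
  "matlis_dualizable R M \<longleftrightarrow> noetherian_module R M \<or> artinian_module R M"

section \<open>Complete local rings and the injective hull of the residue field\<close>

text \<open>
  Completeness says that \<open>R\<close> maps bijectively onto the inverse limit of the rings \<open>R/\<mm>\<^sup>n\<close>; an element
  of the limit is represented by a sequence \<open>a\<close> with \<open>a n\<close> standing for its class modulo \<open>\<mm>\<^sup>n\<close>.
  Powers of ideals are powers in the library's monoid \<^const>\<open>ideals_set\<close> of ideals under the ideal
  product.
\<close>

locale complete_noetherian_local_ring = cring R + noetherian_ring R for R (structure) and \<mm> +
  assumes maximal: "maximalideal \<mm> R"
    and unique_maximal: "maximalideal I R \<Longrightarrow> I = \<mm>"
    and complete:
      "\<lbrakk>\<And>n. a n \<in> carrier R; \<And>n. a (Suc n) \<ominus> a n \<in> \<mm> [^]\<^bsub>ideals_set R\<^esub> n\<rbrakk> \<Longrightarrow>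
         \<exists>!x. x \<in> carrier R \<and> (\<forall>n::nat. a n \<ominus> x \<in> \<mm> [^]\<^bsub>ideals_set R\<^esub> n)"

text \<open>
  The test modules in the definition of injectivity range over the same type \<open>'u\<close> as the elements
  of \<open>E\<close>. If \<open>'u\<close> contains a copy of \<open>R\<close>, all ideals of \<open>R\<close> are among them, so that by Baer's
  criterion this is no weaker than testing against modules over every type.
\<close>

definition injective_module :: "('a, 'r) ring_scheme \<Rightarrow> ('a, 'u) module \<Rightarrow> bool" where
  "injective_module R E \<longleftrightarrow> module R E \<and>
     (\<forall>(M :: ('a, 'u) module) (N :: ('a, 'u) module) f g.
        module R M \<and> module R N \<and> f \<in> linear_maps R M N \<and> inj_on f (carrier M) \<and>
        g \<in> linear_maps R M E \<longrightarrow>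
        (\<exists>h\<in>linear_maps R N E. compose (carrier M) h f = g))"

definition injective_hull ::
  "('a, 'r) ring_scheme \<Rightarrow> ('a, 'k) module \<Rightarrow> ('a, 'u) module \<Rightarrow> bool" where
  "injective_hull R K E \<longleftrightarrow> injective_module R E \<and>
     (\<exists>\<iota>\<in>linear_maps R K E. inj_on \<iota> (carrier K) \<and>
        (\<forall>S. submodule S R E \<and> S \<noteq> {\<zero>\<^bsub>E\<^esub>} \<longrightarrow> S \<inter> \<iota> ` carrier K \<noteq> {\<zero>\<^bsub>E\<^esub>}))"

definition residue_field :: "('a, 'r) ring_scheme \<Rightarrow> 'a set \<Rightarrow> ('a, 'a set) module" where
  "residue_field R \<mm> = quotient_module (ring_module R) \<mm>"

section \<open>Matlis duality\<close>

definition dual :: "('a, 'r) ring_scheme \<Rightarrow> ('a, 'e) module \<Rightarrow> ('a, 'b) module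
    \<Rightarrow> ('a, 'b \<Rightarrow> 'e) module" where
  "dual R E M =
     \<lparr>carrier = linear_maps R M E, monoid.mult = undefined, one = undefined,
      ring.zero = (\<lambda>x\<in>carrier M. \<zero>\<^bsub>E\<^esub>),
      add = (\<lambda>f g. \<lambda>x\<in>carrier M. f x \<oplus>\<^bsub>E\<^esub> g x),
      smult = (\<lambda>r f. \<lambda>x\<in>carrier M. r \<odot>\<^bsub>E\<^esub> f x)\<rparr>"

definition dual_map :: "('a, 'r) ring_scheme \<Rightarrow> ('a, 'e) module \<Rightarrow> ('a, 'b) module
    \<Rightarrow> ('a, 'c) module \<Rightarrow> ('b \<Rightarrow> 'c) \<Rightarrow> ('c \<Rightarrow> 'e) \<Rightarrow> ('b \<Rightarrow> 'e)" where
  "dual_map R E M N g = (\<lambda>f\<in>carrier (dual R E N). compose (carrier M) f g)"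

text \<open>\<open>(B/A)\<^sup>\<or>\<close> as a submodule of \<open>B\<^sup>\<or>\<close>, via the dual of \<open>B \<rightarrow> B/A\<close>.\<close>

definition dual_quotient :: "('a, 'r) ring_scheme \<Rightarrow> ('a, 'e) module \<Rightarrow> 'b set
    \<Rightarrow> ('a, 'b) module \<Rightarrow> ('b \<Rightarrow> 'e) set" where
  "dual_quotient R E A B =
     dual_map R E B (quotient_module B A) (projection B A) ` carrier (dual R E (quotient_module B A))"

definition biduality :: "('a, 'r) ring_scheme \<Rightarrow> ('a, 'e) module \<Rightarrow> ('a, 'b) module
    \<Rightarrow> 'b \<Rightarrow> ('b \<Rightarrow> 'e) \<Rightarrow> 'e" where
  "biduality R E B = (\<lambda>b\<in>carrier B. \<lambda>f\<in>carrier (dual R E B). f b)"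

section \<open>Categories of modules and pair operations\<close>

text \<open>
  All objects of a category of modules have their elements in one type \<open>'u\<close>, the universe. If \<open>'u\<close>
  is infinite and \<open>R\<close> embeds into it, every Noetherian module (a quotient of some \<open>R\<^sup>n\<close>) has an
  isomorphic copy over \<open>'u\<close>; so has every Artinian module over a complete Noetherian local ring
  (a submodule of some \<open>E\<^sup>n\<close>) if \<open>E\<close> does.
\<close>

record ('a, 'u) module_cat =
  Obj :: "('a, 'u) module set"
  Mor :: "('a, 'u) module \<Rightarrow> ('a, 'u) module \<Rightarrow> ('u \<Rightarrow> 'u) set"

locale module_category =
  fixes R :: "('a, 'r) ring_scheme" and C :: "('a, 'u) module_cat"
  assumes obj_module: "M \<in> Obj C \<Longrightarrow> module R M"
    and mor_linear: "\<lbrakk>M \<in> Obj C; N \<in> Obj C\<rbrakk> \<Longrightarrow> Mor C M N \<subseteq> linear_maps R M N"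
    and id_mor: "M \<in> Obj C \<Longrightarrow> (\<lambda>x\<in>carrier M. x) \<in> Mor C M M"
    and comp_mor: "\<lbrakk>M \<in> Obj C; N \<in> Obj C; Q \<in> Obj C; f \<in> Mor C M N; g \<in> Mor C N Q\<rbrakk> \<Longrightarrow>
      compose (carrier M) g f \<in> Mor C M Q"

definition contains_matlis_dualizable ::
  "('a, 'r) ring_scheme \<Rightarrow> ('a, 'u) module_cat \<Rightarrow> bool" where
  "contains_matlis_dualizable R C \<longleftrightarrow>
     (\<forall>M. matlis_dualizable R M \<longrightarrow> M \<in> Obj C) \<and>
     (\<forall>M N. matlis_dualizable R M \<and> matlis_dualizable R N \<longrightarrow> Mor C M N = linear_maps R M N)"

definition cat_isos ::
  "('a, 'u) module_cat \<Rightarrow> ('a, 'u) module \<Rightarrow> ('a, 'u) module \<Rightarrow> ('u \<Rightarrow> 'u) set" where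
  "cat_isos C M N =
     {f \<in> Mor C M N. \<exists>g\<in>Mor C N M. compose (carrier M) g f = (\<lambda>x\<in>carrier M. x) \<and>
                                     compose (carrier N) f g = (\<lambda>y\<in>carrier N. y)}"

definition cat_pair ::
  "('a, 'r) ring_scheme \<Rightarrow> ('a, 'u) module_cat \<Rightarrow> 'u set \<Rightarrow> ('a, 'u) module \<Rightarrow> bool" where
  "cat_pair R C L M \<longleftrightarrow> submodule L R M \<and> M\<lparr>carrier := L\<rparr> \<in> Obj C \<and> M \<in> Obj C"

locale pair_collection = module_category R C
  for R :: "('a, 'r) ring_scheme" and C :: "('a, 'u) module_cat" +
  fixes P :: "('u set \<times> ('a, 'u) module) set"
  assumes pairs: "(L, M) \<in> P \<Longrightarrow> cat_pair R C L M"
    and pairs_iso: "\<lbrakk>(L, M) \<in> P; M' \<in> Obj C; \<phi> \<in> cat_isos C M M'\<rbrakk> \<Longrightarrow> (\<phi> ` L, M') \<in> P"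

text \<open>Values of \<open>p\<close> outside \<open>P\<close> are irrelevant.\<close>

locale pair_operation = pair_collection R C P
  for R :: "('a, 'r) ring_scheme" and C :: "('a, 'u) module_cat"
    and P :: "('u set \<times> ('a, 'u) module) set" +
  fixes p :: "'u set \<Rightarrow> ('a, 'u) module \<Rightarrow> 'u set"
  assumes op_submodule: "(L, M) \<in> P \<Longrightarrow> submodule (p L M) R M"
    and op_iso: "\<lbrakk>(L, M) \<in> P; M' \<in> Obj C; \<phi> \<in> cat_isos C M M'\<rbrakk> \<Longrightarrow>
      \<phi> ` p L M = p (\<phi> ` L) M'"

definition functorial :: "('a, 'u) module_cat \<Rightarrow> ('u set \<times> ('a, 'u) module) set
    \<Rightarrow> ('u set \<Rightarrow> ('a, 'u) module \<Rightarrow> 'u set) \<Rightarrow> bool" where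
  "functorial C P p \<longleftrightarrow>
     (\<forall>L M M' g. g \<in> Mor C M M' \<and> (L, M) \<in> P \<and> (g ` L, M') \<in> P \<longrightarrow>
        g ` p L M \<subseteq> p (g ` L) M')"

definition cofunctorial :: "('a, 'u) module_cat \<Rightarrow> ('u set \<times> ('a, 'u) module) set
    \<Rightarrow> ('u set \<Rightarrow> ('a, 'u) module \<Rightarrow> 'u set) \<Rightarrow> bool" where
  "cofunctorial C P p \<longleftrightarrow>
     (\<forall>L M M' g. g \<in> Mor C M M' \<and> (L, M') \<in> P \<and> (g -` L \<inter> carrier M, M) \<in> P \<longrightarrow>
        p (g -` L \<inter> carrier M) M \<subseteq> g -` p L M' \<inter> carrier M)"

section \<open>The dual pair operation\<close>

text \<open>
  The dual of a module over the type \<open>'u\<close> is a module over \<open>'u \<Rightarrow> 'u\<close>, to which \<open>P\<close> and \<open>p\<close> do not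
  literally apply. As both are invariant under isomorphism, they extend uniquely to modules over
  other types, by transport along an isomorphism with a module over \<open>'u\<close>.
\<close>

definition extended_pairs :: "('a, 'r) ring_scheme \<Rightarrow> ('u set \<times> ('a, 'u) module) set
    \<Rightarrow> ('v set \<times> ('a, 'v) module) set" where
  "extended_pairs R P = {(L, M). module R M \<and> submodule L R M \<and>
     (\<exists>N. \<exists>\<theta>\<in>linear_isos R M N. (\<theta> ` L, N) \<in> P)}"

definition extended_op :: "('a, 'r) ring_scheme \<Rightarrow> ('u set \<times> ('a, 'u) module) set
    \<Rightarrow> ('u set \<Rightarrow> ('a, 'u) module \<Rightarrow> 'u set) \<Rightarrow> 'v set \<Rightarrow> ('a, 'v) module \<Rightarrow> 'v set" where
  "extended_op R P p L M =
     {x \<in> carrier M. \<exists>N. \<exists>\<theta>\<in>linear_isos R M N. (\<theta> ` L, N) \<in> P \<and> \<theta> x \<in> p (\<theta> ` L) N}"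

definition dual_pairs :: "('a, 'r) ring_scheme \<Rightarrow> ('a, 'u) module_cat \<Rightarrow> ('a, 'u) module
    \<Rightarrow> ('u set \<times> ('a, 'u) module) set \<Rightarrow> ('u set \<times> ('a, 'u) module) set" where
  "dual_pairs R C E P =
     {(A, B). cat_pair R C A B \<and> (dual_quotient R E A B, dual R E B) \<in> extended_pairs R P}"

text \<open>
  With \<open>V = p((B/A)\<^sup>\<or>, B\<^sup>\<or>)\<close>, the value at \<open>(A, B)\<close> is \<open>(B\<^sup>\<or>/V)\<^sup>\<or> \<subseteq> B\<^sup>\<or>\<^sup>\<or>\<close>, pulled back to \<open>B\<close> along
  the biduality map.
\<close>

definition dual_op :: "('a, 'r) ring_scheme \<Rightarrow> ('a, 'u) module
    \<Rightarrow> ('u set \<times> ('a, 'u) module) set \<Rightarrow> ('u set \<Rightarrow> ('a, 'u) module \<Rightarrow> 'u set)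
    \<Rightarrow> 'u set \<Rightarrow> ('a, 'u) module \<Rightarrow> 'u set" where
  "dual_op R E P p A B =
     (let V = extended_op R P p (dual_quotient R E A B) (dual R E B)
      in {b \<in> carrier B. biduality R E B b \<in> dual_quotient R E V (dual R E B)})"

end

theory Submission
  imports Defs
begin

text \<open>
  Inside \<open>B\<^sup>\<or>\<close>, the submodule \<open>(B/A)\<^sup>\<or>\<close> is the annihilator of \<open>A\<close>, and \<open>p\<^sup>\<smile>(A, B)\<close> consists of the
  elements of \<open>B\<close> that every functional in \<open>p((B/A)\<^sup>\<or>, B\<^sup>\<or>)\<close> kills. For \<open>g : B \<rightarrow> B'\<close>, injectivity of
  \<open>E\<close> gives \<open>g\<^sup>\<or>((B'/A')\<^sup>\<or>) = (B/g\<^sup>-\<^sup>1A')\<^sup>\<or>\<close>, so functoriality of \<open>p\<close> at \<open>g\<^sup>\<or>\<close> is cofunctoriality of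
  \<open>p\<^sup>\<smile>\<close> at \<open>g\<close>. For the converse every pair of \<open>P\<close> must be a dual, which is Matlis duality:
  \<open>End(E) = R\<close> (Noetherian induction on the ideals containing a power of \<open>\<mm>\<close>, then completeness),
  whence a functional vanishing where \<open>f\<^sub>1, \<dots>, f\<^sub>n\<close> vanish is a combination of them; this yields
  reflexivity of Noetherian and of Artinian modules.
\<close>

section \<open>Submodules and linear maps\<close>

text \<open>Types shape the proof. Injectivity of \<open>E\<close> is tested on modules over
  \<open>'u\<close>, whereas the dual of such a module lives over \<open>'u \<Rightarrow> 'u\<close>
  and \<open>R\<close> over \<open>'a\<close>. Every extension is therefore made to a module over
  \<open>'u\<close>, at the crucial point to \<open>E\<close> itself, and a dual re-enters the
  category as a copy over \<open>'u\<close>. A copy requires a bound on the number of functionals,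
  and here an infinite universe containing a copy of \<open>R\<close> is used: the dual embeds in a
  finite power of \<open>'u\<close> if the module is Noetherian, and is finitely generated over
  \<open>R\<close> if it is Artinian. The two directions start from different data. For
  cofunctoriality of the dual operation, \<open>B\<close> is any object whose dual is isomorphic to
  a module occurring in \<open>P\<close>. For the converse, \<open>M\<close> in \<open>P\<close> is
  given and \<open>B\<close> must be built; only when \<open>B\<close> is known to be dualizable are
  \<open>B\<close> and all linear maps between such modules in the category, whence the exchange of
  chain conditions in \<open>matlis_dual_exists\<close>. All nonzero functionals come from one
  source: maps sending \<open>r x\<close> to \<open>r u\<close>, where \<open>\<mm>\<close> is the
  annihilator of \<open>u\<close>.\<close>

lemma module_closed:
  assumes "module R M"
  shows "\<And>x y. x \<in> carrier M \<Longrightarrow> y \<in> carrier M \<Longrightarrow> x \<oplus>\<^bsub>M\<^esub> y \<in> carrier M"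
    and "\<And>x y. x \<in> carrier M \<Longrightarrow> y \<in> carrier M \<Longrightarrow> x \<ominus>\<^bsub>M\<^esub> y \<in> carrier M"
    and "\<zero>\<^bsub>M\<^esub> \<in> carrier M"
    and "\<And>r x. r \<in> carrier R \<Longrightarrow> x \<in> carrier M \<Longrightarrow> r \<odot>\<^bsub>M\<^esub> x \<in> carrier M"
proof -
  interpret module R M by fact
  show "\<And>x y. x \<in> carrier M \<Longrightarrow> y \<in> carrier M \<Longrightarrow> x \<oplus>\<^bsub>M\<^esub> y \<in> carrier M"
    and "\<And>x y. x \<in> carrier M \<Longrightarrow> y \<in> carrier M \<Longrightarrow> x \<ominus>\<^bsub>M\<^esub> y \<in> carrier M"
    and "\<zero>\<^bsub>M\<^esub> \<in> carrier M"
    and "\<And>r x. r \<in> carrier R \<Longrightarrow> x \<in> carrier M \<Longrightarrow> r \<odot>\<^bsub>M\<^esub> x \<in> carrier M"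
    by auto
qed

lemma module_minus_eq_zero_iff:
  assumes "module R M" "x \<in> carrier M" "y \<in> carrier M"
  shows "x \<ominus>\<^bsub>M\<^esub> y = \<zero>\<^bsub>M\<^esub> \<longleftrightarrow> x = y"
proof -
  interpret module R M by fact
  show ?thesis
    using assms M.minus_equality[of x "\<ominus>\<^bsub>M\<^esub> y"] by (auto simp: a_minus_def M.r_neg)
qed

lemma module_add_minus_cancel:
  assumes "module R M" "x \<in> carrier M" "y \<in> carrier M"
  shows "x \<oplus>\<^bsub>M\<^esub> (y \<ominus>\<^bsub>M\<^esub> x) = y"
proof -
  interpret module R M by fact
  have "x \<oplus>\<^bsub>M\<^esub> (y \<ominus>\<^bsub>M\<^esub> x) = y \<oplus>\<^bsub>M\<^esub> (x \<oplus>\<^bsub>M\<^esub> \<ominus>\<^bsub>M\<^esub> x)"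
    using assms by (simp add: a_minus_def M.a_lcomm)
  then show ?thesis using assms by (simp add: M.r_neg)
qed

lemma (in module) smult_commute:
  "a \<in> carrier R \<Longrightarrow> b \<in> carrier R \<Longrightarrow> x \<in> carrier M \<Longrightarrow> a \<odot>\<^bsub>M\<^esub> (b \<odot>\<^bsub>M\<^esub> x) = b \<odot>\<^bsub>M\<^esub> (a \<odot>\<^bsub>M\<^esub> x)"
  by (simp add: smult_assoc1[symmetric] R.m_comm)

text \<open>Negation is multiplication by \<open>-1\<close>, so closure under it follows from
  \<open>smult\<close>.\<close>

lemma submoduleI_closed:
  assumes "module R M" "H \<subseteq> carrier M" "\<zero>\<^bsub>M\<^esub> \<in> H"
    and add: "\<And>x y. x \<in> H \<Longrightarrow> y \<in> H \<Longrightarrow> x \<oplus>\<^bsub>M\<^esub> y \<in> H"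
    and smult: "\<And>r x. r \<in> carrier R \<Longrightarrow> x \<in> H \<Longrightarrow> r \<odot>\<^bsub>M\<^esub> x \<in> H"
  shows "submodule H R M"
proof -
  interpret module R M by fact
  show ?thesis
  proof (rule submoduleI)
    fix a assume a: "a \<in> H"
    have "(\<ominus>\<^bsub>R\<^esub> \<one>\<^bsub>R\<^esub>) \<odot>\<^bsub>M\<^esub> a \<in> H" using a smult by simp
    then show "\<ominus>\<^bsub>M\<^esub> a \<in> H" using a assms(2) by (simp add: smult_l_minus subset_iff)
  qed (use assms in auto)
qed

lemma submoduleD:
  assumes "module R M" "submodule H R M"
  shows "H \<subseteq> carrier M" "\<And>x. x \<in> H \<Longrightarrow> x \<in> carrier M" "\<zero>\<^bsub>M\<^esub> \<in> H"
    and "\<And>x y. x \<in> H \<Longrightarrow> y \<in> H \<Longrightarrow> x \<oplus>\<^bsub>M\<^esub> y \<in> H"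
    and "\<And>x y. x \<in> H \<Longrightarrow> y \<in> H \<Longrightarrow> x \<ominus>\<^bsub>M\<^esub> y \<in> H"
    and "\<And>x. x \<in> H \<Longrightarrow> \<ominus>\<^bsub>M\<^esub> x \<in> H"
    and "\<And>r x. r \<in> carrier R \<Longrightarrow> x \<in> H \<Longrightarrow> r \<odot>\<^bsub>M\<^esub> x \<in> H"
proof -
  interpret module R M by fact
  note E = submoduleE[OF assms(2)]
  show "H \<subseteq> carrier M" "\<And>x. x \<in> H \<Longrightarrow> x \<in> carrier M" using E(1) by auto
  show "\<zero>\<^bsub>M\<^esub> \<in> H"
    using submodule.axioms(1)[OF assms(2)] subgroup.one_closed by fastforce
  show "\<And>x y. x \<in> H \<Longrightarrow> y \<in> H \<Longrightarrow> x \<ominus>\<^bsub>M\<^esub> y \<in> H" using E by (simp add: a_minus_def)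
qed (use module.submoduleE[OF assms] in auto)

lemma submodule_trans:
  assumes "module R M" "submodule L R M" "submodule S R (M\<lparr>carrier := L\<rparr>)"
  shows "submodule S R M"
proof -
  have L: "module R (M\<lparr>carrier := L\<rparr>)"
    using assms submodule.submodule_is_module by blast
  note S = submoduleD[OF L assms(3)]
  show ?thesis
    using S submoduleD(1)[OF assms(1,2)] by (intro submoduleI_closed[OF assms(1)]) auto
qed

lemma linear_mapsI:
  assumes "f \<in> extensional (carrier M)" "\<And>x. x \<in> carrier M \<Longrightarrow> f x \<in> carrier N"
    and "\<And>x y. x \<in> carrier M \<Longrightarrow> y \<in> carrier M \<Longrightarrow> f (x \<oplus>\<^bsub>M\<^esub> y) = f x \<oplus>\<^bsub>N\<^esub> f y"
    and "\<And>r x. r \<in> carrier R \<Longrightarrow> x \<in> carrier M \<Longrightarrow> f (r \<odot>\<^bsub>M\<^esub> x) = r \<odot>\<^bsub>N\<^esub> f x"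
  shows "f \<in> linear_maps R M N"
  using assms unfolding linear_maps_def by (auto simp: PiE_def)

lemma linear_mapsD:
  assumes "f \<in> linear_maps R M N"
  shows "f \<in> extensional (carrier M)" "\<And>x. x \<in> carrier M \<Longrightarrow> f x \<in> carrier N"
    and "\<And>x y. x \<in> carrier M \<Longrightarrow> y \<in> carrier M \<Longrightarrow> f (x \<oplus>\<^bsub>M\<^esub> y) = f x \<oplus>\<^bsub>N\<^esub> f y"
    and "\<And>r x. r \<in> carrier R \<Longrightarrow> x \<in> carrier M \<Longrightarrow> f (r \<odot>\<^bsub>M\<^esub> x) = r \<odot>\<^bsub>N\<^esub> f x"
  using assms unfolding linear_maps_def by (auto simp: PiE_def)

lemma linear_maps_eqI:
  assumes "f \<in> linear_maps R M N" "g \<in> linear_maps R M N'"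
    and "\<And>x. x \<in> carrier M \<Longrightarrow> f x = g x"
  shows "f = g"
  using linear_mapsD(1)[OF assms(1)] linear_mapsD(1)[OF assms(2)] assms(3)
  by (rule extensionalityI)

lemma linear_maps_zero:
  assumes "module R M" "module R N" "f \<in> linear_maps R M N"
  shows "f \<zero>\<^bsub>M\<^esub> = \<zero>\<^bsub>N\<^esub>"
proof -
  interpret M: module R M by fact
  interpret N: module R N by fact
  have "f (\<zero>\<^bsub>R\<^esub> \<odot>\<^bsub>M\<^esub> \<zero>\<^bsub>M\<^esub>) = \<zero>\<^bsub>R\<^esub> \<odot>\<^bsub>N\<^esub> f \<zero>\<^bsub>M\<^esub>"
    by (rule linear_mapsD(4)[OF assms(3)]) auto
  then show ?thesis using linear_mapsD(2)[OF assms(3)] by simp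
qed

lemma linear_maps_minus:
  assumes "module R M" "module R N" "f \<in> linear_maps R M N" "x \<in> carrier M" "y \<in> carrier M"
  shows "f (x \<ominus>\<^bsub>M\<^esub> y) = f x \<ominus>\<^bsub>N\<^esub> f y"
proof -
  interpret M: module R M by fact
  interpret N: module R N by fact
  note f = linear_mapsD[OF assms(3)]
  have "f (\<ominus>\<^bsub>M\<^esub> y) = f ((\<ominus>\<^bsub>R\<^esub> \<one>\<^bsub>R\<^esub>) \<odot>\<^bsub>M\<^esub> y)" using assms by (simp add: M.smult_l_minus)
  also have "\<dots> = \<ominus>\<^bsub>N\<^esub> f y" using assms f(2) by (simp add: f(4) N.smult_l_minus)
  finally show ?thesis using assms by (simp add: a_minus_def f(3))
qed

lemma linear_maps_compose:
  assumes "module R M" "f \<in> linear_maps R M N" "g \<in> linear_maps R N Q"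
  shows "compose (carrier M) g f \<in> linear_maps R M Q"
  using linear_mapsD(2-)[OF assms(2)] linear_mapsD(2-)[OF assms(3)] module_closed[OF assms(1)]
  by (intro linear_mapsI) (auto simp: compose_def)

lemma linear_maps_restrictI:
  assumes "module R M" "\<And>x. x \<in> carrier M \<Longrightarrow> f x \<in> carrier N"
    and "\<And>x y. x \<in> carrier M \<Longrightarrow> y \<in> carrier M \<Longrightarrow> f (x \<oplus>\<^bsub>M\<^esub> y) = f x \<oplus>\<^bsub>N\<^esub> f y"
    and "\<And>r x. r \<in> carrier R \<Longrightarrow> x \<in> carrier M \<Longrightarrow> f (r \<odot>\<^bsub>M\<^esub> x) = r \<odot>\<^bsub>N\<^esub> f x"
  shows "(\<lambda>x\<in>carrier M. f x) \<in> linear_maps R M N"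
  using assms module_closed[OF assms(1)] by (intro linear_mapsI) auto

lemma submodule_vimage:
  assumes "module R M" "module R N" "f \<in> linear_maps R M N" "submodule A R N"
  shows "submodule {x \<in> carrier M. f x \<in> A} R M"
  using linear_mapsD[OF assms(3)] linear_maps_zero[OF assms(1-3)] submoduleD[OF assms(2,4)]
    module_closed[OF assms(1)]
  by (intro submoduleI_closed[OF assms(1)]) auto

lemma submodule_image:
  assumes "module R M" "module R N" "f \<in> linear_maps R M N" "submodule A R M"
  shows "submodule (f ` A) R N"
proof (rule submoduleI_closed[OF assms(2)])
  note f = linear_mapsD(2-)[OF assms(3)] and A = submoduleD[OF assms(1,4)]
  show "f ` A \<subseteq> carrier N" using f(1) A(2) by auto
  show "\<zero>\<^bsub>N\<^esub> \<in> f ` A" using linear_maps_zero[OF assms(1-3)] A(3) by (metis image_eqI)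
  show "x \<oplus>\<^bsub>N\<^esub> y \<in> f ` A" if "x \<in> f ` A" "y \<in> f ` A" for x y
    using that A f(2) by (smt (verit) image_iff)
  show "r \<odot>\<^bsub>N\<^esub> x \<in> f ` A" if "r \<in> carrier R" "x \<in> f ` A" for r x
    using that A f(3) by (smt (verit) image_iff)
qed

lemma submodule_zero:
  assumes "module R M" shows "submodule {\<zero>\<^bsub>M\<^esub>} R M"
proof -
  interpret module R M by fact
  show ?thesis by (intro submoduleI_closed[OF assms]) auto
qed

lemma submodule_ker:
  assumes "module R M" "module R N" "f \<in> linear_maps R M N"
  shows "submodule {x \<in> carrier M. f x = \<zero>\<^bsub>N\<^esub>} R M"
  using submodule_vimage[OF assms submodule_zero[OF assms(2)]] by simp

lemma submodule_common_ker:
  assumes "module R M" "module R N" "\<And>f. f \<in> F \<Longrightarrow> f \<in> linear_maps R M N"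
  shows "submodule {x \<in> carrier M. \<forall>f\<in>F. f x = \<zero>\<^bsub>N\<^esub>} R M"
proof -
  have ker: "submodule {x \<in> carrier M. f x = \<zero>\<^bsub>N\<^esub>} R M" if "f \<in> F" for f
    using submodule_ker[OF assms(1,2) assms(3)[OF that]] .
  show ?thesis
  proof (rule submoduleI_closed[OF assms(1)])
    show "\<zero>\<^bsub>M\<^esub> \<in> {x \<in> carrier M. \<forall>f\<in>F. f x = \<zero>\<^bsub>N\<^esub>}"
      using submoduleD(3)[OF assms(1) ker] module_closed(3)[OF assms(1)] by blast
    show "x \<oplus>\<^bsub>M\<^esub> y \<in> {x \<in> carrier M. \<forall>f\<in>F. f x = \<zero>\<^bsub>N\<^esub>}"
      if "x \<in> {x \<in> carrier M. \<forall>f\<in>F. f x = \<zero>\<^bsub>N\<^esub>}" "y \<in> {x \<in> carrier M. \<forall>f\<in>F. f x = \<zero>\<^bsub>N\<^esub>}" for x y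
      using that submoduleD(4)[OF assms(1) ker] module_closed(1)[OF assms(1)] by blast
    show "r \<odot>\<^bsub>M\<^esub> x \<in> {x \<in> carrier M. \<forall>f\<in>F. f x = \<zero>\<^bsub>N\<^esub>}"
      if "r \<in> carrier R" "x \<in> {x \<in> carrier M. \<forall>f\<in>F. f x = \<zero>\<^bsub>N\<^esub>}" for r x
      using that submoduleD(7)[OF assms(1) ker] module_closed(4)[OF assms(1)] by blast
  qed auto
qed

lemma submodule_equalizer:
  assumes "module R M" "module R N" "f \<in> linear_maps R M N" "g \<in> linear_maps R M N"
  shows "submodule {x \<in> carrier M. f x = g x} R M"
  using linear_mapsD(3,4)[OF assms(3)] linear_mapsD(3,4)[OF assms(4)] linear_maps_zero[OF assms(1-3)]
    linear_maps_zero[OF assms(1,2,4)] module_closed[OF assms(1)]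
  by (intro submoduleI_closed[OF assms(1)]) auto

lemma submodule_Int:
  assumes "module R M" "submodule A R M" "submodule B R M"
  shows "submodule (A \<inter> B) R M"
  using submoduleD[OF assms(1,2)] submoduleD[OF assms(1,3)]
  by (intro submoduleI_closed[OF assms(1)]) auto

text \<open>
  Extending a linear map is phrased through its graph \<open>S\<close>, so that a map given on generators of
  the form \<open>v + r x\<close> or \<open>f x\<close> need not be defined by choice.
\<close>

lemma injective_extend_graph:
  fixes M E :: "('a, 'u) module"
  assumes "injective_module R E" "module R M"
    and S: "S \<subseteq> carrier M \<times> carrier E" "(\<zero>\<^bsub>M\<^esub>, \<zero>\<^bsub>E\<^esub>) \<in> S"
    and add: "\<And>x e y e'. (x, e) \<in> S \<Longrightarrow> (y, e') \<in> S \<Longrightarrow> (x \<oplus>\<^bsub>M\<^esub> y, e \<oplus>\<^bsub>E\<^esub> e') \<in> S"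
    and smult: "\<And>r x e. r \<in> carrier R \<Longrightarrow> (x, e) \<in> S \<Longrightarrow> (r \<odot>\<^bsub>M\<^esub> x, r \<odot>\<^bsub>E\<^esub> e) \<in> S"
    and single: "\<And>e. (\<zero>\<^bsub>M\<^esub>, e) \<in> S \<Longrightarrow> e = \<zero>\<^bsub>E\<^esub>"
  shows "\<exists>h\<in>linear_maps R M E. \<forall>x e. (x, e) \<in> S \<longrightarrow> h x = e"
proof -
  have E: "module R E" using assms(1) unfolding injective_module_def by blast
  interpret E: module R E by fact
  interpret M: module R M by fact
  \<comment> \<open>Subtraction is expressed as adding the multiple by \<open>-1\<close>, under
    which \<open>S\<close> is closed. This reduces uniqueness of all values to uniqueness of the
    value at zero.\<close>
  have sv: "e = e'" if "(x, e) \<in> S" "(x, e') \<in> S" for x e e'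
  proof -
    have c: "x \<in> carrier M" "e \<in> carrier E" "e' \<in> carrier E" using that S(1) by auto
    have "(x \<oplus>\<^bsub>M\<^esub> (\<ominus>\<^bsub>R\<^esub> \<one>\<^bsub>R\<^esub>) \<odot>\<^bsub>M\<^esub> x, e \<oplus>\<^bsub>E\<^esub> (\<ominus>\<^bsub>R\<^esub> \<one>\<^bsub>R\<^esub>) \<odot>\<^bsub>E\<^esub> e') \<in> S"
      using that by (intro add smult) auto
    then have "e \<ominus>\<^bsub>E\<^esub> e' = \<zero>\<^bsub>E\<^esub>"
      using c by (intro single) (simp add: M.smult_l_minus E.smult_l_minus M.M.r_neg a_minus_def)
    then show ?thesis using c module_minus_eq_zero_iff[OF E] by blast
  qed
  \<comment> \<open>The domain of the graph becomes a module, whose inclusion into \<open>M\<close>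
    is the injective map along which \<open>injective_module\<close> extends
    \<open>g\<close>.\<close>
  define N where "N = M\<lparr>carrier := fst ` S\<rparr>"
  have "submodule (fst ` S) R M"
  proof (rule submoduleI_closed[OF assms(2)])
    fix x y assume "x \<in> fst ` S" "y \<in> fst ` S"
    then show "x \<oplus>\<^bsub>M\<^esub> y \<in> fst ` S" using add by force
  next
    fix r x assume "r \<in> carrier R" "x \<in> fst ` S"
    then show "r \<odot>\<^bsub>M\<^esub> x \<in> fst ` S" using smult by force
  qed (use S in force)+
  then have N: "module R N"
    unfolding N_def by (rule submodule.submodule_is_module[OF _ assms(2)])
  define g where "g = (\<lambda>x\<in>carrier N. THE e. (x, e) \<in> S)"
  have g: "g x = e" if "(x, e) \<in> S" for x e
  proof -
    have "x \<in> carrier N" using that by (force simp: N_def)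
    moreover have "(THE e. (x, e) \<in> S) = e" using that sv[OF _ that] by (rule the_equality)
    ultimately show ?thesis by (simp add: g_def)
  qed
  have "g \<in> linear_maps R N E"
  proof (rule linear_mapsI)
    fix x assume "x \<in> carrier N"
    then obtain e where e: "(x, e) \<in> S" by (auto simp: N_def)
    then show "g x \<in> carrier E" using g S(1) by auto
    show "g (r \<odot>\<^bsub>N\<^esub> x) = r \<odot>\<^bsub>E\<^esub> g x" if "r \<in> carrier R" for r
      using g[OF smult[OF that e]] g[OF e] by (simp add: N_def)
    fix y assume "y \<in> carrier N"
    then obtain e' where e': "(y, e') \<in> S" by (auto simp: N_def)
    show "g (x \<oplus>\<^bsub>N\<^esub> y) = g x \<oplus>\<^bsub>E\<^esub> g y"
      using g[OF add[OF e e']] g[OF e] g[OF e'] by (simp add: N_def)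
  qed (simp add: g_def)
  moreover have "(\<lambda>x\<in>carrier N. x) \<in> linear_maps R N M"
    using S by (intro linear_maps_restrictI[OF N]) (auto simp: N_def)
  moreover have "inj_on (\<lambda>x\<in>carrier N. x) (carrier N)" by (simp add: inj_on_def)
  ultimately obtain h where h: "h \<in> linear_maps R M E"
      "compose (carrier N) h (\<lambda>x\<in>carrier N. x) = g"
    using assms(1,2) N unfolding injective_module_def by meson
  have "h x = e" if "(x, e) \<in> S" for x e
  proof -
    have "x \<in> carrier N" using that by (force simp: N_def)
    then show ?thesis using fun_cong[OF h(2), of x] g[OF that] by (simp add: compose_def)
  qed
  with h(1) show ?thesis by blast
qed

section \<open>Quotients and duals\<close>

lemma submodule_abelian_subgroup:
  assumes "module R B" "submodule A R B"
  shows "abelian_subgroup A B"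
proof -
  interpret module R B by fact
  show ?thesis
    using submodule.axioms(1)[OF assms(2)] M.abelian_group_axioms
    by (intro abelian_subgroupI3) (simp_all add: additive_subgroup_def)
qed

lemma quotient_module_simps:
  assumes "module R B" "submodule A R B"
  shows "carrier (quotient_module B A) = (\<lambda>b. A +>\<^bsub>B\<^esub> b) ` carrier B"
    and "\<And>a b. a \<in> carrier B \<Longrightarrow> b \<in> carrier B \<Longrightarrow>
      (A +>\<^bsub>B\<^esub> a) \<oplus>\<^bsub>quotient_module B A\<^esub> (A +>\<^bsub>B\<^esub> b) = A +>\<^bsub>B\<^esub> (a \<oplus>\<^bsub>B\<^esub> b)"
    and "\<And>r b. r \<in> carrier R \<Longrightarrow> b \<in> carrier B \<Longrightarrow>
      r \<odot>\<^bsub>quotient_module B A\<^esub> (A +>\<^bsub>B\<^esub> b) = A +>\<^bsub>B\<^esub> (r \<odot>\<^bsub>B\<^esub> b)"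
    and "\<And>a b. a \<in> carrier B \<Longrightarrow> b \<in> carrier B \<Longrightarrow>
      A +>\<^bsub>B\<^esub> a = A +>\<^bsub>B\<^esub> b \<longleftrightarrow> a \<ominus>\<^bsub>B\<^esub> b \<in> A"
proof -
  interpret module R B by fact
  interpret abelian_subgroup A B by (rule submodule_abelian_subgroup) fact+
  note A = submoduleD[OF assms]
  show "carrier (quotient_module B A) = (\<lambda>b. A +>\<^bsub>B\<^esub> b) ` carrier B"
    by (auto simp: quotient_module_def A_RCOSETS_def')
  show "(A +>\<^bsub>B\<^esub> a) \<oplus>\<^bsub>quotient_module B A\<^esub> (A +>\<^bsub>B\<^esub> b) = A +>\<^bsub>B\<^esub> (a \<oplus>\<^bsub>B\<^esub> b)"
    if "a \<in> carrier B" "b \<in> carrier B" for a b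
    using that by (simp add: quotient_module_def a_rcos_sum)
  show *: "A +>\<^bsub>B\<^esub> a = A +>\<^bsub>B\<^esub> b \<longleftrightarrow> a \<ominus>\<^bsub>B\<^esub> b \<in> A"
    if "a \<in> carrier B" "b \<in> carrier B" for a b
  proof -
    have "A +>\<^bsub>B\<^esub> a = A +>\<^bsub>B\<^esub> b \<longleftrightarrow> a \<in> A +>\<^bsub>B\<^esub> b"
      using that a_repr_independence'[of a b] a_rcos_self[of a] by auto
    also have "\<dots> \<longleftrightarrow> a \<ominus>\<^bsub>B\<^esub> b \<in> A"
      using that a_rcos_module[of b a] by (simp add: a_minus_def)
    finally show ?thesis .
  qed
  show "r \<odot>\<^bsub>quotient_module B A\<^esub> (A +>\<^bsub>B\<^esub> b) = A +>\<^bsub>B\<^esub> (r \<odot>\<^bsub>B\<^esub> b)"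
    if rb: "r \<in> carrier R" "b \<in> carrier B" for r b
  proof -
    \<comment> \<open>Scaling any representative of a coset leads to the same coset, so the union in
      the definition of \<open>smult\<close> collapses.\<close>
    have "A +>\<^bsub>B\<^esub> (r \<odot>\<^bsub>B\<^esub> x) = A +>\<^bsub>B\<^esub> (r \<odot>\<^bsub>B\<^esub> b)" if x: "x \<in> A +>\<^bsub>B\<^esub> b" for x
    proof -
      obtain a where a: "a \<in> A" "x = a \<oplus>\<^bsub>B\<^esub> b" using x unfolding a_r_coset_def' by blast
      then have c: "a \<in> carrier B" "x \<in> carrier B" using A rb by auto
      have "r \<odot>\<^bsub>B\<^esub> x \<ominus>\<^bsub>B\<^esub> r \<odot>\<^bsub>B\<^esub> b = r \<odot>\<^bsub>B\<^esub> a"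
        using a(2) c rb by (simp add: smult_r_distr a_minus_def M.a_assoc M.r_neg)
      then show ?thesis using *[of "r \<odot>\<^bsub>B\<^esub> x" "r \<odot>\<^bsub>B\<^esub> b"] c rb A(7) a(1) by simp
    qed
    moreover have "b \<in> A +>\<^bsub>B\<^esub> b" using rb by (simp add: a_rcos_self)
    ultimately have "(\<Union>x\<in>A +>\<^bsub>B\<^esub> b. A +>\<^bsub>B\<^esub> (r \<odot>\<^bsub>B\<^esub> x)) = A +>\<^bsub>B\<^esub> (r \<odot>\<^bsub>B\<^esub> b)" by blast
    then show ?thesis by (simp add: quotient_module_def)
  qed
qed

lemma dual_simps [simp]:
  "carrier (dual R E M) = linear_maps R M E"
  "\<zero>\<^bsub>dual R E M\<^esub> = (\<lambda>x\<in>carrier M. \<zero>\<^bsub>E\<^esub>)"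
  "f \<oplus>\<^bsub>dual R E M\<^esub> g = (\<lambda>x\<in>carrier M. f x \<oplus>\<^bsub>E\<^esub> g x)"
  "r \<odot>\<^bsub>dual R E M\<^esub> f = (\<lambda>x\<in>carrier M. r \<odot>\<^bsub>E\<^esub> f x)"
  by (simp_all add: dual_def)

lemma dual_module:
  assumes "module R E" "module R M"
  shows "module R (dual R E M)"
proof -
  interpret E: module R E by fact
  interpret M: module R M by fact
  note L = linear_mapsD[of _ R M E]
  have closed: "f \<oplus>\<^bsub>dual R E M\<^esub> g \<in> linear_maps R M E"
      "r \<odot>\<^bsub>dual R E M\<^esub> f \<in> linear_maps R M E"
    if "f \<in> linear_maps R M E" "g \<in> linear_maps R M E" "r \<in> carrier R" for f g r
    using L(2-)[OF that(1)] L(2-)[OF that(2)] that(3) unfolding dual_simps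
    by (auto intro!: linear_maps_restrictI[OF assms(2)]
        simp: E.M.a_ac E.smult_r_distr E.smult_assoc1[symmetric] E.R.m_comm)
  have zero: "\<zero>\<^bsub>dual R E M\<^esub> \<in> linear_maps R M E"
    unfolding dual_simps by (auto intro!: linear_maps_restrictI[OF assms(2)])
  show ?thesis
  proof (rule moduleI)
    show "cring R" by (rule E.R.cring_axioms)
    show "abelian_group (dual R E M)"
    proof (rule abelian_groupI, unfold dual_simps(1))
      fix f assume f: "f \<in> linear_maps R M E"
      show "\<exists>g\<in>linear_maps R M E. g \<oplus>\<^bsub>dual R E M\<^esub> f = \<zero>\<^bsub>dual R E M\<^esub>"
        using closed(2)[OF f f, of "\<ominus>\<^bsub>R\<^esub> \<one>\<^bsub>R\<^esub>"] L(2)[OF f]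
        by (intro bexI[of _ "(\<ominus>\<^bsub>R\<^esub> \<one>\<^bsub>R\<^esub>) \<odot>\<^bsub>dual R E M\<^esub> f"])
          (auto simp: E.smult_l_minus E.M.l_neg intro!: restrict_ext)
      show "\<zero>\<^bsub>dual R E M\<^esub> \<oplus>\<^bsub>dual R E M\<^esub> f = f"
        using L(1,2)[OF f] by (auto intro!: extensionalityI[of _ "carrier M"])
    qed (use closed zero L(2) in \<open>auto intro!: restrict_ext simp: E.M.a_ac\<close>)
  next
    fix f assume f: "f \<in> carrier (dual R E M)"
    then show "\<one>\<^bsub>R\<^esub> \<odot>\<^bsub>dual R E M\<^esub> f = f"
      using L(1,2)[of f] by (auto intro!: extensionalityI[of _ "carrier M"])
  qed (use closed L(2) in \<open>auto intro!: restrict_ext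
      simp: E.smult_l_distr E.smult_r_distr E.smult_assoc1\<close>)
qed

text \<open>A functional kills \<open>A\<close> exactly when it factors through the projection.
  Later arguments about dual quotients work with this annihilator and not with cosets.\<close>

lemma dual_quotient_eq:
  assumes "module R E" "module R B" "submodule A R B"
  shows "dual_quotient R E A B = {f \<in> linear_maps R B E. \<forall>a\<in>A. f a = \<zero>\<^bsub>E\<^esub>}"
proof -
  interpret E: module R E by fact
  interpret B: module R B by fact
  interpret abelian_subgroup A B by (rule submodule_abelian_subgroup) fact+
  note A = submoduleD[OF assms(2,3)] and Q = quotient_module_simps[OF assms(2,3)]
  let ?Q = "quotient_module B A"
  have eq: "dual_map R E B ?Q (projection B A) k = (\<lambda>b\<in>carrier B. k (A +>\<^bsub>B\<^esub> b))"
    if "k \<in> linear_maps R ?Q E" for k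
    using that by (auto simp: dual_map_def projection_def compose_def)
  have QA: "A +>\<^bsub>B\<^esub> b \<in> carrier ?Q" if "b \<in> carrier B" for b using that Q(1) by auto
  have *: "(\<lambda>b\<in>carrier B. k (A +>\<^bsub>B\<^esub> b)) \<in> {f \<in> linear_maps R B E. \<forall>a\<in>A. f a = \<zero>\<^bsub>E\<^esub>}"
    if k: "k \<in> linear_maps R ?Q E" for k
  proof -
    note kD = linear_mapsD[OF k]
    have add: "k (A +>\<^bsub>B\<^esub> (a \<oplus>\<^bsub>B\<^esub> b)) = k (A +>\<^bsub>B\<^esub> a) \<oplus>\<^bsub>E\<^esub> k (A +>\<^bsub>B\<^esub> b)"
      if "a \<in> carrier B" "b \<in> carrier B" for a b
      using that kD(3)[OF QA QA] Q(2) by simp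
    have smult: "k (A +>\<^bsub>B\<^esub> (r \<odot>\<^bsub>B\<^esub> b)) = r \<odot>\<^bsub>E\<^esub> k (A +>\<^bsub>B\<^esub> b)"
      if "r \<in> carrier R" "b \<in> carrier B" for r b
      using that kD(4)[OF _ QA] Q(3) by simp
    have z: "k (A +>\<^bsub>B\<^esub> \<zero>\<^bsub>B\<^esub>) = \<zero>\<^bsub>E\<^esub>"
      using smult[of "\<zero>\<^bsub>R\<^esub>" "\<zero>\<^bsub>B\<^esub>"] kD(2)[OF QA] by simp
    have "k (A +>\<^bsub>B\<^esub> a) = \<zero>\<^bsub>E\<^esub>" if "a \<in> A" for a
    proof -
      have "A +>\<^bsub>B\<^esub> a = A +>\<^bsub>B\<^esub> \<zero>\<^bsub>B\<^esub>" using that A by (subst Q(4)) auto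
      then show ?thesis using z by simp
    qed
    then show ?thesis
      using kD(2)[OF QA] add smult A(2) by (auto intro!: linear_maps_restrictI[OF assms(2)])
  qed
  have **: "\<exists>k\<in>linear_maps R ?Q E. f = (\<lambda>b\<in>carrier B. k (A +>\<^bsub>B\<^esub> b))"
    if f: "f \<in> linear_maps R B E" "\<forall>a\<in>A. f a = \<zero>\<^bsub>E\<^esub>" for f
  proof -
    note fD = linear_mapsD[OF f(1)]
    \<comment> \<open>The value at a coset is read off at a chosen representative. Another
      representative differs by an element of \<open>A\<close>, which \<open>f\<close>
      kills.\<close>
    define k where "k = (\<lambda>Y\<in>(carrier ?Q). f (SOME b. b \<in> Y))"
    have k: "k (A +>\<^bsub>B\<^esub> b) = f b" if b: "b \<in> carrier B" for b
    proof -
      define c where "c = (SOME c. c \<in> A +>\<^bsub>B\<^esub> b)"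
      have "c \<in> A +>\<^bsub>B\<^esub> b" unfolding c_def using b a_rcos_self by (metis someI_ex)
      then obtain a where a: "a \<in> A" "c = a \<oplus>\<^bsub>B\<^esub> b" unfolding a_r_coset_def' by blast
      then have "f c = f b" using f(2) fD(2,3) A(2) b by simp
      then show ?thesis unfolding k_def c_def using QA[OF b] by simp
    qed
    have "k \<in> linear_maps R ?Q E"
      using fD(2-) by (intro linear_mapsI) (auto simp: Q k, simp add: k_def Q)
    moreover have "f = (\<lambda>b\<in>carrier B. k (A +>\<^bsub>B\<^esub> b))"
      using fD(1) k by (auto intro!: extensionalityI[of _ "carrier B"])
    ultimately show ?thesis by blast
  qed
  have "(\<lambda>k. \<lambda>b\<in>carrier B. k (A +>\<^bsub>B\<^esub> b)) ` linear_maps R ?Q E =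
      {f \<in> linear_maps R B E. \<forall>a\<in>A. f a = \<zero>\<^bsub>E\<^esub>}"
  proof (intro equalityI subsetI)
    fix f assume "f \<in> (\<lambda>k. \<lambda>b\<in>carrier B. k (A +>\<^bsub>B\<^esub> b)) ` linear_maps R ?Q E"
    then show "f \<in> {f \<in> linear_maps R B E. \<forall>a\<in>A. f a = \<zero>\<^bsub>E\<^esub>}"
      using * by (elim imageE) simp
  next
    fix f assume "f \<in> {f \<in> linear_maps R B E. \<forall>a\<in>A. f a = \<zero>\<^bsub>E\<^esub>}"
    then obtain k where "k \<in> linear_maps R ?Q E" "f = (\<lambda>b\<in>carrier B. k (A +>\<^bsub>B\<^esub> b))"
      using **[of f] by blast
    then show "f \<in> (\<lambda>k. \<lambda>b\<in>carrier B. k (A +>\<^bsub>B\<^esub> b)) ` linear_maps R ?Q E"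
      by (intro image_eqI[of _ _ k]) 
  qed
  moreover have "dual_quotient R E A B = (\<lambda>k. \<lambda>b\<in>carrier B. k (A +>\<^bsub>B\<^esub> b)) ` linear_maps R ?Q E"
    unfolding dual_quotient_def dual_simps by (rule image_cong[OF refl eq])
  ultimately show ?thesis by (rule trans[rotated])
qed

section \<open>Isomorphic copies\<close>

text \<open>Restricted to \<open>carrier N\<close> because members of \<open>linear_maps\<close>
  have to be extensional.\<close>

definition iso_inv :: "('a, 'b) module \<Rightarrow> ('a, 'c) module \<Rightarrow> ('b \<Rightarrow> 'c) \<Rightarrow> 'c \<Rightarrow> 'b" where
  "iso_inv M N f = (\<lambda>y\<in>carrier N. inv_into (carrier M) f y)"

lemma linear_isosD:
  assumes "f \<in> linear_isos R M N"
  shows "f \<in> linear_maps R M N" "bij_betw f (carrier M) (carrier N)"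
    "inj_on f (carrier M)" "f ` carrier M = carrier N"
  using assms by (auto simp: linear_isos_def bij_betw_def)

lemma iso_inv_simps:
  assumes "f \<in> linear_isos R M N"
  shows "x \<in> carrier M \<Longrightarrow> iso_inv M N f (f x) = x" "y \<in> carrier N \<Longrightarrow> f (iso_inv M N f y) = y"
    "y \<in> carrier N \<Longrightarrow> iso_inv M N f y \<in> carrier M"
  using linear_isosD[OF assms]
  by (auto simp: iso_inv_def bij_betw_def inv_into_f_f f_inv_into_f) (metis inv_into_into)

lemma iso_inv_linear_isos:
  assumes "module R M" "f \<in> linear_isos R M N"
  shows "iso_inv M N f \<in> linear_isos R N M"
proof -
  note f = linear_mapsD(2-)[OF linear_isosD(1)[OF assms(2)]] and i = iso_inv_simps[OF assms(2)]
  note c = module_closed[OF assms(1)]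
  have "iso_inv M N f \<in> linear_maps R N M"
  proof (rule linear_mapsI)
    fix x y r assume x: "x \<in> carrier N"
    then show "iso_inv M N f x \<in> carrier M" by (rule i)
    show "iso_inv M N f (x \<oplus>\<^bsub>N\<^esub> y) = iso_inv M N f x \<oplus>\<^bsub>M\<^esub> iso_inv M N f y" if "y \<in> carrier N"
      using i(1)[of "iso_inv M N f x \<oplus>\<^bsub>M\<^esub> iso_inv M N f y"] f(2) i(2,3) x that c by simp
    show "iso_inv M N f (r \<odot>\<^bsub>N\<^esub> x) = r \<odot>\<^bsub>M\<^esub> iso_inv M N f x" if "r \<in> carrier R"
      using i(1)[of "r \<odot>\<^bsub>M\<^esub> iso_inv M N f x"] f(3) i(2,3) x that c by simp
  qed (simp add: iso_inv_def)
  moreover have "bij_betw (iso_inv M N f) (carrier N) (carrier M)"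
    using i f(1) by (intro bij_betw_byWitness[where f' = f]) auto
  ultimately show ?thesis by (simp add: linear_isos_def)
qed

lemma linear_isos_compose:
  assumes "module R M" "f \<in> linear_isos R M N" "g \<in> linear_isos R N Q"
  shows "compose (carrier M) g f \<in> linear_isos R M Q"
  using linear_maps_compose[OF assms(1) linear_isosD(1)[OF assms(2)] linear_isosD(1)[OF assms(3)]]
    bij_betw_trans[OF linear_isosD(2)[OF assms(2)] linear_isosD(2)[OF assms(3)]]
  by (simp add: linear_isos_def compose_def bij_betw_def cong: inj_on_cong image_cong)

lemma iso_inv_image:
  assumes "f \<in> linear_isos R M N" "A \<subseteq> carrier M"
  shows "iso_inv M N f ` (f ` A) = A"
  using iso_inv_simps(1)[OF assms(1)] assms(2) by (force simp: image_image subset_iff)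

text \<open>Transport of structure along an injection \<open>j\<close> into \<open>'u\<close>, with
  inverse \<open>k\<close> on the carrier. Through such copies the dual of an object can become an
  object again.\<close>

lemma module_copy:
  fixes M :: "('a, 'v) module"
  assumes "module R M" "carrier M \<lesssim> (UNIV :: 'u set)"
  obtains N :: "('a, 'u) module" and \<theta> where "module R N" "\<theta> \<in> linear_isos R M N"
proof -
  interpret module R M by fact
  obtain j :: "'v \<Rightarrow> 'u" where j: "inj_on j (carrier M)" using assms(2) by (auto simp: lepoll_def)
  define k where "k = inv_into (carrier M) j"
  have k: "k (j x) = x" if "x \<in> carrier M" for x unfolding k_def using j that by simp
  define N :: "('a, 'u) module" where "N = \<lparr>carrier = j ` carrier M, monoid.mult = undefined, one = undefined,
    ring.zero = j \<zero>\<^bsub>M\<^esub>, add = (\<lambda>x y. j (k x \<oplus>\<^bsub>M\<^esub> k y)), smult = (\<lambda>r x. j (r \<odot>\<^bsub>M\<^esub> k x))\<rparr>"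
  have N: "module R N"
  proof (rule moduleI)
    show "cring R" by (rule R.cring_axioms)
    show "abelian_group N"
    proof (rule abelian_groupI)
      show "\<exists>y\<in>carrier N. y \<oplus>\<^bsub>N\<^esub> x = \<zero>\<^bsub>N\<^esub>" if "x \<in> carrier N" for x
        using that by (intro bexI[of _ "j (\<ominus>\<^bsub>M\<^esub> (k x))"]) (auto simp: N_def k M.l_neg)
    qed (auto simp: N_def k M.a_ac)
  qed (auto simp: N_def k smult_l_distr smult_r_distr smult_assoc1)
  have "(\<lambda>x\<in>carrier M. j x) \<in> linear_isos R M N"
    unfolding linear_isos_def using j
    by (auto intro!: linear_maps_restrictI[OF assms(1)] simp: N_def k bij_betw_def inj_on_def)
  with N that show ?thesis by blast
qed

section \<open>Ideals of a Noetherian local ring\<close>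

text \<open>In a Noetherian ring a nonempty chain of ideals contains its own union, so Zorn's lemma
  applies to every nonempty family. Later proofs use this to choose a maximal
  counterexample.\<close>

lemma (in noetherian_ring) maximal_ideal_in_family:
  assumes "F \<noteq> {}" "\<And>I. I \<in> F \<Longrightarrow> ideal I R"
  obtains I where "I \<in> F" "\<And>J. J \<in> F \<Longrightarrow> I \<subseteq> J \<Longrightarrow> J = I"
proof -
  have "\<exists>I\<in>F. \<forall>J\<in>F. I \<subseteq> J \<longrightarrow> J = I"
  proof (rule subset_Zorn)
    fix \<C> assume C: "subset.chain F \<C>"
    show "\<exists>U\<in>F. \<forall>I\<in>\<C>. I \<subseteq> U"
    proof (cases "\<C> = {}")
      case False
      have "subset.chain {I. ideal I R} \<C>"
        using C assms(2) by (auto simp: subset_chain_def)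
      then have "\<Union>\<C> \<in> \<C>" using ideal_chain_is_trivial False by blast
      then show ?thesis using C by (auto simp: subset_chain_def)
    qed (use assms(1) in auto)
  qed
  then show ?thesis using that by blast
qed

context complete_noetherian_local_ring
begin

lemma ideal_max: "ideal \<mm> R" using maximal by (rule maximalideal.axioms)

lemma max_closed: "a \<in> \<mm> \<Longrightarrow> a \<in> carrier R"
  using ideal.Icarr[OF ideal_max] .

lemma one_notin_max: "\<one> \<notin> \<mm>"
  using maximalideal.I_notcarr[OF maximal] ideal.one_imp_carrier[OF ideal_max] by auto

text \<open>An ideal that is maximal among those containing \<open>I\<close> and avoiding
  \<open>\<one>\<close> is a maximal ideal, hence equals \<open>\<mm>\<close>.\<close>

lemma ideal_subset_max:
  assumes "ideal I R" "\<one> \<notin> I"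
  shows "I \<subseteq> \<mm>"
proof -
  obtain J where J: "J \<in> {J. ideal J R \<and> I \<subseteq> J \<and> \<one> \<notin> J}"
      "\<And>K. K \<in> {J. ideal J R \<and> I \<subseteq> J \<and> \<one> \<notin> J} \<Longrightarrow> J \<subseteq> K \<Longrightarrow> K = J"
    using assms by (elim maximal_ideal_in_family[rotated 2]) auto
  have "maximalideal J R"
  proof (rule maximalidealI)
    show "ideal J R" "carrier R \<noteq> J" using J(1) by auto
    fix K assume K: "ideal K R" "J \<subseteq> K" "K \<subseteq> carrier R"
    show "K = J \<or> K = carrier R"
      using J(2)[of K] K J(1) ideal.one_imp_carrier[OF K(1)] by auto
  qed
  then show ?thesis using unique_maximal J(1) by auto
qed

lemma ideal_add_cgenideal:
  assumes "ideal J R" "t \<in> carrier R"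
  shows "ideal (J <+>\<^bsub>R\<^esub> PIdl t) R" "J \<subseteq> J <+>\<^bsub>R\<^esub> PIdl t" "t \<in> J <+>\<^bsub>R\<^esub> PIdl t"
    and "x \<in> J <+>\<^bsub>R\<^esub> PIdl t \<Longrightarrow> \<exists>j\<in>J. \<exists>a\<in>carrier R. x = j \<oplus> a \<otimes> t"
proof -
  have P: "ideal (PIdl t) R" using cgenideal_ideal assms by auto
  show "ideal (J <+>\<^bsub>R\<^esub> PIdl t) R" using add_ideals assms P by auto
  have 0: "\<zero> \<in> J" "\<zero> \<in> PIdl t" using assms P additive_subgroup.zero_closed ideal.axioms(1) by blast+
  show "J \<subseteq> J <+>\<^bsub>R\<^esub> PIdl t"
    using 0 ideal.Icarr[OF assms(1)] unfolding set_add_def' by force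
  show "t \<in> J <+>\<^bsub>R\<^esub> PIdl t"
    using 0 assms(2) cgenideal_self unfolding set_add_def' by force
  show "\<exists>j\<in>J. \<exists>a\<in>carrier R. x = j \<oplus> a \<otimes> t" if "x \<in> J <+>\<^bsub>R\<^esub> PIdl t"
    using that unfolding set_add_def' cgenideal_def by auto
qed

text \<open>The ideal \<open>\<mm> + (r)\<close> is strictly larger than \<open>\<mm>\<close>, so it
  contains \<open>\<one>\<close>. This expresses that \<open>R/\<mm>\<close> is a field.\<close>

lemma inverse_mod_max:
  assumes "r \<in> carrier R" "r \<notin> \<mm>"
  obtains b where "b \<in> carrier R" "\<one> \<ominus> b \<otimes> r \<in> \<mm>"
proof -
  note J = ideal_add_cgenideal[OF ideal_max assms(1)]
  have "\<one> \<in> \<mm> <+>\<^bsub>R\<^esub> PIdl r"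
    using maximalideal.I_maximal[OF maximal J(1,2)] J(3) assms ideal.Icarr[OF J(1)] by auto
  then obtain j a where ja: "j \<in> \<mm>" "a \<in> carrier R" "\<one> = j \<oplus> a \<otimes> r" using J(4) by blast
  then have "\<one> \<ominus> a \<otimes> r = j"
    using assms(1) max_closed[of j] by (simp add: a_minus_def a_assoc r_neg)
  with ja that show ?thesis by blast
qed

abbreviation pow :: "nat \<Rightarrow> 'a set" where
  "pow n \<equiv> \<mm> [^]\<^bsub>ideals_set R\<^esub> n"

lemma pow_simps: "pow 0 = carrier R" "pow (Suc n) = ideal_prod R (pow n) \<mm>"
  by (simp_all add: nat_pow_def ideals_set_def)

lemma ideal_pow: "ideal (pow n) R"
  by (induction n) (simp_all only: pow_simps oneideal ideal_prod_is_ideal ideal_max)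

lemma pow_closed: "a \<in> pow n \<Longrightarrow> a \<in> carrier R"
  using ideal.Icarr[OF ideal_pow] .

lemma pow_Suc_subset: "pow (Suc n) \<subseteq> pow n"
  using ideal_prod_inter[OF ideal_pow ideal_max, of n] unfolding pow_simps by blast

lemma pow_SucI: "a \<in> pow n \<Longrightarrow> b \<in> \<mm> \<Longrightarrow> a \<otimes> b \<in> pow (Suc n)"
  unfolding pow_simps by (rule ideal_prod.prod)

end

section \<open>The ring as a module over itself, cyclic submodules and colon ideals\<close>

lemma ring_module_simps [simp]:
  "carrier (ring_module R) = carrier R" "\<zero>\<^bsub>ring_module R\<^esub> = \<zero>\<^bsub>R\<^esub>"
  "x \<oplus>\<^bsub>ring_module R\<^esub> y = x \<oplus>\<^bsub>R\<^esub> y" "r \<odot>\<^bsub>ring_module R\<^esub> x = r \<otimes>\<^bsub>R\<^esub> x"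
  by (simp_all add: ring_module_def)

lemma (in cring) ring_module_module: "module R (ring_module R)"
proof (rule moduleI)
  show "abelian_group (ring_module R)"
    by (rule abelian_groupI) (auto simp: a_ac intro: l_neg)
qed (auto simp: l_distr r_distr m_assoc cring_axioms)

lemma (in cring) ideal_submodule: "ideal I R \<Longrightarrow> submodule I R (ring_module R)"
  by (rule submoduleI_closed[OF ring_module_module])
    (auto simp: ideal.Icarr additive_subgroup.zero_closed additive_subgroup.a_closed
      ideal.axioms ideal.I_l_closed)

lemma (in cring) submodule_cyclic:
  "module R M \<Longrightarrow> x \<in> carrier M \<Longrightarrow> submodule {r \<odot>\<^bsub>M\<^esub> x | r. r \<in> carrier R} R M"
proof (rule submoduleI_closed)
  assume M: "module R M" and x: "x \<in> carrier M"
  interpret M: module R M by fact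
  show "\<zero>\<^bsub>M\<^esub> \<in> {r \<odot>\<^bsub>M\<^esub> x | r. r \<in> carrier R}" using x by (auto intro!: exI[of _ \<zero>])
  show "y \<oplus>\<^bsub>M\<^esub> z \<in> {r \<odot>\<^bsub>M\<^esub> x | r. r \<in> carrier R}"
    if "y \<in> {r \<odot>\<^bsub>M\<^esub> x | r. r \<in> carrier R}" "z \<in> {r \<odot>\<^bsub>M\<^esub> x | r. r \<in> carrier R}" for y z
    using that x by (auto simp: M.smult_l_distr[symmetric])
  show "r \<odot>\<^bsub>M\<^esub> y \<in> {r \<odot>\<^bsub>M\<^esub> x | r. r \<in> carrier R}"
    if "r \<in> carrier R" "y \<in> {r \<odot>\<^bsub>M\<^esub> x | r. r \<in> carrier R}" for r y
    using that x by (auto simp: M.smult_assoc1[symmetric])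
qed (auto intro: module_closed)

text \<open>This is the colon ideal \<open>(V : x)\<close>; for \<open>V = 0\<close> it is the
  annihilator of \<open>x\<close>.\<close>

lemma (in cring) ideal_colon:
  assumes "module R M" "submodule V R M" "x \<in> carrier M"
  shows "ideal {r \<in> carrier R. r \<odot>\<^bsub>M\<^esub> x \<in> V} R"
proof -
  interpret M: module R M by fact
  note V = submoduleD[OF assms(1,2)]
  show ?thesis
  proof (rule idealI[OF ring_axioms])
    show "subgroup {r \<in> carrier R. r \<odot>\<^bsub>M\<^esub> x \<in> V} (add_monoid R)"
      using V assms(3) by (intro add.subgroupI)
        (auto simp: M.smult_l_distr M.smult_l_minus simp flip: a_inv_def intro!: exI[of _ \<zero>])
    show l: "b \<otimes> a \<in> {r \<in> carrier R. r \<odot>\<^bsub>M\<^esub> x \<in> V}"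
      if "a \<in> {r \<in> carrier R. r \<odot>\<^bsub>M\<^esub> x \<in> V}" "b \<in> carrier R" for a b
      using that V(7) assms(3) by (simp add: M.smult_assoc1)
    show "a \<otimes> b \<in> {r \<in> carrier R. r \<odot>\<^bsub>M\<^esub> x \<in> V}"
      if "a \<in> {r \<in> carrier R. r \<odot>\<^bsub>M\<^esub> x \<in> V}" "b \<in> carrier R" for a b
      using l[OF that] that by (simp add: m_comm)
  qed
qed

section \<open>The injective hull of the residue field\<close>

text \<open>
  \<open>u\<close> is the image of \<open>1\<close> under the essential embedding of the residue field, so it spans the socle
  of \<open>E\<close>.
\<close>

locale matlis = complete_noetherian_local_ring R \<mm> for R (structure) and \<mm> +
  fixes E :: "('a, 'u) module" and u :: 'u
  assumes infinite_universe: "infinite (UNIV :: 'u set)"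
    and ring_lepoll: "carrier R \<lesssim> (UNIV :: 'u set)"
    and injective: "injective_module R E"
    and u_closed: "u \<in> carrier E"
    and u_ann: "r \<in> carrier R \<Longrightarrow> r \<odot>\<^bsub>E\<^esub> u = \<zero>\<^bsub>E\<^esub> \<longleftrightarrow> r \<in> \<mm>"
    and u_essential: "submodule S R E \<Longrightarrow> S \<noteq> {\<zero>\<^bsub>E\<^esub>} \<Longrightarrow> u \<in> S"

text \<open>Trades the embedded residue field for the single element \<open>u\<close>, whose
  annihilator is \<open>\<mm>\<close> because the embedding is injective.\<close>

lemma matlis_exists:
  fixes R :: "('a, 'r) ring_scheme" and E :: "('a, 'u) module"
  assumes "infinite (UNIV :: 'u set)" "carrier R \<lesssim> (UNIV :: 'u set)"
    and "complete_noetherian_local_ring R \<mm>" "injective_hull R (residue_field R \<mm>) E"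
  obtains u where "matlis R \<mm> E u"
proof -
  interpret R: complete_noetherian_local_ring R \<mm> by fact
  let ?M = "ring_module R" and ?K = "residue_field R \<mm>"
  have M: "module R ?M" by (rule R.ring_module_module)
  interpret M: module R ?M by (rule M)
  note Q = quotient_module_simps[OF M R.ideal_submodule[OF R.ideal_max],
      folded residue_field_def, simplified]
  from assms(4) have inj: "injective_module R E" unfolding injective_hull_def by blast
  then have E: "module R E" unfolding injective_module_def by blast
  interpret E: module R E by fact
  from assms(4) obtain \<iota> where \<iota>: "\<iota> \<in> linear_maps R ?K E" "inj_on \<iota> (carrier ?K)"
      "\<And>S. submodule S R E \<Longrightarrow> S \<noteq> {\<zero>\<^bsub>E\<^esub>} \<Longrightarrow> S \<inter> \<iota> ` carrier ?K \<noteq> {\<zero>\<^bsub>E\<^esub>}"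
    unfolding injective_hull_def by blast
  define c where "c r = \<mm> +>\<^bsub>?M\<^esub> r" for r
  have c: "c r \<in> carrier ?K" if "r \<in> carrier R" for r using that Q(1) by (simp add: c_def)
  define u where "u = \<iota> (c \<one>\<^bsub>R\<^esub>)"
  have u: "u \<in> carrier E" unfolding u_def using linear_mapsD(2)[OF \<iota>(1) c] by simp
  have cu: "\<iota> (c r) = r \<odot>\<^bsub>E\<^esub> u" if "r \<in> carrier R" for r
    using linear_mapsD(4)[OF \<iota>(1) that c[OF R.one_closed]] Q(3)[OF that R.one_closed] that
    by (simp add: c_def u_def)
  have u_ann: "r \<odot>\<^bsub>E\<^esub> u = \<zero>\<^bsub>E\<^esub> \<longleftrightarrow> r \<in> \<mm>" if r: "r \<in> carrier R" for r
  proof -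
    have "r \<odot>\<^bsub>E\<^esub> u = \<zero>\<^bsub>E\<^esub> \<longleftrightarrow> \<iota> (c r) = \<iota> (c \<zero>\<^bsub>R\<^esub>)" using cu[OF r] cu[OF R.zero_closed] u by simp
    also have "\<dots> \<longleftrightarrow> c r = c \<zero>\<^bsub>R\<^esub>" using \<iota>(2) c r by (auto dest: inj_onD)
    also have "\<dots> \<longleftrightarrow> r \<ominus>\<^bsub>?M\<^esub> \<zero>\<^bsub>?M\<^esub> \<in> \<mm>" using Q(4)[OF r R.zero_closed] by (simp add: c_def)
    also have "\<ominus>\<^bsub>?M\<^esub> \<zero>\<^bsub>?M\<^esub> = \<zero>\<^bsub>?M\<^esub>" by (rule M.M.minus_equality) auto
    then have "r \<ominus>\<^bsub>?M\<^esub> \<zero>\<^bsub>?M\<^esub> = r" using r by (simp add: a_minus_def)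
    finally show ?thesis .
  qed
  have "u \<in> S" if S: "submodule S R E" "S \<noteq> {\<zero>\<^bsub>E\<^esub>}" for S
  proof -
    note SD = submoduleD[OF E S(1)]
    have "\<zero>\<^bsub>E\<^esub> \<in> S \<inter> \<iota> ` carrier ?K"
      using SD(3) cu[OF R.zero_closed] c[OF R.zero_closed] u by (auto intro: rev_image_eqI)
    then obtain y where y: "y \<in> S" "y \<noteq> \<zero>\<^bsub>E\<^esub>" "y \<in> \<iota> ` carrier ?K" using \<iota>(3)[OF S] by blast
    then obtain r where r: "r \<in> carrier R" "y = r \<odot>\<^bsub>E\<^esub> u" using Q(1) cu by (auto simp: c_def)
    \<comment> \<open>Since \<open>y = r u\<close> is nonzero, \<open>r\<close> lies outside
      \<open>\<mm>\<close> and has an inverse \<open>b\<close> modulo \<open>\<mm>\<close>. As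
      \<open>\<mm>\<close> kills \<open>u\<close>, the multiple \<open>b y\<close> is
      \<open>u\<close>.\<close>
    then obtain b where b: "b \<in> carrier R" "\<one>\<^bsub>R\<^esub> \<ominus>\<^bsub>R\<^esub> b \<otimes>\<^bsub>R\<^esub> r \<in> \<mm>"
      using u_ann y(2) R.inverse_mod_max by metis
    have "u = (\<one>\<^bsub>R\<^esub> \<ominus>\<^bsub>R\<^esub> b \<otimes>\<^bsub>R\<^esub> r) \<odot>\<^bsub>E\<^esub> u \<oplus>\<^bsub>E\<^esub> b \<odot>\<^bsub>E\<^esub> y"
      using b r u by (simp add: a_minus_def E.smult_l_distr E.smult_l_minus E.smult_assoc1
          E.M.a_assoc E.M.l_neg)
    also have "\<dots> = b \<odot>\<^bsub>E\<^esub> y" using u_ann b r u by simp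
    finally show "u \<in> S" using SD(7) b(1) y(1) by metis
  qed
  then have "matlis R \<mm> E u"
    using assms inj u u_ann by (intro matlis.intro) (auto simp: matlis_axioms_def)
  then show ?thesis using that by blast
qed

context matlis
begin

lemma E_module: "module R E"
  using injective unfolding injective_module_def by blast

sublocale E: module R E by (rule E_module)

section \<open>The socle of \<open>E\<close>, and separation by functionals into
  \<open>E\<close>\<close>

lemma u_nonzero: "u \<noteq> \<zero>\<^bsub>E\<^esub>"
  using u_ann[of \<one>] one_notin_max u_closed by auto

text \<open>An element killed by \<open>\<mm>\<close> is a vector over the residue field, on which
  \<open>r\<close> acts invertibly.\<close>

lemma smult_inverse_mod_max:
  assumes "r \<in> carrier R" "r \<notin> \<mm>" "w \<in> carrier E" "\<And>a. a \<in> \<mm> \<Longrightarrow> a \<odot>\<^bsub>E\<^esub> w = \<zero>\<^bsub>E\<^esub>"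
  obtains b where "b \<in> carrier R" "w = b \<odot>\<^bsub>E\<^esub> (r \<odot>\<^bsub>E\<^esub> w)"
proof -
  obtain b where b: "b \<in> carrier R" "\<one> \<ominus> b \<otimes> r \<in> \<mm>" using assms inverse_mod_max by metis
  have "w = (\<one> \<ominus> b \<otimes> r) \<odot>\<^bsub>E\<^esub> w \<oplus>\<^bsub>E\<^esub> b \<odot>\<^bsub>E\<^esub> (r \<odot>\<^bsub>E\<^esub> w)"
    using b assms(1,3) by (simp add: a_minus_def E.smult_l_distr E.smult_l_minus E.smult_assoc1
          E.M.a_assoc E.M.l_neg)
  also have "\<dots> = b \<odot>\<^bsub>E\<^esub> (r \<odot>\<^bsub>E\<^esub> w)" using assms b by simp
  finally show ?thesis using that b by blast
qed

lemma u_in_cyclic: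
  assumes "x \<in> carrier E" "x \<noteq> \<zero>\<^bsub>E\<^esub>"
  obtains a where "a \<in> carrier R" "u = a \<odot>\<^bsub>E\<^esub> x"
proof -
  have "x \<in> {r \<odot>\<^bsub>E\<^esub> x | r. r \<in> carrier R}" using assms(1) by (auto intro!: exI[of _ \<one>])
  then have "u \<in> {r \<odot>\<^bsub>E\<^esub> x | r. r \<in> carrier R}"
    using assms by (intro u_essential submodule_cyclic[OF E_module]) auto
  then show ?thesis using that by blast
qed

text \<open>The socle of \<open>E\<close> is a line over the residue field, spanned by
  \<open>u\<close>: a scalar taking a nonzero socle element \<open>w\<close> to \<open>u\<close>
  lies outside \<open>\<mm>\<close>, so it can be inverted and \<open>w\<close> is a multiple of
  \<open>u\<close>. In turn \<open>u\<close> is a multiple of every nonzero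
  \<open>v\<close>.\<close>

lemma socle_cyclic:
  assumes v: "v \<in> carrier E" "v \<noteq> \<zero>\<^bsub>E\<^esub>"
    and w: "w \<in> carrier E" "\<And>a. a \<in> \<mm> \<Longrightarrow> a \<odot>\<^bsub>E\<^esub> w = \<zero>\<^bsub>E\<^esub>"
  obtains s where "s \<in> carrier R" "w = s \<odot>\<^bsub>E\<^esub> v"
proof (cases "w = \<zero>\<^bsub>E\<^esub>")
  case True
  then show ?thesis using that[of \<zero>] v by simp
next
  case False
  obtain a where a: "a \<in> carrier R" "u = a \<odot>\<^bsub>E\<^esub> v" using u_in_cyclic v by blast
  obtain b where b: "b \<in> carrier R" "u = b \<odot>\<^bsub>E\<^esub> w" using u_in_cyclic w(1) False by blast
  have "b \<notin> \<mm>" using w(2)[of b] b u_nonzero by auto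
  then obtain d where "d \<in> carrier R" "w = d \<odot>\<^bsub>E\<^esub> (b \<odot>\<^bsub>E\<^esub> w)"
    using smult_inverse_mod_max[OF b(1) _ w] by blast
  then show ?thesis using that[of "d \<otimes> a"] a b v by (simp add: E.smult_assoc1)
qed

text \<open>The map sending \<open>v + r x\<close> to \<open>r u\<close> on the submodule
  \<open>V + R x\<close> kills \<open>V\<close> but not \<open>x\<close>, and injectivity of
  \<open>E\<close> extends it to \<open>M\<close>.\<close>

lemma cogenerator:
  fixes M :: "('a, 'u) module"
  assumes "module R M" "submodule V R M" "x \<in> carrier M" "x \<notin> V"
  shows "\<exists>f\<in>linear_maps R M E. (\<forall>v\<in>V. f v = \<zero>\<^bsub>E\<^esub>) \<and> f x \<noteq> \<zero>\<^bsub>E\<^esub>"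
proof -
  interpret M: module R M by fact
  note V = submoduleD[OF assms(1,2)]
  \<comment> \<open>The colon ideal \<open>(V : x)\<close> is proper because \<open>x\<close> is
    outside \<open>V\<close>, so it lies in \<open>\<mm>\<close>. This makes the map above well
    defined, as \<open>\<mm>\<close> kills \<open>u\<close>.\<close>
  have I: "r \<in> \<mm>" if r: "r \<in> carrier R" "r \<odot>\<^bsub>M\<^esub> x \<in> V" for r
  proof (rule ccontr)
    assume "r \<notin> \<mm>"
    let ?I = "{r \<in> carrier R. r \<odot>\<^bsub>M\<^esub> x \<in> V}"
    have "ideal ?I R" using assms(1-3) by (rule ideal_colon)
    then have "?I \<subseteq> \<mm>" using assms(3,4) by (intro ideal_subset_max) auto
    then show False using r \<open>r \<notin> \<mm>\<close> by blast
  qed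
  define S where "S = {(v \<oplus>\<^bsub>M\<^esub> r \<odot>\<^bsub>M\<^esub> x, r \<odot>\<^bsub>E\<^esub> u) | v r. v \<in> V \<and> r \<in> carrier R}"
  have "\<exists>f\<in>linear_maps R M E. \<forall>y e. (y, e) \<in> S \<longrightarrow> f y = e"
  proof (rule injective_extend_graph[OF injective assms(1), of S])
    show "S \<subseteq> carrier M \<times> carrier E" unfolding S_def using V(2) assms(3) u_closed by auto
    show "(\<zero>\<^bsub>M\<^esub>, \<zero>\<^bsub>E\<^esub>) \<in> S" unfolding S_def using V(3) assms(3) u_closed
      by (auto intro!: exI[of _ "\<zero>\<^bsub>M\<^esub>"] exI[of _ \<zero>])
  next
    fix y e y' e' assume "(y, e) \<in> S" "(y', e') \<in> S"
    then obtain v r v' r' where *: "y = v \<oplus>\<^bsub>M\<^esub> r \<odot>\<^bsub>M\<^esub> x" "e = r \<odot>\<^bsub>E\<^esub> u" "v \<in> V" "r \<in> carrier R"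
      "y' = v' \<oplus>\<^bsub>M\<^esub> r' \<odot>\<^bsub>M\<^esub> x" "e' = r' \<odot>\<^bsub>E\<^esub> u" "v' \<in> V" "r' \<in> carrier R" unfolding S_def by auto
    then have "y \<oplus>\<^bsub>M\<^esub> y' = (v \<oplus>\<^bsub>M\<^esub> v') \<oplus>\<^bsub>M\<^esub> (r \<oplus> r') \<odot>\<^bsub>M\<^esub> x" "e \<oplus>\<^bsub>E\<^esub> e' = (r \<oplus> r') \<odot>\<^bsub>E\<^esub> u"
      using V(2) assms(3) u_closed by (simp_all add: M.smult_l_distr E.smult_l_distr M.M.a_ac)
    then show "(y \<oplus>\<^bsub>M\<^esub> y', e \<oplus>\<^bsub>E\<^esub> e') \<in> S"
      unfolding S_def using * V(4) by blast
  next
    fix a y e assume a: "a \<in> carrier R" "(y, e) \<in> S"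
    then obtain v r where *: "y = v \<oplus>\<^bsub>M\<^esub> r \<odot>\<^bsub>M\<^esub> x" "e = r \<odot>\<^bsub>E\<^esub> u" "v \<in> V" "r \<in> carrier R"
      unfolding S_def by auto
    then have "a \<odot>\<^bsub>M\<^esub> y = a \<odot>\<^bsub>M\<^esub> v \<oplus>\<^bsub>M\<^esub> (a \<otimes> r) \<odot>\<^bsub>M\<^esub> x" "a \<odot>\<^bsub>E\<^esub> e = (a \<otimes> r) \<odot>\<^bsub>E\<^esub> u"
      using a V(2) assms(3) u_closed by (simp_all add: M.smult_r_distr M.smult_assoc1 E.smult_assoc1)
    then show "(a \<odot>\<^bsub>M\<^esub> y, a \<odot>\<^bsub>E\<^esub> e) \<in> S"
      unfolding S_def using * V(7) a(1) by blast
  next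
    fix e assume "(\<zero>\<^bsub>M\<^esub>, e) \<in> S"
    then obtain v r where *: "\<zero>\<^bsub>M\<^esub> = v \<oplus>\<^bsub>M\<^esub> r \<odot>\<^bsub>M\<^esub> x" "e = r \<odot>\<^bsub>E\<^esub> u" "v \<in> V" "r \<in> carrier R"
      unfolding S_def by auto
    then have "r \<odot>\<^bsub>M\<^esub> x = \<ominus>\<^bsub>M\<^esub> v"
      using V(2) assms(3) by (metis M.M.minus_equality M.M.minus_minus M.smult_closed M.M.a_comm)
    then have "r \<in> \<mm>" using I * V(6) by simp
    then show "e = \<zero>\<^bsub>E\<^esub>" using * u_ann by simp
  qed
  then obtain f where f: "f \<in> linear_maps R M E" "\<And>y e. (y, e) \<in> S \<Longrightarrow> f y = e" by blast
  show ?thesis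
  proof (intro bexI[OF _ f(1)] conjI ballI)
    show "f v = \<zero>\<^bsub>E\<^esub>" if "v \<in> V" for v
    proof (rule f(2))
      have "v = v \<oplus>\<^bsub>M\<^esub> \<zero> \<odot>\<^bsub>M\<^esub> x" "\<zero>\<^bsub>E\<^esub> = \<zero> \<odot>\<^bsub>E\<^esub> u" using V(2) that assms(3) u_closed by auto
      then show "(v, \<zero>\<^bsub>E\<^esub>) \<in> S" unfolding S_def using that by blast
    qed
    have "f x = u"
    proof (rule f(2))
      have "x = \<zero>\<^bsub>M\<^esub> \<oplus>\<^bsub>M\<^esub> \<one> \<odot>\<^bsub>M\<^esub> x" "u = \<one> \<odot>\<^bsub>E\<^esub> u" using assms(3) u_closed by auto
      then show "(x, u) \<in> S" unfolding S_def using V(3) by blast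
    qed
    then show "f x \<noteq> \<zero>\<^bsub>E\<^esub>" using u_nonzero by simp
  qed
qed

text \<open>Transfers \<open>cogenerator\<close> to modules over other types through a copy over
  \<open>'u\<close>. In \<open>endo_scalar\<close> it is applied to \<open>R\<close> itself, whose
  elements have type \<open>'a\<close>.\<close>

lemma cogenerator_lepoll:
  fixes M :: "('a, 'v) module"
  assumes "module R M" "carrier M \<lesssim> (UNIV :: 'u set)" "submodule V R M" "x \<in> carrier M" "x \<notin> V"
  shows "\<exists>f\<in>linear_maps R M E. (\<forall>v\<in>V. f v = \<zero>\<^bsub>E\<^esub>) \<and> f x \<noteq> \<zero>\<^bsub>E\<^esub>"
proof -
  obtain N :: "('a, 'u) module" and \<theta> where N: "module R N" and \<theta>: "\<theta> \<in> linear_isos R M N"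
    using module_copy[OF assms(1,2)] .
  note V = submoduleD[OF assms(1,3)]
  note \<theta>D = linear_isosD[OF \<theta>]
  have x: "\<theta> x \<in> carrier N" using linear_mapsD(2)[OF \<theta>D(1) assms(4)] .
  have xV: "\<theta> x \<notin> \<theta> ` V" using inj_onD[OF \<theta>D(3) _ assms(4) V(2)] assms(5) by auto
  obtain f where f: "f \<in> linear_maps R N E" "\<forall>v\<in>\<theta> ` V. f v = \<zero>\<^bsub>E\<^esub>" "f (\<theta> x) \<noteq> \<zero>\<^bsub>E\<^esub>"
    using cogenerator[OF N submodule_image[OF assms(1) N \<theta>D(1) assms(3)] x xV] by blast
  show ?thesis
    using f V(2) assms(4)
    by (intro bexI[OF _ linear_maps_compose[OF assms(1) \<theta>D(1) f(1)]]) (auto simp: compose_def)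
qed

section \<open>Torsion in \<open>E\<close>, and endomorphisms of \<open>E\<close> as scalars\<close>

lemma submodule_annihilated:
  assumes "ideal J R"
  shows "submodule {e \<in> carrier E. \<forall>a\<in>J. a \<odot>\<^bsub>E\<^esub> e = \<zero>\<^bsub>E\<^esub>} R E"
  using ideal.Icarr[OF assms]
  by (intro submoduleI_closed[OF E_module]) (auto simp: E.smult_r_distr E.smult_commute)

text \<open>Among the elements that no power of \<open>\<mm>\<close> kills, take \<open>y\<close>
  with maximal annihilator. Every \<open>r y\<close> with \<open>r\<close> in \<open>\<mm>\<close>
  is killed by some power, finite generation of \<open>\<mm>\<close> gives a common exponent, and
  one more power then kills \<open>y\<close>.\<close>

lemma killed_by_pow:
  assumes "x \<in> carrier E"
  shows "\<exists>n. \<forall>a\<in>pow n. a \<odot>\<^bsub>E\<^esub> x = \<zero>\<^bsub>E\<^esub>"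
proof (rule ccontr)
  define good where "good y \<longleftrightarrow> (\<exists>n. \<forall>a\<in>pow n. a \<odot>\<^bsub>E\<^esub> y = \<zero>\<^bsub>E\<^esub>)" for y
  define ann where "ann y = {r \<in> carrier R. r \<odot>\<^bsub>E\<^esub> y = \<zero>\<^bsub>E\<^esub>}" for y
  have ideal_ann: "ideal (ann y) R" if "y \<in> carrier E" for y
    using ideal_colon[OF E_module submodule_zero[OF E_module] that] by (simp add: ann_def)
  assume "\<nexists>n. \<forall>a\<in>pow n. a \<odot>\<^bsub>E\<^esub> x = \<zero>\<^bsub>E\<^esub>"
  then have "ann x \<in> {ann y | y. y \<in> carrier E \<and> \<not> good y}" using assms unfolding good_def by blast
  then obtain I where I: "I \<in> {ann y | y. y \<in> carrier E \<and> \<not> good y}"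
      "\<And>J. J \<in> {ann y | y. y \<in> carrier E \<and> \<not> good y} \<Longrightarrow> I \<subseteq> J \<Longrightarrow> J = I"
    using ideal_ann by (elim maximal_ideal_in_family[rotated 2]) auto
  then obtain y where y: "y \<in> carrier E" "\<not> good y" "I = ann y" by blast
  have "y \<noteq> \<zero>\<^bsub>E\<^esub>" using y(2) pow_closed unfolding good_def by auto
  then obtain a where a: "a \<in> carrier R" "u = a \<odot>\<^bsub>E\<^esub> y" using u_in_cyclic y(1) by blast
  \<comment> \<open>By maximality multiplication by a bad \<open>r \<in> \<mm>\<close> would be injective on \<open>R y\<close>, but it kills \<open>u\<close>.\<close>
  have good: "good (r \<odot>\<^bsub>E\<^esub> y)" if r: "r \<in> \<mm>" for r
  proof (rule ccontr)
    assume bad: "\<not> good (r \<odot>\<^bsub>E\<^esub> y)"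
    have rR: "r \<in> carrier R" using r max_closed by blast
    have comm: "b \<odot>\<^bsub>E\<^esub> (r \<odot>\<^bsub>E\<^esub> y) = r \<odot>\<^bsub>E\<^esub> (b \<odot>\<^bsub>E\<^esub> y)" if "b \<in> carrier R" for b
      using that rR y(1) by (rule E.smult_commute)
    have "ann y \<subseteq> ann (r \<odot>\<^bsub>E\<^esub> y)" using comm rR by (auto simp: ann_def)
    then have "ann (r \<odot>\<^bsub>E\<^esub> y) = ann y" using I(2) y bad rR by blast
    moreover have "a \<in> ann (r \<odot>\<^bsub>E\<^esub> y)"
      using comm[OF a(1)] a u_ann[OF rR] r by (simp add: ann_def)
    ultimately show False using a u_nonzero by (simp add: ann_def)
  qed
  \<comment> \<open>Finitely many generators of \<open>\<mm>\<close> allow a single exponent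
    \<open>N\<close> to serve all of them, since the powers decrease.\<close>
  obtain A where A: "A \<subseteq> carrier R" "finite A" "\<mm> = Idl A" using finetely_gen[OF ideal_max] by blast
  have A_max: "A \<subseteq> \<mm>" using A(1,3) genideal_self by blast
  have "\<exists>N. \<forall>r\<in>A. \<forall>a\<in>pow N. a \<odot>\<^bsub>E\<^esub> (r \<odot>\<^bsub>E\<^esub> y) = \<zero>\<^bsub>E\<^esub>"
    using A(2) A_max
  proof (induction A)
    case (insert r A)
    then obtain N where N: "\<forall>r\<in>A. \<forall>a\<in>pow N. a \<odot>\<^bsub>E\<^esub> (r \<odot>\<^bsub>E\<^esub> y) = \<zero>\<^bsub>E\<^esub>" by auto
    obtain n where n: "\<forall>a\<in>pow n. a \<odot>\<^bsub>E\<^esub> (r \<odot>\<^bsub>E\<^esub> y) = \<zero>\<^bsub>E\<^esub>" using good insert.prems unfolding good_def by blast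
    have "pow (max N n) \<subseteq> pow N" "pow (max N n) \<subseteq> pow n"
      using lift_Suc_antimono_le[of pow, OF pow_Suc_subset] by auto
    with N n show ?case by blast
  qed simp
  then obtain N where N: "\<forall>r\<in>A. \<forall>a\<in>pow N. a \<odot>\<^bsub>E\<^esub> (r \<odot>\<^bsub>E\<^esub> y) = \<zero>\<^bsub>E\<^esub>" by blast
  define W where "W = {e \<in> carrier E. \<forall>a\<in>pow N. a \<odot>\<^bsub>E\<^esub> e = \<zero>\<^bsub>E\<^esub>}"
  have W: "submodule W R E" unfolding W_def by (rule submodule_annihilated[OF ideal_pow])
  \<comment> \<open>The colon ideal \<open>(W : y)\<close> contains the generators of
    \<open>\<mm>\<close>, hence all of \<open>\<mm>\<close>.\<close>
  have "\<mm> \<subseteq> {r \<in> carrier R. r \<odot>\<^bsub>E\<^esub> y \<in> W}"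
    unfolding A(3) using A(1) N y(1)
    by (intro genideal_minimal ideal_colon[OF E_module W y(1)]) (auto simp: W_def)
  then have Wy: "a \<odot>\<^bsub>E\<^esub> (r \<odot>\<^bsub>E\<^esub> y) = \<zero>\<^bsub>E\<^esub>" if "a \<in> pow N" "r \<in> \<mm>" for a r
    using that by (auto simp: W_def)
  \<comment> \<open>Induction over the ideal product, whose elements arise by sums from products
    \<open>i j\<close> with \<open>i\<close> in \<open>pow N\<close> and \<open>j\<close> in
    \<open>\<mm>\<close>.\<close>
  have "c \<odot>\<^bsub>E\<^esub> y = \<zero>\<^bsub>E\<^esub> \<and> c \<in> carrier R" if "c \<in> pow (Suc N)" for c
    using that unfolding pow_simps(2)
  proof (induction c)
    case (prod i j)
    then show ?case using Wy[of i j] y(1) pow_closed[of i] max_closed by (simp add: E.smult_assoc1)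
  next
    case (sum s t)
    then show ?case using y(1) by (simp add: E.smult_l_distr)
  qed
  then have "good y" unfolding good_def by blast
  with y(2) show False by blast
qed

text \<open>Write \<open>E[K]\<close> for the elements killed by \<open>K\<close>, and let
  \<open>K\<close> be a maximal counterexample. Choose \<open>t\<close> outside \<open>K\<close>
  with \<open>t \<mm> \<subseteq> K\<close>. A scalar \<open>r\<close> describes \<open>h\<close> on
  \<open>E[K + (t)]\<close>, the part of \<open>E[K]\<close> killed by \<open>t\<close>. On
  \<open>E[K]\<close> the error \<open>h - r\<close> is controlled by the socle, which is a line,
  and is corrected by a multiple of \<open>t\<close>.\<close>

lemma endo_scalar_on_ann:
  assumes h: "h \<in> linear_maps R E E" and "ideal J R" "pow n \<subseteq> J"
  shows "\<exists>r\<in>carrier R. \<forall>e\<in>carrier E. (\<forall>a\<in>J. a \<odot>\<^bsub>E\<^esub> e = \<zero>\<^bsub>E\<^esub>) \<longrightarrow> h e = r \<odot>\<^bsub>E\<^esub> e"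
proof (rule ccontr)
  note hD = linear_mapsD(2-)[OF h]
  define good where "good J \<longleftrightarrow> (\<exists>r\<in>carrier R. \<forall>e\<in>carrier E. (\<forall>a\<in>J. a \<odot>\<^bsub>E\<^esub> e = \<zero>\<^bsub>E\<^esub>) \<longrightarrow> h e = r \<odot>\<^bsub>E\<^esub> e)" for J
  define F where "F = {J. ideal J R \<and> pow n \<subseteq> J \<and> \<not> good J}"
  assume "\<not> ?thesis"
  then have "J \<in> F" using assms unfolding good_def F_def by blast
  then obtain K where K: "K \<in> F" "\<And>J. J \<in> F \<Longrightarrow> K \<subseteq> J \<Longrightarrow> J = K"
    by (elim maximal_ideal_in_family[rotated 2]) (auto simp: F_def)
  have KI: "ideal K R" and Kn: "pow n \<subseteq> K" and bad: "\<not> good K" using K(1) by (auto simp: F_def)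
  have "\<one> \<notin> K"
  proof
    assume "\<one> \<in> K"
    then have "e = \<zero>\<^bsub>E\<^esub>" if "e \<in> carrier E" "\<forall>a\<in>K. a \<odot>\<^bsub>E\<^esub> e = \<zero>\<^bsub>E\<^esub>" for e
      using that by (metis E.smult_one)
    moreover have "h \<zero>\<^bsub>E\<^esub> = \<zero> \<odot>\<^bsub>E\<^esub> \<zero>\<^bsub>E\<^esub>" using linear_maps_zero[OF E_module E_module h] by simp
    ultimately have "good K" unfolding good_def using zero_closed by metis
    with bad show False by blast
  qed
  then have "\<not> pow 0 \<subseteq> K" unfolding pow_simps by blast
  \<comment> \<open>The least power inside \<open>K\<close> is not the zeroth, as
    \<open>\<one>\<close> is outside \<open>K\<close>. An element \<open>t\<close> of the previous
    power that avoids \<open>K\<close> then represents a nonzero socle element of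
    \<open>R/K\<close>.\<close>
  define i where "i = (LEAST i. pow i \<subseteq> K)"
  have i: "pow i \<subseteq> K" unfolding i_def by (rule LeastI[of "\<lambda>i. pow i \<subseteq> K", OF Kn])
  then have "i \<noteq> 0" using \<open>\<not> pow 0 \<subseteq> K\<close> by (intro notI) (simp only:)
  then obtain k where k: "i = Suc k" using not0_implies_Suc by blast
  then have "\<not> pow k \<subseteq> K" using not_less_Least[of k "\<lambda>i. pow i \<subseteq> K", folded i_def] by simp
  then obtain t where t: "t \<in> pow k" "t \<notin> K" by blast
  have tR: "t \<in> carrier R" using t(1) pow_closed by blast
  have tm: "t \<otimes> a \<in> K" if "a \<in> \<mm>" for a using pow_SucI[OF t(1) that] i unfolding k by blast
  note L = ideal_add_cgenideal[OF KI tR]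
  have "good (K <+>\<^bsub>R\<^esub> PIdl t)"
    using K(2)[of "K <+>\<^bsub>R\<^esub> PIdl t"] L(1-3) t(2) Kn unfolding F_def by blast
  then obtain r where r: "r \<in> carrier R"
      "\<And>e. e \<in> carrier E \<Longrightarrow> \<forall>a\<in>K <+>\<^bsub>R\<^esub> PIdl t. a \<odot>\<^bsub>E\<^esub> e = \<zero>\<^bsub>E\<^esub> \<Longrightarrow> h e = r \<odot>\<^bsub>E\<^esub> e"
    unfolding good_def by blast
  define EK where "EK = {e \<in> carrier E. \<forall>a\<in>K. a \<odot>\<^bsub>E\<^esub> e = \<zero>\<^bsub>E\<^esub>}"
  have KR: "a \<in> carrier R" if "a \<in> K" for a using ideal.Icarr[OF KI that] .
  have EK: "submodule EK R E" unfolding EK_def by (rule submodule_annihilated[OF KI])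
  note EKD = submoduleD[OF E_module EK]
  have rt: "h e = r \<odot>\<^bsub>E\<^esub> e" if e: "e \<in> EK" "t \<odot>\<^bsub>E\<^esub> e = \<zero>\<^bsub>E\<^esub>" for e
  proof (rule r(2))
    show "\<forall>a\<in>K <+>\<^bsub>R\<^esub> PIdl t. a \<odot>\<^bsub>E\<^esub> e = \<zero>\<^bsub>E\<^esub>"
    proof
      fix x assume "x \<in> K <+>\<^bsub>R\<^esub> PIdl t"
      then obtain j a where ja: "j \<in> K" "a \<in> carrier R" "x = j \<oplus> a \<otimes> t" using L(4) by blast
      moreover have "j \<odot>\<^bsub>E\<^esub> e = \<zero>\<^bsub>E\<^esub>" using e(1) ja(1) unfolding EK_def by blast
      ultimately show "x \<odot>\<^bsub>E\<^esub> e = \<zero>\<^bsub>E\<^esub>"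
        using e(2) EKD(2)[OF e(1)] KR[OF ja(1)] tR by (simp add: E.smult_l_distr E.smult_assoc1)
    qed
  qed (rule EKD(2)[OF e(1)])
  have "good K"
  proof (cases "\<exists>e\<in>EK. t \<odot>\<^bsub>E\<^esub> e \<noteq> \<zero>\<^bsub>E\<^esub>")
    \<comment> \<open>If \<open>t\<close> kills \<open>E[K]\<close>, then \<open>E[K]\<close> equals
      \<open>E[K + (t)]\<close> and \<open>r\<close> already works.\<close>
    case False
    then show ?thesis using rt r(1) unfolding good_def EK_def by blast
  next
    case True
    \<comment> \<open>Both \<open>t e0\<close> and the error \<open>d e0\<close> lie in the socle:
      multiplying either by \<open>\<mm>\<close> gives zero, for the error because \<open>t\<close>
      kills \<open>\<mm> e0\<close>. As \<open>t e0\<close> is nonzero,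
      \<open>d e0 = s (t e0)\<close> for some \<open>s\<close>.\<close>
    then obtain e0 where e0: "e0 \<in> EK" "t \<odot>\<^bsub>E\<^esub> e0 \<noteq> \<zero>\<^bsub>E\<^esub>" by blast
    define d where "d e = h e \<ominus>\<^bsub>E\<^esub> r \<odot>\<^bsub>E\<^esub> e" for e
    have dE: "d e \<in> carrier E" if "e \<in> carrier E" for e using that hD r(1) by (simp add: d_def)
    have dscal: "d (a \<odot>\<^bsub>E\<^esub> e) = a \<odot>\<^bsub>E\<^esub> d e" if "a \<in> carrier R" "e \<in> carrier E" for a e
      using that hD r(1)
      by (simp add: d_def a_minus_def E.smult_r_distr E.smult_r_minus E.smult_assoc1[symmetric] m_comm)
    have d0: "d e = \<zero>\<^bsub>E\<^esub>" if "e \<in> EK" "t \<odot>\<^bsub>E\<^esub> e = \<zero>\<^bsub>E\<^esub>" for e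
      using rt[OF that] EKD(2)[OF that(1)] r(1) by (simp add: d_def a_minus_def E.M.r_neg)
    have tsoc: "a \<odot>\<^bsub>E\<^esub> (t \<odot>\<^bsub>E\<^esub> e) = \<zero>\<^bsub>E\<^esub>" if "a \<in> \<mm>" "e \<in> EK" for a e
    proof -
      have "(t \<otimes> a) \<odot>\<^bsub>E\<^esub> e = \<zero>\<^bsub>E\<^esub>" using tm[OF that(1)] that(2) unfolding EK_def by blast
      then show ?thesis
        using that(1) EKD(2)[OF that(2)] tR max_closed[OF that(1)]
        by (simp add: E.smult_assoc1[symmetric] m_comm)
    qed
    have "a \<odot>\<^bsub>E\<^esub> d e0 = \<zero>\<^bsub>E\<^esub>" if a: "a \<in> \<mm>" for a
    proof -
      have "t \<odot>\<^bsub>E\<^esub> (a \<odot>\<^bsub>E\<^esub> e0) = \<zero>\<^bsub>E\<^esub>"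
        using tsoc[OF a e0(1)] EKD(2)[OF e0(1)] tR max_closed[OF a] by (simp add: E.smult_commute)
      then show ?thesis
        using d0[of "a \<odot>\<^bsub>E\<^esub> e0"] EKD(7)[OF max_closed[OF a] e0(1)]
          dscal[OF max_closed[OF a] EKD(2)[OF e0(1)]] by simp
    qed
    then obtain s where s: "s \<in> carrier R" "d e0 = s \<odot>\<^bsub>E\<^esub> (t \<odot>\<^bsub>E\<^esub> e0)"
      using socle_cyclic[of "t \<odot>\<^bsub>E\<^esub> e0" "d e0"] e0 EKD(2) dE tR by blast
    have "h e = (r \<oplus> s \<otimes> t) \<odot>\<^bsub>E\<^esub> e" if e: "e \<in> EK" for e
    proof -
      \<comment> \<open>The element \<open>t e\<close> lies on the line spanned by
        \<open>t e0\<close>. Hence \<open>e - a e0\<close> is killed by \<open>t\<close>, so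
        \<open>h\<close> acts on it by \<open>r\<close>, while \<open>h e0\<close> is
        \<open>(r + s t) e0\<close>.\<close>
      obtain a where a: "a \<in> carrier R" "t \<odot>\<^bsub>E\<^esub> e = a \<odot>\<^bsub>E\<^esub> (t \<odot>\<^bsub>E\<^esub> e0)"
        using socle_cyclic[of "t \<odot>\<^bsub>E\<^esub> e0" "t \<odot>\<^bsub>E\<^esub> e"] e0 e EKD(2) tR tsoc[OF _ e] by blast
      note c = EKD(2)[OF e] EKD(2)[OF e0(1)] a(1) tR s(1) r(1)
      let ?f = "e \<ominus>\<^bsub>E\<^esub> a \<odot>\<^bsub>E\<^esub> e0"
      have ta: "t \<odot>\<^bsub>E\<^esub> (a \<odot>\<^bsub>E\<^esub> e0) = t \<odot>\<^bsub>E\<^esub> e" using c a(2) by (simp add: E.smult_commute)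
      have "t \<odot>\<^bsub>E\<^esub> ?f = \<zero>\<^bsub>E\<^esub>"
        using ta c by (simp add: a_minus_def E.smult_r_distr E.smult_r_minus E.M.r_neg)
      moreover have fEK: "?f \<in> EK" using EKD(5,7) e e0(1) a(1) by blast
      ultimately have hf: "h ?f = r \<odot>\<^bsub>E\<^esub> ?f" using rt by blast
      have "h e = h (?f \<oplus>\<^bsub>E\<^esub> a \<odot>\<^bsub>E\<^esub> e0)" using c by (simp add: a_minus_def E.M.a_assoc E.M.l_neg)
      also have "\<dots> = r \<odot>\<^bsub>E\<^esub> ?f \<oplus>\<^bsub>E\<^esub> a \<odot>\<^bsub>E\<^esub> h e0" using hf c hD(2,3) by simp
      also have "h e0 = d e0 \<oplus>\<^bsub>E\<^esub> r \<odot>\<^bsub>E\<^esub> e0"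
        using c hD(1) by (simp add: d_def a_minus_def E.M.a_assoc E.M.l_neg)
      also have "a \<odot>\<^bsub>E\<^esub> (d e0 \<oplus>\<^bsub>E\<^esub> r \<odot>\<^bsub>E\<^esub> e0) = s \<odot>\<^bsub>E\<^esub> (t \<odot>\<^bsub>E\<^esub> e) \<oplus>\<^bsub>E\<^esub> r \<odot>\<^bsub>E\<^esub> (a \<odot>\<^bsub>E\<^esub> e0)"
        using c s(2) a(2) dE[OF c(2)]
        by (simp add: E.smult_r_distr E.smult_assoc1[symmetric] m_comm m_lcomm)
      finally have "h e = r \<odot>\<^bsub>E\<^esub> ?f \<oplus>\<^bsub>E\<^esub> (s \<odot>\<^bsub>E\<^esub> (t \<odot>\<^bsub>E\<^esub> e) \<oplus>\<^bsub>E\<^esub> r \<odot>\<^bsub>E\<^esub> (a \<odot>\<^bsub>E\<^esub> e0))" .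
      also have "\<dots> = r \<odot>\<^bsub>E\<^esub> (?f \<oplus>\<^bsub>E\<^esub> a \<odot>\<^bsub>E\<^esub> e0) \<oplus>\<^bsub>E\<^esub> s \<odot>\<^bsub>E\<^esub> (t \<odot>\<^bsub>E\<^esub> e)"
        using c by (simp add: E.smult_r_distr E.M.a_ac)
      also have "?f \<oplus>\<^bsub>E\<^esub> a \<odot>\<^bsub>E\<^esub> e0 = e" using c by (simp add: a_minus_def E.M.a_assoc E.M.l_neg)
      finally show ?thesis using c by (simp add: E.smult_l_distr E.smult_assoc1)
    qed
    then show ?thesis unfolding good_def EK_def using r(1) s(1) tR by (intro bexI[of _ "r \<oplus> s \<otimes> t"]) auto
  qed
  with bad show False by blast
qed

text \<open>On the elements killed by \<open>pow n\<close> the map is a scalar \<open>a n\<close>.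
  These scalars form a Cauchy sequence, and its limit works everywhere because each element of
  \<open>E\<close> is killed by some power.\<close>

theorem endo_scalar:
  assumes h: "h \<in> linear_maps R E E"
  shows "\<exists>r\<in>carrier R. \<forall>e\<in>carrier E. h e = r \<odot>\<^bsub>E\<^esub> e"
proof -
  have "\<forall>n. \<exists>r\<in>carrier R. \<forall>e\<in>carrier E. (\<forall>a\<in>pow n. a \<odot>\<^bsub>E\<^esub> e = \<zero>\<^bsub>E\<^esub>) \<longrightarrow> h e = r \<odot>\<^bsub>E\<^esub> e"
    using endo_scalar_on_ann[OF h ideal_pow] by blast
  then obtain a where a: "\<And>n. a n \<in> carrier R"
      "\<And>n e. e \<in> carrier E \<Longrightarrow> \<forall>b\<in>pow n. b \<odot>\<^bsub>E\<^esub> e = \<zero>\<^bsub>E\<^esub> \<Longrightarrow> h e = a n \<odot>\<^bsub>E\<^esub> e"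
    by metis
  have "a (Suc n) \<ominus> a n \<in> pow n" for n
  proof (rule ccontr)
    let ?r = "a (Suc n) \<ominus> a n"
    assume "?r \<notin> pow n"
    moreover have "?r \<in> carrier R" using a by simp
    \<comment> \<open>A functional on \<open>R\<close> is multiplication into
      \<open>f \<one>\<close>. This element is killed by \<open>pow n\<close>, so \<open>a n\<close>
      and \<open>a (Suc n)\<close> both describe \<open>h\<close> on it; yet their difference would
      not kill it.\<close>
    ultimately obtain f where f: "f \<in> linear_maps R (ring_module R) E"
        "\<forall>v\<in>pow n. f v = \<zero>\<^bsub>E\<^esub>" "f ?r \<noteq> \<zero>\<^bsub>E\<^esub>"
      using cogenerator_lepoll[OF ring_module_module _ ideal_submodule[OF ideal_pow]] ring_lepoll by force
    have fr: "f b = b \<odot>\<^bsub>E\<^esub> f \<one>" if "b \<in> carrier R" for b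
      using linear_mapsD(4)[OF f(1) that, of \<one>] that by simp
    have f1: "f \<one> \<in> carrier E" using linear_mapsD(2)[OF f(1)] by simp
    have "\<forall>b\<in>pow n. b \<odot>\<^bsub>E\<^esub> f \<one> = \<zero>\<^bsub>E\<^esub>" using f(2) fr pow_closed by metis
    moreover from this have "\<forall>b\<in>pow (Suc n). b \<odot>\<^bsub>E\<^esub> f \<one> = \<zero>\<^bsub>E\<^esub>" using pow_Suc_subset by blast
    ultimately have "a (Suc n) \<odot>\<^bsub>E\<^esub> f \<one> = a n \<odot>\<^bsub>E\<^esub> f \<one>" using a(2)[OF f1] by metis
    then have "?r \<odot>\<^bsub>E\<^esub> f \<one> = \<zero>\<^bsub>E\<^esub>"
      using a(1) f1 by (simp add: a_minus_def E.smult_l_distr E.smult_l_minus E.M.r_neg)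
    then show False using f(3) fr[of ?r] a(1) by simp
  qed
  then obtain x where x: "x \<in> carrier R" "\<And>n. a n \<ominus> x \<in> pow n"
    using complete[of a] a(1) by blast
  have "h e = x \<odot>\<^bsub>E\<^esub> e" if e: "e \<in> carrier E" for e
  proof -
    obtain n where n: "\<forall>b\<in>pow n. b \<odot>\<^bsub>E\<^esub> e = \<zero>\<^bsub>E\<^esub>" using killed_by_pow[OF e] by blast
    then have "(a n \<ominus> x) \<odot>\<^bsub>E\<^esub> e = \<zero>\<^bsub>E\<^esub>" using x(2) by blast
    then have "a n \<odot>\<^bsub>E\<^esub> e \<ominus>\<^bsub>E\<^esub> x \<odot>\<^bsub>E\<^esub> e = \<zero>\<^bsub>E\<^esub>"
      using a(1) x(1) e by (simp add: a_minus_def E.smult_l_distr E.smult_l_minus)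
    then show ?thesis
      using a(2)[OF e n] module_minus_eq_zero_iff[OF E_module] a(1) x(1) e by simp
  qed
  with x(1) show ?thesis by blast
qed

end

section \<open>Finite generation\<close>

text \<open>As an intersection, a span is handled by exhibiting one submodule that contains
  \<open>F\<close>, in place of linear combinations.\<close>

definition span_of :: "('a, 'r) ring_scheme \<Rightarrow> ('a, 'b) module \<Rightarrow> 'b set \<Rightarrow> 'b set" where
  "span_of R M F = \<Inter>{W. submodule W R M \<and> F \<subseteq> W}"

lemma span_of_minimal: "submodule W R M \<Longrightarrow> F \<subseteq> W \<Longrightarrow> span_of R M F \<subseteq> W"
  by (auto simp: span_of_def)

lemma span_of_superset: "F \<subseteq> span_of R M F"
  by (auto simp: span_of_def)

lemma submodule_span_of:
  assumes "module R M" "F \<subseteq> carrier M"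
  shows "submodule (span_of R M F) R M"
proof (rule submoduleI_closed[OF assms(1)])
  show "span_of R M F \<subseteq> carrier M"
    using assms module.carrier_is_submodule by (intro span_of_minimal) auto
qed (auto simp: span_of_def submoduleD[OF assms(1)])

text \<open>The equalizer of two linear maps is a submodule, so it contains the span of any set on
  which they agree.\<close>

lemma linear_maps_eq_on_span:
  assumes "module R M" "module R N" "f \<in> linear_maps R M N" "g \<in> linear_maps R M N"
    and "span_of R M F = carrier M" "F \<subseteq> carrier M" "\<And>x. x \<in> F \<Longrightarrow> f x = g x"
  shows "f = g"
proof (rule linear_maps_eqI[OF assms(3,4)])
  fix x assume "x \<in> carrier M"
  moreover have "span_of R M F \<subseteq> {x \<in> carrier M. f x = g x}"
    using assms by (intro span_of_minimal submodule_equalizer[OF assms(1-4)]) auto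
  ultimately show "f x = g x" using assms(5) by auto
qed

text \<open>Without a maximal member, dependent choice would produce a strictly ascending
  chain.\<close>

lemma noetherian_maximal:
  assumes "noetherian_module R M" "\<F> \<noteq> {}" "\<And>S. S \<in> \<F> \<Longrightarrow> submodule S R M"
  shows "\<exists>S\<in>\<F>. \<forall>T\<in>\<F>. S \<subseteq> T \<longrightarrow> T = S"
proof (rule ccontr)
  assume "\<not> ?thesis"
  then have step: "\<exists>T. T \<in> \<F> \<and> S \<subset> T" if "S \<in> \<F>" for S using that by blast
  have "\<exists>f. \<forall>n. f n \<in> \<F> \<and> f n \<subset> f (Suc n)"
    by (rule dependent_nat_choice) (use step assms(2) in auto)
  then obtain f where f: "\<And>n. f n \<in> \<F>" "\<And>n. f n \<subset> f (Suc n)" by blast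
  then have "\<forall>n. submodule (f n) R M \<and> f n \<subseteq> f (Suc n)" using assms(3) by blast
  then obtain n where "\<forall>k\<ge>n. f k = f n" using assms(1) unfolding noetherian_module_def by blast
  then have "f (Suc n) = f n" using le_SucI[OF order_refl] by blast
  with f(2)[of n] show False by simp
qed

lemma artinian_minimal:
  assumes "artinian_module R M" "\<F> \<noteq> {}" "\<And>S. S \<in> \<F> \<Longrightarrow> submodule S R M"
  shows "\<exists>S\<in>\<F>. \<forall>T\<in>\<F>. T \<subseteq> S \<longrightarrow> T = S"
proof (rule ccontr)
  assume "\<not> ?thesis"
  then have step: "\<exists>T. T \<in> \<F> \<and> T \<subset> S" if "S \<in> \<F>" for S using that by blast
  have "\<exists>f. \<forall>n. f n \<in> \<F> \<and> f (Suc n) \<subset> f n"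
    by (rule dependent_nat_choice) (use step assms(2) in auto)
  then obtain f where f: "\<And>n. f n \<in> \<F>" "\<And>n. f (Suc n) \<subset> f n" by blast
  then have "\<forall>n. submodule (f n) R M \<and> f (Suc n) \<subseteq> f n" using assms(3) by blast
  then obtain n where "\<forall>k\<ge>n. f k = f n" using assms(1) unfolding artinian_module_def by blast
  then have "f (Suc n) = f n" using le_SucI[OF order_refl] by blast
  with f(2)[of n] show False by simp
qed

text \<open>A maximal member among the spans of finite subsets cannot grow when a further generator
  is added, so it is the whole module.\<close>

lemma noetherian_finitely_generated:
  assumes "noetherian_module R M"
  obtains F where "finite F" "F \<subseteq> carrier M" "span_of R M F = carrier M"
proof -
  have M: "module R M" using assms unfolding noetherian_module_def by blast
  define \<F> where "\<F> = {span_of R M F | F. finite F \<and> F \<subseteq> carrier M}"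
  have "\<exists>S\<in>\<F>. \<forall>T\<in>\<F>. S \<subseteq> T \<longrightarrow> T = S"
    by (rule noetherian_maximal[OF assms]) (auto simp: \<F>_def submodule_span_of[OF M])
  then obtain S where S: "S \<in> \<F>" "\<And>T. T \<in> \<F> \<Longrightarrow> S \<subseteq> T \<Longrightarrow> T = S" by blast
  then obtain F where F: "finite F" "F \<subseteq> carrier M" "S = span_of R M F" unfolding \<F>_def by blast
  have "x \<in> span_of R M F" if "x \<in> carrier M" for x
  proof -
    have "span_of R M F \<subseteq> span_of R M (insert x F)"
      using that F(2) span_of_superset[of "insert x F" R M]
      by (intro span_of_minimal submodule_span_of[OF M]) auto
    moreover have "span_of R M (insert x F) \<in> \<F>"
      unfolding \<F>_def using F(1,2) that by (intro CollectI exI[of _ "insert x F"]) simp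
    ultimately have "span_of R M (insert x F) = span_of R M F" using S(2) F(3) by simp
    then show ?thesis using span_of_superset[of "insert x F" R M] by blast
  qed
  then have "span_of R M F = carrier M" using submoduleD(1)[OF M submodule_span_of[OF M F(2)]] by blast
  with F(1,2) that show ?thesis by blast
qed

lemma matlis_dualizable_module: "matlis_dualizable R M \<Longrightarrow> module R M"
  unfolding matlis_dualizable_def noetherian_module_def artinian_module_def by blast

text \<open>\<open>cat_pair\<close> requires the submodule of a pair to be an object as well; for
  submodules of dualizable modules this lemma supplies it.\<close>

lemma submodule_matlis_dualizable:
  assumes "matlis_dualizable R M" "submodule L R M"
  shows "matlis_dualizable R (M\<lparr>carrier := L\<rparr>)"
proof -
  have M: "module R M" by (rule matlis_dualizable_module[OF assms(1)])
  have "module R (M\<lparr>carrier := L\<rparr>)" using assms(2) M submodule.submodule_is_module by blast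
  then show ?thesis
    using assms(1) submodule_trans[OF M assms(2)]
    unfolding matlis_dualizable_def noetherian_module_def artinian_module_def by blast
qed

section \<open>Cardinalities\<close>

lemma infinite_times_lepoll:
  assumes "infinite (UNIV :: 'u set)" "A \<lesssim> (UNIV :: 'u set)" "B \<lesssim> (UNIV :: 'u set)"
  shows "A \<times> B \<lesssim> (UNIV :: 'u set)"
proof -
  have "(UNIV :: 'u set) \<times> (UNIV :: 'u set) \<lesssim> (UNIV :: 'u set)"
    using card_of_Times_same_infinite[OF assms(1)] card_of_ordLeq ordIso_iff_ordLeq
    unfolding lepoll_def by blast
  then show ?thesis using times_lepoll_mono[OF assms(2,3)] lepoll_trans by blast
qed

lemma singleton_lepoll_UNIV: "{x} \<lesssim> (UNIV :: 'u set)"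
  by (auto simp: lepoll_def intro: exI[of _ "\<lambda>_. undefined"])

lemma finite_PiE_lepoll:
  assumes "infinite (UNIV :: 'u set)" "finite F"
  shows "(F \<rightarrow>\<^sub>E (UNIV :: 'u set)) \<lesssim> (UNIV :: 'u set)"
  using assms(2)
proof induction
  case empty
  then show ?case using singleton_lepoll_UNIV by simp
next
  case (insert x F)
  have "(UNIV :: 'u set) \<times> (F \<rightarrow>\<^sub>E (UNIV :: 'u set)) \<lesssim> (UNIV :: 'u set)"
    using insert.IH by (intro infinite_times_lepoll[OF assms(1)]) auto
  then show ?case unfolding PiE_insert_eq using image_lepoll lepoll_trans by blast
qed

text \<open>Adding a generator \<open>x\<close> enlarges a submodule \<open>W\<close> to
  \<open>W + R x\<close>, an image of \<open>W \<times> R\<close>, and the infinite universe absorbs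
  such products.\<close>

lemma span_of_finite_lepoll:
  fixes N :: "('a, 'v) module"
  assumes "infinite (UNIV :: 'u set)" "carrier R \<lesssim> (UNIV :: 'u set)"
    and N: "module R N" and "finite F" "F \<subseteq> carrier N"
  shows "span_of R N F \<lesssim> (UNIV :: 'u set)"
proof -
  interpret N: module R N by fact
  have "\<exists>W. submodule W R N \<and> F \<subseteq> W \<and> W \<lesssim> (UNIV :: 'u set)"
    using assms(4,5)
  proof induction
    case empty
    show ?case
      by (intro exI[of _ "{\<zero>\<^bsub>N\<^esub>}"] conjI submodule_zero[OF N] singleton_lepoll_UNIV empty_subsetI)
  next
    case (insert x F)
    obtain W where W: "submodule W R N" "F \<subseteq> W" "W \<lesssim> (UNIV :: 'u set)"
      using insert.IH insert.prems by blast
    have x: "x \<in> carrier N" using insert.prems by simp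
    note WD = submoduleD[OF N W(1)]
    let ?V = "(\<lambda>(w, r). w \<oplus>\<^bsub>N\<^esub> r \<odot>\<^bsub>N\<^esub> x) ` (W \<times> carrier R)"
    have I: "w \<oplus>\<^bsub>N\<^esub> r \<odot>\<^bsub>N\<^esub> x \<in> ?V" if "w \<in> W" "r \<in> carrier R" for w r using that by force
    have "submodule ?V R N"
    proof (rule submoduleI_closed[OF N])
      show "?V \<subseteq> carrier N" using WD(2) x by auto
      show "\<zero>\<^bsub>N\<^esub> \<in> ?V" using I[OF WD(3) N.R.zero_closed] x by simp
      fix y assume "y \<in> ?V"
      then obtain w r where y: "w \<in> W" "r \<in> carrier R" "y = w \<oplus>\<^bsub>N\<^esub> r \<odot>\<^bsub>N\<^esub> x" by auto
      show "a \<odot>\<^bsub>N\<^esub> y \<in> ?V" if a: "a \<in> carrier R" for a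
        using I[of "a \<odot>\<^bsub>N\<^esub> w" "a \<otimes>\<^bsub>R\<^esub> r"] y a x WD(2)[OF y(1)] WD(7)
        by (simp add: N.smult_r_distr N.smult_assoc1)
      fix z assume "z \<in> ?V"
      then obtain w' r' where z: "w' \<in> W" "r' \<in> carrier R" "z = w' \<oplus>\<^bsub>N\<^esub> r' \<odot>\<^bsub>N\<^esub> x" by auto
      show "y \<oplus>\<^bsub>N\<^esub> z \<in> ?V"
        using I[of "w \<oplus>\<^bsub>N\<^esub> w'" "r \<oplus>\<^bsub>R\<^esub> r'"] y z x WD(2)[OF y(1)] WD(2)[OF z(1)] WD(4)
        by (simp add: N.smult_l_distr N.M.a_ac)
    qed
    moreover have "insert x F \<subseteq> ?V"
    proof -
      have "x \<in> ?V" using I[OF WD(3) N.R.one_closed] x by simp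
      moreover have "w \<in> ?V" if "w \<in> F" for w
        using I[of w, OF _ N.R.zero_closed] x W(2) that WD(2) by (simp add: subset_iff)
      ultimately show ?thesis by blast
    qed
    moreover have "?V \<lesssim> (UNIV :: 'u set)"
      using infinite_times_lepoll[OF assms(1) W(3) assms(2)] image_lepoll lepoll_trans by blast
    ultimately show ?case by blast
  qed
  then show ?thesis using span_of_minimal subset_imp_lepoll lepoll_trans by metis
qed

section \<open>Matlis duality\<close>

lemma biduality_linear:
  assumes "module R E" "module R M" "x \<in> carrier M"
  shows "biduality R E M x \<in> linear_maps R (dual R E M) E"
proof -
  have "(\<lambda>f\<in>carrier (dual R E M). f x) \<in> linear_maps R (dual R E M) E"
    using linear_mapsD(2) assms(3) by (intro linear_maps_restrictI dual_module assms) auto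
  then show ?thesis using assms(3) by (simp add: biduality_def)
qed

lemma biduality_apply:
  "x \<in> carrier M \<Longrightarrow> f \<in> linear_maps R M E \<Longrightarrow> biduality R E M x f = f x"
  by (simp add: biduality_def)

text \<open>The annihilator of \<open>A\<close> is the common kernel of the evaluations at the
  elements of \<open>A\<close>.\<close>

lemma submodule_dual_quotient:
  assumes "module R E" "module R B" "submodule A R B"
  shows "submodule (dual_quotient R E A B) R (dual R E B)"
proof -
  have "submodule {f \<in> carrier (dual R E B). \<forall>g\<in>biduality R E B ` A. g f = \<zero>\<^bsub>E\<^esub>} R (dual R E B)"
    using submoduleD(2)[OF assms(2,3)] biduality_linear[OF assms(1,2)]
    by (intro submodule_common_ker[OF dual_module[OF assms(1,2)] assms(1)]) blast
  also have "{f \<in> carrier (dual R E B). \<forall>g\<in>biduality R E B ` A. g f = \<zero>\<^bsub>E\<^esub>} = dual_quotient R E A B"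
    unfolding dual_quotient_eq[OF assms] using submoduleD(2)[OF assms(2,3)] by (auto simp: biduality_apply)
  finally show ?thesis .
qed

lemma biduality_map_linear:
  assumes "module R E" "module R M"
  shows "biduality R E M \<in> linear_maps R M (dual R E (dual R E M))"
  unfolding biduality_def
proof (rule linear_maps_restrictI[OF assms(2)])
  show "(\<lambda>f\<in>carrier (dual R E M). f x) \<in> carrier (dual R E (dual R E M))" if "x \<in> carrier M" for x
    using biduality_linear[OF assms that] that by (simp add: biduality_def)
qed (auto simp: linear_mapsD intro!: restrict_ext)

lemma dual_map_linear:
  assumes "module R E" "module R M" "module R N" "g \<in> linear_maps R M N"
  shows "dual_map R E M N g \<in> linear_maps R (dual R E N) (dual R E M)"
  unfolding dual_map_def
proof (rule linear_maps_restrictI[OF dual_module[OF assms(1,3)]])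
  show "compose (carrier M) f g \<in> carrier (dual R E M)" if "f \<in> carrier (dual R E N)" for f
    using linear_maps_compose[OF assms(2,4)] that by simp
qed (use linear_mapsD(2)[OF assms(4)] in \<open>auto simp: compose_def intro!: restrict_ext\<close>)

lemma dual_map_apply:
  "f \<in> linear_maps R N E \<Longrightarrow> x \<in> carrier M \<Longrightarrow> dual_map R E M N g f x = f (g x)"
  by (simp add: dual_map_def compose_def)

context matlis
begin

text \<open>
  The statement is relative to a submodule \<open>K\<close> because the induction restricts to the kernel of one
  member of \<open>F\<close> after the other; the coefficient at that member comes from \<open>endo_scalar\<close>.
\<close>

lemma dual_span_on:
  fixes M :: "('a, 'v) module"
  assumes M: "module R M" and W: "submodule W R (dual R E M)" and "finite F" "F \<subseteq> W"
    and f: "f \<in> linear_maps R M E"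
    and "submodule K R M" "\<And>x. x \<in> K \<Longrightarrow> \<forall>g\<in>F. g x = \<zero>\<^bsub>E\<^esub> \<Longrightarrow> f x = \<zero>\<^bsub>E\<^esub>"
  shows "\<exists>w\<in>W. \<forall>x\<in>K. f x = w x"
  using assms(3,4,6,7)
proof (induction F arbitrary: K)
  case empty
  have "\<zero>\<^bsub>dual R E M\<^esub> \<in> W" using submoduleD(3)[OF dual_module[OF E_module M] W] .
  moreover have "\<forall>x\<in>K. f x = \<zero>\<^bsub>dual R E M\<^esub> x"
    using empty.prems(3) submoduleD(2)[OF M empty.prems(2)] by simp
  ultimately show ?case by blast
next
  case (insert g F)
  interpret M: module R M by fact
  note WD = submoduleD[OF dual_module[OF E_module M] W]
  note KD = submoduleD[OF M insert.prems(2)]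
  have g: "g \<in> W" "g \<in> linear_maps R M E" using insert.prems(1) WD(2) by auto
  \<comment> \<open>On the kernel of \<open>g\<close> the set \<open>F\<close> alone controls
    \<open>f\<close>, so the induction hypothesis provides \<open>w\<close> there.\<close>
  have K': "submodule (K \<inter> {x \<in> carrier M. g x = \<zero>\<^bsub>E\<^esub>}) R M"
    using submodule_Int[OF M insert.prems(2) submodule_ker[OF M E_module g(2)]] .
  obtain w where w: "w \<in> W" "\<And>x. x \<in> K \<Longrightarrow> g x = \<zero>\<^bsub>E\<^esub> \<Longrightarrow> f x = w x"
    using insert.IH[OF _ K'] insert.prems KD(2) by auto
  have wl: "w \<in> linear_maps R M E" using WD(2)[OF w(1)] by simp
  note fD = linear_mapsD(2-)[OF f] and gD = linear_mapsD(2-)[OF g(2)] and wD = linear_mapsD(2-)[OF wl]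
  \<comment> \<open>The graph sends \<open>g x\<close> to \<open>f x - w x\<close> for
    \<open>x\<close> in \<open>K\<close>. It is single-valued because \<open>f\<close> and
    \<open>w\<close> agree where \<open>g\<close> vanishes on \<open>K\<close>. Its extension to
    \<open>E\<close> is multiplication by some \<open>r\<close>, so \<open>f = w + r g\<close> on
    \<open>K\<close>.\<close>
  define S where "S = (\<lambda>x. (g x, f x \<ominus>\<^bsub>E\<^esub> w x)) ` K"
  have SI: "(g x, f x \<ominus>\<^bsub>E\<^esub> w x) \<in> S" if "x \<in> K" for x using that by (simp add: S_def)
  have "\<exists>h\<in>linear_maps R E E. \<forall>x e. (x, e) \<in> S \<longrightarrow> h x = e"
  proof (rule injective_extend_graph[OF injective E_module])
    show "S \<subseteq> carrier E \<times> carrier E" using fD(1) gD(1) wD(1) KD(2) by (auto simp: S_def)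
    show "(\<zero>\<^bsub>E\<^esub>, \<zero>\<^bsub>E\<^esub>) \<in> S"
      using SI[OF KD(3)] linear_maps_zero[OF M E_module f] linear_maps_zero[OF M E_module g(2)]
        linear_maps_zero[OF M E_module wl] by (simp add: a_minus_def E.M.r_neg)
  next
    fix x e y e' assume "(x, e) \<in> S" "(y, e') \<in> S"
    then obtain a b where ab: "a \<in> K" "b \<in> K" "x = g a" "e = f a \<ominus>\<^bsub>E\<^esub> w a" "y = g b" "e' = f b \<ominus>\<^bsub>E\<^esub> w b"
      by (auto simp: S_def)
    then show "(x \<oplus>\<^bsub>E\<^esub> y, e \<oplus>\<^bsub>E\<^esub> e') \<in> S"
      using SI[OF KD(4)[OF ab(1,2)]] KD(2)[OF ab(1)] KD(2)[OF ab(2)] fD(1,2) gD(1,2) wD(1,2)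
      by (simp add: a_minus_def E.M.minus_add E.M.a_ac)
  next
    fix r x e assume r: "r \<in> carrier R" "(x, e) \<in> S"
    then obtain a where a: "a \<in> K" "x = g a" "e = f a \<ominus>\<^bsub>E\<^esub> w a" by (auto simp: S_def)
    then show "(r \<odot>\<^bsub>E\<^esub> x, r \<odot>\<^bsub>E\<^esub> e) \<in> S"
      using SI[OF KD(7)[OF r(1) a(1)]] KD(2)[OF a(1)] r(1) fD(1,3) gD(1,3) wD(1,3)
      by (simp add: a_minus_def E.smult_r_distr E.smult_r_minus)
  next
    fix e assume "(\<zero>\<^bsub>E\<^esub>, e) \<in> S"
    then obtain a where a: "a \<in> K" "g a = \<zero>\<^bsub>E\<^esub>" "e = f a \<ominus>\<^bsub>E\<^esub> w a" by (auto simp: S_def)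
    then show "e = \<zero>\<^bsub>E\<^esub>" using w(2)[OF a(1,2)] wD(1)[OF KD(2)[OF a(1)]] by (simp add: a_minus_def E.M.r_neg)
  qed
  then obtain h where h: "h \<in> linear_maps R E E" "\<And>x e. (x, e) \<in> S \<Longrightarrow> h x = e" by blast
  obtain r where r: "r \<in> carrier R" "\<And>e. e \<in> carrier E \<Longrightarrow> h e = r \<odot>\<^bsub>E\<^esub> e"
      using endo_scalar[OF h(1)] by blast
  define w' where "w' = w \<oplus>\<^bsub>dual R E M\<^esub> (r \<odot>\<^bsub>dual R E M\<^esub> g)"
  have "w' \<in> W" unfolding w'_def using WD(4)[OF w(1) WD(7)[OF r(1) g(1)]] .
  moreover have "f x = w' x" if x: "x \<in> K" for x
  proof -
    have "r \<odot>\<^bsub>E\<^esub> g x = f x \<ominus>\<^bsub>E\<^esub> w x" using h(2)[OF SI[OF x]] r(2)[OF gD(1)[OF KD(2)[OF x]]] by simp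
    then show ?thesis
      using KD(2)[OF x] module_add_minus_cancel[OF E_module wD(1) fD(1)] by (simp add: w'_def)
  qed
  ultimately show ?case by blast
qed

text \<open>\<open>M\<close> may live over any type, since the extension behind
  \<open>dual_span_on\<close> takes place inside \<open>E\<close>. So \<open>M\<close> may itself be
  a dual, as in \<open>reflexive_finitely_generated\<close>.\<close>

corollary dual_span:
  fixes M :: "('a, 'v) module"
  assumes M: "module R M" and W: "submodule W R (dual R E M)" and "finite F" "F \<subseteq> W"
    and f: "f \<in> linear_maps R M E"
    and "\<And>x. x \<in> carrier M \<Longrightarrow> \<forall>g\<in>F. g x = \<zero>\<^bsub>E\<^esub> \<Longrightarrow> f x = \<zero>\<^bsub>E\<^esub>"
  shows "f \<in> W"
proof -
  obtain w where w: "w \<in> W" "\<forall>x\<in>carrier M. f x = w x"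
    using dual_span_on[OF assms(1-5) module.carrier_is_submodule[OF M] assms(6)] by blast
  have "w \<in> linear_maps R M E" using submoduleD(2)[OF dual_module[OF E_module M] W w(1)] by simp
  then have "f = w" using linear_maps_eqI[OF f] w(2) by blast
  with w(1) show ?thesis by simp
qed

text \<open>Induction on \<open>F\<close>: a point \<open>x\<close> that is right on
  \<open>F\<close> is corrected by an element \<open>y\<close> of the common kernel \<open>K\<close>
  of \<open>F\<close>, chosen with \<open>g y = \<phi> g - g x\<close>.\<close>

lemma biduality_surj_on_finite:
  fixes M :: "('a, 'v) module"
  assumes M: "module R M" and \<phi>: "\<phi> \<in> linear_maps R (dual R E M) E"
    and "finite F" "F \<subseteq> linear_maps R M E"
  shows "\<exists>x\<in>carrier M. \<forall>f\<in>F. \<phi> f = f x"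
  using assms(3,4)
proof induction
  case empty
  then show ?case using module_closed(3)[OF M] by blast
next
  case (insert g F)
  interpret M: module R M by fact
  let ?D = "dual R E M"
  have D: "module R ?D" by (rule dual_module[OF E_module M])
  note \<phi>D = linear_mapsD(2-)[OF \<phi>, simplified dual_simps(1)]
  obtain x where x: "x \<in> carrier M" "\<forall>f\<in>F. \<phi> f = f x" using insert by auto
  have g: "g \<in> linear_maps R M E" using insert.prems by simp
  note gD = linear_mapsD(2-)[OF g]
  define K where "K = {y \<in> carrier M. \<forall>f\<in>F. f y = \<zero>\<^bsub>E\<^esub>}"
  have F: "f \<in> linear_maps R M E" if "f \<in> F" for f using insert.prems that by auto
  have K: "submodule K R M" unfolding K_def by (rule submodule_common_ker[OF M E_module F])
  note KD = submoduleD[OF M K]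
  have gK: "submodule (g ` K) R E" by (rule submodule_image[OF M E_module g K])
  define e where "e = \<phi> g \<ominus>\<^bsub>E\<^esub> g x"
  have e: "e \<in> carrier E" unfolding e_def using \<phi>D(1)[OF g] gD(1)[OF x(1)] by simp
  have "e \<in> g ` K"
  proof (rule ccontr)
    assume "e \<notin> g ` K"
    then obtain h where h: "h \<in> linear_maps R E E" "\<forall>v\<in>g ` K. h v = \<zero>\<^bsub>E\<^esub>" "h e \<noteq> \<zero>\<^bsub>E\<^esub>"
      using cogenerator[OF E_module gK e] by blast
    obtain r where r: "r \<in> carrier R" "\<And>e. e \<in> carrier E \<Longrightarrow> h e = r \<odot>\<^bsub>E\<^esub> e"
      using endo_scalar[OF h(1)] by blast
    define W where "W = {f \<in> carrier ?D. \<phi> f = biduality R E M x f}"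
    have b: "biduality R E M x \<in> linear_maps R ?D E" by (rule biduality_linear[OF E_module M x(1)])
    have W: "submodule W R ?D" unfolding W_def by (rule submodule_equalizer[OF D E_module \<phi> b])
    have rg: "r \<odot>\<^bsub>?D\<^esub> g \<in> linear_maps R M E" using module_closed(4)[OF D r(1)] g by simp
    have "r \<odot>\<^bsub>?D\<^esub> g \<in> W"
    proof (rule dual_span[OF M W insert.hyps(1) _ rg])
      show "F \<subseteq> W" using x F by (auto simp: W_def biduality_apply)
      fix y assume y: "y \<in> carrier M" "\<forall>f\<in>F. f y = \<zero>\<^bsub>E\<^esub>"
      then have "h (g y) = \<zero>\<^bsub>E\<^esub>" using h(2) by (auto simp: K_def)
      then show "(r \<odot>\<^bsub>?D\<^esub> g) y = \<zero>\<^bsub>E\<^esub>" using y(1) r(2) gD(1) by simp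
    qed
    then have "\<phi> (r \<odot>\<^bsub>?D\<^esub> g) = biduality R E M x (r \<odot>\<^bsub>?D\<^esub> g)" by (simp add: W_def)
    then have "r \<odot>\<^bsub>E\<^esub> \<phi> g = r \<odot>\<^bsub>E\<^esub> g x"
      using \<phi>D(3)[OF r(1) g] linear_mapsD(4)[OF b r(1)] g x(1) by (simp add: biduality_apply)
    then have "h e = \<zero>\<^bsub>E\<^esub>"
      using r e \<phi>D(1)[OF g] gD(1)[OF x(1)]
      by (simp add: e_def a_minus_def E.smult_r_distr E.smult_r_minus E.M.r_neg)
    with h(3) show False by simp
  qed
  then obtain y where y: "y \<in> K" "e = g y" by blast
  have yM: "y \<in> carrier M" using KD(2)[OF y(1)] .
  have "\<phi> g = g (x \<oplus>\<^bsub>M\<^esub> y)"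
    using y(2) gD(2)[OF x(1) yM] module_add_minus_cancel[OF E_module gD(1)[OF x(1)] \<phi>D(1)[OF g]]
    by (simp add: e_def)
  moreover have "\<phi> f = f (x \<oplus>\<^bsub>M\<^esub> y)" if f: "f \<in> F" for f
    using linear_mapsD(2,3)[OF F[OF f]] x yM y(1) f by (simp add: K_def)
  ultimately show ?case using x(1) yM by (intro bexI[of _ "x \<oplus>\<^bsub>M\<^esub> y"]) auto
qed

text \<open>Records surjectivity of the biduality map only; injectivity is obtained from
  \<open>cogenerator\<close> where it is used.\<close>

definition reflexive :: "('a, 'v) module \<Rightarrow> bool" where
  "reflexive M \<longleftrightarrow> (\<forall>\<phi>\<in>linear_maps R (dual R E M) E. \<exists>x\<in>carrier M. \<phi> = biduality R E M x)"

text \<open>Evaluations at the generators have no common zero except the zero functional. By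
  \<open>dual_span\<close>, applied to the dual of \<open>M\<close>, every member of the bidual lies
  in the submodule of all evaluations.\<close>

lemma reflexive_finitely_generated:
  assumes M: "module R M" and F: "finite F" "F \<subseteq> carrier M" "span_of R M F = carrier M"
  shows "reflexive M"
  unfolding reflexive_def
proof
  fix \<phi> assume \<phi>: "\<phi> \<in> linear_maps R (dual R E M) E"
  have D: "module R (dual R E M)" by (rule dual_module[OF E_module M])
  have "\<phi> \<in> biduality R E M ` carrier M"
  proof (rule dual_span[OF D _ _ _ \<phi>])
    show "submodule (biduality R E M ` carrier M) R (dual R E (dual R E M))"
      by (rule submodule_image[OF M dual_module[OF E_module D] biduality_map_linear[OF E_module M]
            module.carrier_is_submodule[OF M]])
    show "finite (biduality R E M ` F)" using F(1) by simp
    show "biduality R E M ` F \<subseteq> biduality R E M ` carrier M" using F(2) by blast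
    fix f assume f: "f \<in> carrier (dual R E M)" "\<forall>g\<in>biduality R E M ` F. g f = \<zero>\<^bsub>E\<^esub>"
    have z: "\<zero>\<^bsub>dual R E M\<^esub> \<in> linear_maps R M E" using module_closed(3)[OF D] by simp
    have "f = \<zero>\<^bsub>dual R E M\<^esub>"
    proof (rule linear_maps_eq_on_span[OF M E_module _ z F(3,2)])
      show "f x = \<zero>\<^bsub>dual R E M\<^esub> x" if "x \<in> F" for x
        using f that F(2) by (auto simp: biduality_apply subset_iff)
    qed (use f in simp)
    then show "\<phi> f = \<zero>\<^bsub>E\<^esub>" using linear_maps_zero[OF D E_module \<phi>] by simp
  qed
  then show "\<exists>x\<in>carrier M. \<phi> = biduality R E M x" by blast
qed

text \<open>A functional is determined by its values at the finitely many generators.\<close>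

lemma dual_lepoll_finitely_generated:
  assumes M: "module R M" and F: "finite F" "F \<subseteq> carrier M" "span_of R M F = carrier M"
  shows "linear_maps R M E \<lesssim> (UNIV :: 'u set)"
proof -
  have "inj_on (\<lambda>f. restrict f F) (linear_maps R M E)"
  proof (rule inj_onI)
    fix f g assume fg: "f \<in> linear_maps R M E" "g \<in> linear_maps R M E" "restrict f F = restrict g F"
    have "f x = g x" if "x \<in> F" for x using fun_cong[OF fg(3), of x] that by simp
    then show "f = g" using linear_maps_eq_on_span[OF M E_module fg(1,2) F(3,2)] by blast
  qed
  then have "linear_maps R M E \<lesssim> (F \<rightarrow>\<^sub>E (UNIV :: 'u set))" unfolding lepoll_def by auto
  then show ?thesis using finite_PiE_lepoll[OF infinite_universe F(1)] lepoll_trans by blast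
qed

text \<open>Choose \<open>F\<close> finite with minimal common kernel. Adding any \<open>f\<close>
  leaves this kernel unchanged, so \<open>f\<close> vanishes on it and lies in the span of
  \<open>F\<close> by \<open>dual_span\<close>.\<close>

lemma dual_artinian_finitely_generated:
  fixes M :: "('a, 'v) module"
  assumes "artinian_module R M"
  obtains F where "finite F" "F \<subseteq> linear_maps R M E" "span_of R (dual R E M) F = linear_maps R M E"
proof -
  have M: "module R M" using assms unfolding artinian_module_def by blast
  have D: "module R (dual R E M)" by (rule dual_module[OF E_module M])
  define ker where "ker F = {x \<in> carrier M. \<forall>f\<in>F. f x = \<zero>\<^bsub>E\<^esub>}" for F :: "('v \<Rightarrow> 'u) set"
  define \<F> where "\<F> = {ker F | F. finite F \<and> F \<subseteq> linear_maps R M E}"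
  have "\<exists>S\<in>\<F>. \<forall>T\<in>\<F>. T \<subseteq> S \<longrightarrow> T = S"
  proof (rule artinian_minimal[OF assms])
    show "\<F> \<noteq> {}" unfolding \<F>_def by blast
    fix S assume "S \<in> \<F>"
    then obtain F where F: "F \<subseteq> linear_maps R M E" "S = ker F" unfolding \<F>_def by blast
    show "submodule S R M"
      unfolding F(2) ker_def using F(1) by (intro submodule_common_ker[OF M E_module]) blast
  qed
  then obtain S where S: "S \<in> \<F>" "\<And>T. T \<in> \<F> \<Longrightarrow> T \<subseteq> S \<Longrightarrow> T = S" by blast
  then obtain F where F: "finite F" "F \<subseteq> linear_maps R M E" "S = ker F" unfolding \<F>_def by blast
  have W: "submodule (span_of R (dual R E M) F) R (dual R E M)"
    using F(2) by (intro submodule_span_of[OF D]) simp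
  have "f \<in> span_of R (dual R E M) F" if f: "f \<in> linear_maps R M E" for f
  proof (rule dual_span[OF M W F(1) span_of_superset f])
    fix x assume x: "x \<in> carrier M" "\<forall>g\<in>F. g x = \<zero>\<^bsub>E\<^esub>"
    have "ker (insert f F) \<in> \<F>"
      unfolding \<F>_def using F f by (intro CollectI exI[of _ "insert f F"]) simp
    moreover have "ker (insert f F) \<subseteq> S" unfolding F(3) ker_def by blast
    ultimately have "ker (insert f F) = S" using S(2) by blast
    moreover have "x \<in> S" using x unfolding F(3) ker_def by blast
    ultimately show "f x = \<zero>\<^bsub>E\<^esub>" unfolding ker_def by blast
  qed
  then have "span_of R (dual R E M) F = linear_maps R M E" using submoduleD(1)[OF D W] by auto
  with F(1,2) that show ?thesis by blast
qed

text \<open>In the Artinian case the dual is spanned by a finite \<open>F\<close>, so agreement with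
  an evaluation on \<open>F\<close> is agreement everywhere. The cardinality bound is what provides
  a copy of the dual over \<open>'u\<close>.\<close>

lemma matlis_dualizable_reflexive:
  fixes M :: "('a, 'v) module"
  assumes "matlis_dualizable R M"
  shows "reflexive M" "linear_maps R M E \<lesssim> (UNIV :: 'u set)"
proof -
  have "reflexive M \<and> linear_maps R M E \<lesssim> (UNIV :: 'u set)"
    using assms unfolding matlis_dualizable_def
  proof
    assume N: "noetherian_module R M"
    then have M: "module R M" unfolding noetherian_module_def by blast
    obtain F where F: "finite F" "F \<subseteq> carrier M" "span_of R M F = carrier M"
      using noetherian_finitely_generated[OF N] .
    show ?thesis
      using reflexive_finitely_generated[OF M F] dual_lepoll_finitely_generated[OF M F] by blast
  next
    assume A: "artinian_module R M"
    then have M: "module R M" unfolding artinian_module_def by blast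
    have D: "module R (dual R E M)" by (rule dual_module[OF E_module M])
    obtain F where F: "finite F" "F \<subseteq> linear_maps R M E" "span_of R (dual R E M) F = linear_maps R M E"
      using dual_artinian_finitely_generated[OF A] .
    have "reflexive M"
      unfolding reflexive_def
    proof
      fix \<phi> assume \<phi>: "\<phi> \<in> linear_maps R (dual R E M) E"
      obtain x where x: "x \<in> carrier M" "\<forall>f\<in>F. \<phi> f = f x"
        using biduality_surj_on_finite[OF M \<phi> F(1,2)] by blast
      have "\<phi> = biduality R E M x"
      proof (rule linear_maps_eq_on_span[OF D E_module \<phi> biduality_linear[OF E_module M x(1)]])
        show "span_of R (dual R E M) F = carrier (dual R E M)" "F \<subseteq> carrier (dual R E M)"
          using F by simp_all
        show "\<phi> f = biduality R E M x f" if "f \<in> F" for f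
          using that x F(2) by (simp add: biduality_apply subset_iff)
      qed
      with x(1) show "\<exists>x\<in>carrier M. \<phi> = biduality R E M x" by blast
    qed
    moreover have "linear_maps R M E \<lesssim> (UNIV :: 'u set)"
      using span_of_finite_lepoll[OF infinite_universe ring_lepoll D F(1)] F(2,3) by simp
    ultimately show ?thesis by blast
  qed
  then show "reflexive M" "linear_maps R M E \<lesssim> (UNIV :: 'u set)" by blast+
qed

text \<open>Taking common zeros is an order-reversing injection from submodules of the dual to
  submodules of \<open>M\<close>, so duality exchanges the two chain conditions.\<close>

lemma matlis_dual_exists:
  fixes M :: "('a, 'u) module"
  assumes "matlis_dualizable R M"
  obtains B :: "('a, 'u) module" and \<theta>
  where "matlis_dualizable R B" "\<theta> \<in> linear_isos R (dual R E M) B"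
proof -
  have M: "module R M" by (rule matlis_dualizable_module[OF assms])
  let ?D = "dual R E M"
  have D: "module R ?D" by (rule dual_module[OF E_module M])
  obtain B :: "('a, 'u) module" and \<theta> where B: "module R B" and \<theta>: "\<theta> \<in> linear_isos R ?D B"
    using module_copy[OF D] matlis_dualizable_reflexive(2)[OF assms] by auto
  define \<psi> where "\<psi> = iso_inv ?D B \<theta>"
  note \<theta>D = linear_isosD[OF \<theta>]
  have \<psi>: "\<psi> \<theta>f = f" if "f \<in> linear_maps R M E" "\<theta>f = \<theta> f" for f \<theta>f
    using iso_inv_simps(1)[OF \<theta>] that by (simp add: \<psi>_def)
  have \<theta>\<psi>: "\<theta> (\<psi> b) = b" "\<psi> b \<in> linear_maps R M E" if "b \<in> carrier B" for b
    using iso_inv_simps(2,3)[OF \<theta>] that by (simp_all add: \<psi>_def)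
  define U where "U S = {x \<in> carrier M. \<forall>b\<in>S. \<psi> b x = \<zero>\<^bsub>E\<^esub>}" for S
  have U_mono: "U T \<subseteq> U S" if "S \<subseteq> T" for S T using that by (auto simp: U_def)
  have U: "submodule (U S) R M" if "submodule S R B" for S
  proof -
    have "submodule {x \<in> carrier M. \<forall>f\<in>\<psi> ` S. f x = \<zero>\<^bsub>E\<^esub>} R M"
      using submoduleD(2)[OF B that] \<theta>\<psi>(2) by (intro submodule_common_ker[OF M E_module]) blast
    then show ?thesis by (simp add: U_def)
  qed
  \<comment> \<open>A functional on \<open>B\<close> that kills \<open>S\<close> but not
    \<open>b\<close> is, by reflexivity, evaluation at some point \<open>x\<close> of
    \<open>M\<close>. This \<open>x\<close> is a common zero of \<open>S\<close> but not of
    \<open>b\<close>, so \<open>U\<close> determines \<open>S\<close>.\<close>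
  have separate: "\<exists>x\<in>U S. \<psi> b x \<noteq> \<zero>\<^bsub>E\<^esub>" if S: "submodule S R B" and b: "b \<in> carrier B" "b \<notin> S" for S b
  proof -
    obtain f where f: "f \<in> linear_maps R B E" "\<forall>v\<in>S. f v = \<zero>\<^bsub>E\<^esub>" "f b \<noteq> \<zero>\<^bsub>E\<^esub>"
      using cogenerator[OF B S b] by blast
    have "compose (carrier ?D) f \<theta> \<in> linear_maps R ?D E"
      by (rule linear_maps_compose[OF D \<theta>D(1) f(1)])
    then obtain x where x: "x \<in> carrier M" "compose (carrier ?D) f \<theta> = biduality R E M x"
      using matlis_dualizable_reflexive(1)[OF assms] unfolding reflexive_def by blast
    have fx: "f c = \<psi> c x" if c: "c \<in> carrier B" for c
      using fun_cong[OF x(2), of "\<psi> c"] \<theta>\<psi>[OF c] x(1) by (simp add: compose_def biduality_apply)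
    have "x \<in> U S" using f(2) fx submoduleD(2)[OF B S] x(1) by (simp add: U_def)
    with f(3) fx b(1) show ?thesis by metis
  qed
  have U_inj: "S = T" if S: "submodule S R B" and T: "submodule T R B" and "U S = U T" for S T
  proof -
    have "T \<subseteq> S" if S: "submodule S R B" and T: "submodule T R B" and eq: "U S = U T" for S T
    proof
      fix b assume b: "b \<in> T"
      show "b \<in> S"
      proof (rule ccontr)
        assume "b \<notin> S"
        then obtain x where "x \<in> U S" "\<psi> b x \<noteq> \<zero>\<^bsub>E\<^esub>"
          using separate[OF S] submoduleD(2)[OF B T b] by blast
        then show False using b unfolding eq by (simp add: U_def)
      qed
    qed
    then show ?thesis using S T \<open>U S = U T\<close> by blast
  qed
  have "matlis_dualizable R B"
    using assms unfolding matlis_dualizable_def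
  proof
    assume N: "noetherian_module R M"
    have "artinian_module R B"
      unfolding artinian_module_def
    proof (intro conjI B allI impI)
      fix S :: "nat \<Rightarrow> 'u set" assume S: "\<forall>n. submodule (S n) R B \<and> S (Suc n) \<subseteq> S n"
      then have "\<forall>n. submodule (U (S n)) R M \<and> U (S n) \<subseteq> U (S (Suc n))" using U U_mono by blast
      then obtain n where "\<forall>k\<ge>n. U (S k) = U (S n)"
        using N[unfolded noetherian_module_def, THEN conjunct2, rule_format, of "\<lambda>n. U (S n)"] by blast
      then have "\<forall>k\<ge>n. S k = S n" using U_inj[OF conjunct1[OF spec[OF S]] conjunct1[OF spec[OF S]]] by blast
      then show "\<exists>n. \<forall>k\<ge>n. S k = S n" by blast
    qed
    then show "noetherian_module R B \<or> artinian_module R B" by blast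
  next
    assume A: "artinian_module R M"
    have "noetherian_module R B"
      unfolding noetherian_module_def
    proof (intro conjI B allI impI)
      fix S :: "nat \<Rightarrow> 'u set" assume S: "\<forall>n. submodule (S n) R B \<and> S n \<subseteq> S (Suc n)"
      then have "\<forall>n. submodule (U (S n)) R M \<and> U (S (Suc n)) \<subseteq> U (S n)" using U U_mono by blast
      then obtain n where "\<forall>k\<ge>n. U (S k) = U (S n)"
        using A[unfolded artinian_module_def, THEN conjunct2, rule_format, of "\<lambda>n. U (S n)"] by blast
      then have "\<forall>k\<ge>n. S k = S n" using U_inj[OF conjunct1[OF spec[OF S]] conjunct1[OF spec[OF S]]] by blast
      then show "\<exists>n. \<forall>k\<ge>n. S k = S n" by blast
    qed
    then show "noetherian_module R B \<or> artinian_module R B" by blast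
  qed
  with \<theta> that show ?thesis by blast
qed

end

section \<open>Functoriality and cofunctoriality\<close>

text \<open>Lets the invariance of \<open>P\<close> and \<open>p\<close> under isomorphisms of the
  category be applied to linear isomorphisms.\<close>

lemma linear_isos_cat_isos:
  assumes "contains_matlis_dualizable R C" "matlis_dualizable R M" "matlis_dualizable R N"
    and "module R M" "f \<in> linear_isos R M N"
  shows "f \<in> cat_isos C M N"
proof -
  have "iso_inv M N f \<in> Mor C N M" "f \<in> Mor C M N"
    using assms linear_isosD(1)[OF assms(5)] linear_isosD(1)[OF iso_inv_linear_isos[OF assms(4,5)]]
    unfolding contains_matlis_dualizable_def by blast+
  moreover have "compose (carrier M) (iso_inv M N f) f = (\<lambda>x\<in>carrier M. x)"
      "compose (carrier N) f (iso_inv M N f) = (\<lambda>y\<in>carrier N. y)"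
    using iso_inv_simps[OF assms(5)] by (auto simp: compose_def intro!: restrict_ext)
  ultimately show ?thesis unfolding cat_isos_def by blast
qed

locale matlis_pair_operation = matlis R \<mm> E u + pair_operation R C P p
  for R :: "('a, 'r) ring_scheme" (structure) and \<mm> and E :: "('a, 'u) module" and u
    and C :: "('a, 'u) module_cat" and P and p +
  assumes contains_dualizable: "contains_matlis_dualizable R C"
    and dualizable: "(L, M) \<in> P \<Longrightarrow> matlis_dualizable R M"
begin

lemma dualizable_obj: "matlis_dualizable R M \<Longrightarrow> M \<in> Obj C"
  using contains_dualizable unfolding contains_matlis_dualizable_def by blast

lemma dualizable_mor:
  "matlis_dualizable R M \<Longrightarrow> matlis_dualizable R N \<Longrightarrow> Mor C M N = linear_maps R M N"
  using contains_dualizable unfolding contains_matlis_dualizable_def by blast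

lemma pairsD:
  assumes "(L, M) \<in> P"
  shows "module R M" "submodule L R M" "matlis_dualizable R M" "submodule (p L M) R M"
  using pairs[OF assms] obj_module dualizable[OF assms] op_submodule[OF assms]
  unfolding cat_pair_def by blast+

text \<open>The existential in \<open>extended_op\<close> may be evaluated at any one copy: two
  copies differ by an isomorphism of the category, which carries the one value of \<open>p\<close>
  to the other.\<close>

lemma extended_op_eq:
  fixes M :: "('a, 'v) module"
  assumes M: "module R M" and L: "submodule L R M"
    and \<theta>: "\<theta> \<in> linear_isos R M N" and LN: "(\<theta> ` L, N) \<in> P"
  shows "extended_op R P p L M = {x \<in> carrier M. \<theta> x \<in> p (\<theta> ` L) N}"
proof -
  have "\<theta> x \<in> p (\<theta> ` L) N"
    if x: "x \<in> carrier M" and \<theta>': "\<theta>' \<in> linear_isos R M N'" and LN': "(\<theta>' ` L, N') \<in> P"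
      and x': "\<theta>' x \<in> p (\<theta>' ` L) N'" for x N' \<theta>'
  proof -
    note N' = pairsD[OF LN'] and N = pairsD[OF LN]
    let ?i = "iso_inv M N' \<theta>'"
    define \<phi> where "\<phi> = compose (carrier N') \<theta> ?i"
    have "\<phi> \<in> linear_isos R N' N"
      unfolding \<phi>_def by (rule linear_isos_compose[OF N'(1) iso_inv_linear_isos[OF M \<theta>'] \<theta>])
    then have iso: "\<phi> \<in> cat_isos C N' N"
      using linear_isos_cat_isos[OF contains_dualizable N'(3) N(3) N'(1)] by blast
    have \<phi>\<theta>': "\<phi> (\<theta>' y) = \<theta> y" if "y \<in> carrier M" for y
      using that iso_inv_simps(1)[OF \<theta>' that] linear_mapsD(2)[OF linear_isosD(1)[OF \<theta>'] that]
      by (simp add: \<phi>_def compose_def)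
    have "\<phi> ` \<theta>' ` L = \<theta> ` L"
      using \<phi>\<theta>' submoduleD(2)[OF M L] by (simp add: image_image cong: image_cong)
    then have "\<phi> ` p (\<theta>' ` L) N' = p (\<theta> ` L) N"
      using op_iso[OF LN' dualizable_obj[OF N(3)] iso] by simp
    then show ?thesis using x' \<phi>\<theta>'[OF x] by (metis imageI)
  qed
  then show ?thesis unfolding extended_op_def using \<theta> LN by blast
qed

lemma dual_op_eq:
  assumes B: "module R B" and A: "submodule A R B"
    and \<theta>: "\<theta> \<in> linear_isos R (dual R E B) N" and LN: "(\<theta> ` dual_quotient R E A B, N) \<in> P"
  shows "dual_op R E P p A B = {b \<in> carrier B. \<forall>f\<in>linear_maps R B E.
           \<theta> f \<in> p (\<theta> ` dual_quotient R E A B) N \<longrightarrow> f b = \<zero>\<^bsub>E\<^esub>}"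
proof -
  let ?D = "dual R E B" and ?Q = "dual_quotient R E A B"
  have D: "module R ?D" by (rule dual_module[OF E_module B])
  have Q: "submodule ?Q R ?D" by (rule submodule_dual_quotient[OF E_module B A])
  have V: "extended_op R P p ?Q ?D = {f \<in> carrier ?D. \<theta> f \<in> p (\<theta> ` ?Q) N}"
    by (rule extended_op_eq[OF D Q \<theta> LN])
  note N = pairsD[OF LN]
  have "submodule (extended_op R P p ?Q ?D) R ?D"
    unfolding V by (rule submodule_vimage[OF D N(1) linear_isosD(1)[OF \<theta>] N(4)])
  then have "dual_quotient R E (extended_op R P p ?Q ?D) ?D =
      {\<phi> \<in> linear_maps R ?D E. \<forall>f\<in>extended_op R P p ?Q ?D. \<phi> f = \<zero>\<^bsub>E\<^esub>}"
    by (rule dual_quotient_eq[OF E_module D])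
  then show ?thesis
    unfolding dual_op_def Let_def V
    using biduality_linear[OF E_module B] by (auto simp: biduality_apply)
qed

text \<open>The content is surjectivity. A functional \<open>f\<close> that kills the preimage of
  \<open>A'\<close> must be extended along \<open>g\<close> by a functional on \<open>B'\<close>
  that kills \<open>A'\<close>.\<close>

lemma dual_map_dual_quotient:
  fixes B B' :: "('a, 'u) module"
  assumes B: "module R B" and B': "module R B'" and g: "g \<in> linear_maps R B B'"
    and A': "submodule A' R B'"
  shows "dual_map R E B B' g ` dual_quotient R E A' B' = dual_quotient R E (g -` A' \<inter> carrier B) B"
proof -
  note gD = linear_mapsD(2-)[OF g]
  have eq: "g -` A' \<inter> carrier B = {b \<in> carrier B. g b \<in> A'}" by blast
  have A: "submodule (g -` A' \<inter> carrier B) R B"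
    unfolding eq by (rule submodule_vimage[OF B B' g A'])
  note AD = submoduleD[OF B' A']
  interpret B': module R B' by fact
  interpret B: module R B by fact
  have "f \<in> dual_map R E B B' g ` dual_quotient R E A' B'"
    if f: "f \<in> linear_maps R B E" "\<forall>a\<in>g -` A' \<inter> carrier B. f a = \<zero>\<^bsub>E\<^esub>" for f
  proof -
    note fD = linear_mapsD(2-)[OF f(1)]
    \<comment> \<open>The required functional is prescribed on \<open>A' + g(B)\<close> by sending
      \<open>a + g b\<close> to \<open>f b\<close>. If \<open>a + g b = 0\<close>, then
      \<open>g b\<close> lies in \<open>A'\<close>, so \<open>f b = 0\<close>.\<close>
    define S where "S = (\<lambda>(a, b). (a \<oplus>\<^bsub>B'\<^esub> g b, f b)) ` (A' \<times> carrier B)"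
    have SI: "(a \<oplus>\<^bsub>B'\<^esub> g b, f b) \<in> S" if "a \<in> A'" "b \<in> carrier B" for a b
      unfolding S_def using that by force
    have SE: "\<exists>a b. a \<in> A' \<and> b \<in> carrier B \<and> x = a \<oplus>\<^bsub>B'\<^esub> g b \<and> e = f b" if "(x, e) \<in> S" for x e
      using that unfolding S_def by auto
    have "\<exists>h\<in>linear_maps R B' E. \<forall>x e. (x, e) \<in> S \<longrightarrow> h x = e"
    proof (rule injective_extend_graph[OF injective B'])
      show "S \<subseteq> carrier B' \<times> carrier E" unfolding S_def using AD(2) gD(1) fD(1) by auto
      show "(\<zero>\<^bsub>B'\<^esub>, \<zero>\<^bsub>E\<^esub>) \<in> S"
        using SI[OF AD(3) B.M.zero_closed] linear_maps_zero[OF B B' g] linear_maps_zero[OF B E_module f(1)]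
        by simp
    next
      fix x e y e' assume "(x, e) \<in> S" "(y, e') \<in> S"
      then obtain a b a' b' where *: "a \<in> A'" "b \<in> carrier B" "x = a \<oplus>\<^bsub>B'\<^esub> g b" "e = f b"
          "a' \<in> A'" "b' \<in> carrier B" "y = a' \<oplus>\<^bsub>B'\<^esub> g b'" "e' = f b'" using SE by blast
      then have "x \<oplus>\<^bsub>B'\<^esub> y = (a \<oplus>\<^bsub>B'\<^esub> a') \<oplus>\<^bsub>B'\<^esub> g (b \<oplus>\<^bsub>B\<^esub> b')" "e \<oplus>\<^bsub>E\<^esub> e' = f (b \<oplus>\<^bsub>B\<^esub> b')"
        using AD(2)[OF *(1)] AD(2)[OF *(5)] gD(1,2) fD(2) by (simp_all add: B'.M.a_ac)
      then show "(x \<oplus>\<^bsub>B'\<^esub> y, e \<oplus>\<^bsub>E\<^esub> e') \<in> S"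
        using SI[OF AD(4)[OF *(1,5)] B.M.add.m_closed[OF *(2,6)]] by simp
    next
      fix r x e assume r: "r \<in> carrier R" "(x, e) \<in> S"
      then obtain a b where *: "a \<in> A'" "b \<in> carrier B" "x = a \<oplus>\<^bsub>B'\<^esub> g b" "e = f b" using SE by blast
      then have "r \<odot>\<^bsub>B'\<^esub> x = r \<odot>\<^bsub>B'\<^esub> a \<oplus>\<^bsub>B'\<^esub> g (r \<odot>\<^bsub>B\<^esub> b)" "r \<odot>\<^bsub>E\<^esub> e = f (r \<odot>\<^bsub>B\<^esub> b)"
        using AD(2)[OF *(1)] gD(1,3) fD(3) r(1) by (simp_all add: B'.smult_r_distr)
      then show "(r \<odot>\<^bsub>B'\<^esub> x, r \<odot>\<^bsub>E\<^esub> e) \<in> S"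
        using SI[OF AD(7)[OF r(1) *(1)] B.smult_closed[OF r(1) *(2)]] by simp
    next
      fix e assume "(\<zero>\<^bsub>B'\<^esub>, e) \<in> S"
      then obtain a b where *: "a \<in> A'" "b \<in> carrier B" "\<zero>\<^bsub>B'\<^esub> = a \<oplus>\<^bsub>B'\<^esub> g b" "e = f b" using SE by blast
      have "\<ominus>\<^bsub>B'\<^esub> a = g b"
        using *(1-3) AD(2)[OF *(1)] gD(1)[OF *(2)] B'.M.a_comm[of a "g b"]
        by (intro B'.M.minus_equality) auto
      then have "g b \<in> A'" using AD(6)[OF *(1)] by simp
      then show "e = \<zero>\<^bsub>E\<^esub>" using f(2) *(2,4) by blast
    qed
    then obtain h where h: "h \<in> linear_maps R B' E" "\<And>x e. (x, e) \<in> S \<Longrightarrow> h x = e" by blast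
    have "h a = \<zero>\<^bsub>E\<^esub>" if "a \<in> A'" for a
      using h(2)[OF SI[OF that B.M.zero_closed]] AD(2)[OF that] linear_maps_zero[OF B B' g]
        linear_maps_zero[OF B E_module f(1)] by simp
    then have "h \<in> dual_quotient R E A' B'" using h(1) dual_quotient_eq[OF E_module B' A'] by simp
    moreover have "f = dual_map R E B B' g h"
    proof (rule linear_maps_eqI[OF f(1)])
      show "dual_map R E B B' g h \<in> linear_maps R B E"
        using linear_mapsD(2)[OF dual_map_linear[OF E_module B B' g]] h(1) by simp
      show "f b = dual_map R E B B' g h b" if "b \<in> carrier B" for b
        using h(2)[OF SI[OF AD(3) that]] gD(1)[OF that] dual_map_apply[OF h(1) that] by simp
    qed
    ultimately show ?thesis by blast
  qed
  moreover have "dual_map R E B B' g f \<in> {f \<in> linear_maps R B E. \<forall>a\<in>g -` A' \<inter> carrier B. f a = \<zero>\<^bsub>E\<^esub>}"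
    if "f \<in> linear_maps R B' E" "\<forall>a\<in>A'. f a = \<zero>\<^bsub>E\<^esub>" for f
    using linear_mapsD(2)[OF dual_map_linear[OF E_module B B' g]] that by (auto simp: dual_map_apply)
  ultimately show ?thesis
    unfolding dual_quotient_eq[OF E_module B A] dual_quotient_eq[OF E_module B' A'] by blast
qed

lemma functorial_imp_cofunctorial:
  assumes "functorial C P p"
  shows "cofunctorial C (dual_pairs R C E P) (dual_op R E P p)"
  unfolding cofunctorial_def
proof (intro allI impI)
  fix A' B B' g
  assume asm: "g \<in> Mor C B B' \<and> (A', B') \<in> dual_pairs R C E P \<and>
    (g -` A' \<inter> carrier B, B) \<in> dual_pairs R C E P"
  let ?A = "g -` A' \<inter> carrier B"
  let ?Q = "dual_quotient R E ?A B" and ?Q' = "dual_quotient R E A' B'"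
  let ?D = "dual R E B" and ?D' = "dual R E B'"
  have B: "B \<in> Obj C" "module R B" "submodule ?A R B" and B': "B' \<in> Obj C" "module R B'" "submodule A' R B'"
    using asm obj_module unfolding dual_pairs_def cat_pair_def by auto
  have g: "g \<in> linear_maps R B B'" using asm mor_linear[OF B(1) B'(1)] by blast
  obtain N \<theta> where \<theta>: "\<theta> \<in> linear_isos R ?D N" "(\<theta> ` ?Q, N) \<in> P"
    using asm unfolding dual_pairs_def extended_pairs_def by blast
  obtain N' \<theta>' where \<theta>': "\<theta>' \<in> linear_isos R ?D' N'" "(\<theta>' ` ?Q', N') \<in> P"
    using asm unfolding dual_pairs_def extended_pairs_def by blast
  have D: "module R ?D" and D': "module R ?D'" using dual_module[OF E_module] B(2) B'(2) by blast+
  note N = pairsD[OF \<theta>(2)] and N' = pairsD[OF \<theta>'(2)]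
  let ?g = "dual_map R E B B' g"
  have gl: "?g \<in> linear_maps R ?D' ?D" by (rule dual_map_linear[OF E_module B(2) B'(2) g])
  \<comment> \<open>The dual of \<open>g\<close>, moved to the copies \<open>N'\<close> and
    \<open>N\<close> over \<open>'u\<close>, where functoriality of \<open>p\<close> can be applied
    to it.\<close>
  define \<gamma> where "\<gamma> = compose (carrier N') (compose (carrier ?D') \<theta> ?g) (iso_inv ?D' N' \<theta>')"
  have "\<gamma> \<in> linear_maps R N' N"
    unfolding \<gamma>_def
    by (rule linear_maps_compose[OF N'(1) linear_isosD(1)[OF iso_inv_linear_isos[OF D' \<theta>'(1)]]
          linear_maps_compose[OF D' gl linear_isosD(1)[OF \<theta>(1)]]])
  then have \<gamma>: "\<gamma> \<in> Mor C N' N" using dualizable_mor[OF N'(3) N(3)] by simp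
  have \<gamma>\<theta>': "\<gamma> (\<theta>' f) = \<theta> (?g f)" if "f \<in> linear_maps R B' E" for f
    using that iso_inv_simps(1)[OF \<theta>'(1)] linear_mapsD(2)[OF linear_isosD(1)[OF \<theta>'(1)]]
    by (simp add: \<gamma>_def compose_def)
  have Q'_sub: "?Q' \<subseteq> linear_maps R B' E" using dual_quotient_eq[OF E_module B'(2,3)] by blast
  have "\<gamma> ` \<theta>' ` ?Q' = \<theta> ` ?g ` ?Q'"
    unfolding image_image using \<gamma>\<theta>' Q'_sub by (intro image_cong) auto
  also have "?g ` ?Q' = ?Q" by (rule dual_map_dual_quotient[OF B(2) B'(2) g B'(3)])
  finally have im: "\<gamma> ` \<theta>' ` ?Q' = \<theta> ` ?Q" .
  have incl: "\<gamma> ` p (\<theta>' ` ?Q') N' \<subseteq> p (\<theta> ` ?Q) N"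
    using assms[unfolded functorial_def, rule_format, of \<gamma> N' N "\<theta>' ` ?Q'"] \<gamma> \<theta>(2) \<theta>'(2)
    unfolding im by blast
  show "dual_op R E P p ?A B \<subseteq> g -` dual_op R E P p A' B' \<inter> carrier B"
  proof
    fix b assume "b \<in> dual_op R E P p ?A B"
    then have b: "b \<in> carrier B" "\<And>f. f \<in> linear_maps R B E \<Longrightarrow> \<theta> f \<in> p (\<theta> ` ?Q) N \<Longrightarrow> f b = \<zero>\<^bsub>E\<^esub>"
      unfolding dual_op_eq[OF B(2,3) \<theta>] by blast+
    \<comment> \<open>The value \<open>f (g b)\<close> is that of the dual map of \<open>g\<close>
      on \<open>f\<close>, taken at \<open>b\<close>; by \<open>incl\<close> this functional lies in
      the set that \<open>b\<close> annihilates.\<close>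
    have "f (g b) = \<zero>\<^bsub>E\<^esub>" if f: "f \<in> linear_maps R B' E" "\<theta>' f \<in> p (\<theta>' ` ?Q') N'" for f
    proof -
      have "\<theta> (?g f) \<in> p (\<theta> ` ?Q) N" using incl f(2) unfolding \<gamma>\<theta>'[OF f(1), symmetric] by blast
      moreover have "?g f \<in> linear_maps R B E" using linear_mapsD(2)[OF gl] f(1) by simp
      ultimately show ?thesis using b(2) dual_map_apply[OF f(1) b(1)] by metis
    qed
    then have "g b \<in> dual_op R E P p A' B'"
      unfolding dual_op_eq[OF B'(2,3) \<theta>'] using linear_mapsD(2)[OF g b(1)] by blast
    then show "b \<in> g -` dual_op R E P p A' B' \<inter> carrier B" using b(1) by blast
  qed
qed

text \<open>
  Every pair of \<open>P\<close> is, up to isomorphism, the dual of a pair of \<open>P\<^sup>\<or>\<close>: by reflexivity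
  \<open>(L, M) \<cong> ((B/A)\<^sup>\<or>, B\<^sup>\<or>)\<close> with \<open>B \<cong> M\<^sup>\<or>\<close> and \<open>A \<cong> (M/L)\<^sup>\<or>\<close>.
\<close>

lemma dual_of_pair:
  assumes LM: "(L, M) \<in> P" and B: "matlis_dualizable R B" and \<theta>: "\<theta> \<in> linear_isos R (dual R E M) B"
  shows "(\<theta> ` dual_quotient R E L M, B) \<in> dual_pairs R C E P"
    and "dual_op R E P p (\<theta> ` dual_quotient R E L M) B = \<theta> ` dual_quotient R E (p L M) M"
proof -
  note M = pairsD[OF LM]
  let ?D = "dual R E M" and ?Q = "dual_quotient R E L M" and ?BD = "dual R E B"
  have D: "module R ?D" by (rule dual_module[OF E_module M(1)])
  have Bm: "module R B" by (rule matlis_dualizable_module[OF B])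
  have BD: "module R ?BD" by (rule dual_module[OF E_module Bm])
  note LD = submoduleD[OF M(1,2)]
  define \<psi> where "\<psi> = iso_inv ?D B \<theta>"
  have \<psi>\<theta>: "\<psi> (\<theta> f) = f" "\<theta> f \<in> carrier B" if "f \<in> linear_maps R M E" for f
    using iso_inv_simps(1)[OF \<theta>] linear_mapsD(2)[OF linear_isosD(1)[OF \<theta>]] that by (simp_all add: \<psi>_def)
  have \<theta>\<psi>: "\<theta> (\<psi> b) = b" "\<psi> b \<in> linear_maps R M E" if "b \<in> carrier B" for b
    using iso_inv_simps(2,3)[OF \<theta>] that by (simp_all add: \<psi>_def)
  have \<psi>l: "\<psi> \<in> linear_maps R B ?D"
    unfolding \<psi>_def by (rule linear_isosD(1)[OF iso_inv_linear_isos[OF D \<theta>]])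
  \<comment> \<open>The biduality map of \<open>M\<close>, with the dual of \<open>M\<close>
    replaced by its copy \<open>B\<close>.\<close>
  define \<epsilon> where "\<epsilon> = (\<lambda>x\<in>carrier M. \<lambda>b\<in>carrier B. \<psi> b x)"
  have \<epsilon>_app: "\<epsilon> x b = \<psi> b x" if "x \<in> carrier M" "b \<in> carrier B" for x b using that by (simp add: \<epsilon>_def)
  have \<epsilon>_mem: "\<epsilon> x \<in> linear_maps R B E" if x: "x \<in> carrier M" for x
  proof -
    have "compose (carrier B) (biduality R E M x) \<psi> \<in> linear_maps R B E"
      by (rule linear_maps_compose[OF Bm \<psi>l biduality_linear[OF E_module M(1) x]])
    also have "compose (carrier B) (biduality R E M x) \<psi> = \<epsilon> x"
      using x \<theta>\<psi>(2) by (auto simp: compose_def \<epsilon>_def biduality_apply intro!: restrict_ext)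
    finally show ?thesis .
  qed
  have "\<epsilon> \<in> linear_maps R M ?BD"
    unfolding \<epsilon>_def
  proof (rule linear_maps_restrictI[OF M(1)])
    show "(\<lambda>b\<in>carrier B. \<psi> b x) \<in> carrier ?BD" if "x \<in> carrier M" for x
      using \<epsilon>_mem[OF that] that by (simp add: \<epsilon>_def)
  qed (use linear_mapsD(3,4)[OF \<theta>\<psi>(2)] in \<open>auto intro!: restrict_ext\<close>)
  moreover have "inj_on \<epsilon> (carrier M)"
  proof (rule inj_onI, rule ccontr)
    fix x y assume xy: "x \<in> carrier M" "y \<in> carrier M" "\<epsilon> x = \<epsilon> y" "x \<noteq> y"
    have "x \<ominus>\<^bsub>M\<^esub> y \<in> carrier M" "x \<ominus>\<^bsub>M\<^esub> y \<notin> {\<zero>\<^bsub>M\<^esub>}"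
      using xy module_closed(2)[OF M(1)] module_minus_eq_zero_iff[OF M(1)] by simp_all
    \<comment> \<open>Injectivity: \<open>cogenerator\<close> supplies a functional that does not
      kill \<open>x - y\<close>. Surjectivity is then reflexivity of \<open>M\<close>.\<close>
    then obtain f where f: "f \<in> linear_maps R M E" "f (x \<ominus>\<^bsub>M\<^esub> y) \<noteq> \<zero>\<^bsub>E\<^esub>"
      using cogenerator[OF M(1) submodule_zero[OF M(1)]] by blast
    have "f x = f y"
      using xy(1-3) \<epsilon>_app[of _ "\<theta> f"] \<psi>\<theta>[OF f(1)] by metis
    then show False
      using f(2) linear_maps_minus[OF M(1) E_module f(1) xy(1,2)]
        module_minus_eq_zero_iff[OF E_module] linear_mapsD(2)[OF f(1)] xy(1,2) by simp
  qed
  moreover have "\<epsilon> ` carrier M = carrier ?BD"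
  proof (intro equalityI subsetI)
    fix \<phi> assume "\<phi> \<in> carrier ?BD"
    then have \<phi>: "\<phi> \<in> linear_maps R B E" by simp
    have "compose (carrier ?D) \<phi> \<theta> \<in> linear_maps R ?D E"
      by (rule linear_maps_compose[OF D linear_isosD(1)[OF \<theta>] \<phi>])
    then obtain x where x: "x \<in> carrier M" "compose (carrier ?D) \<phi> \<theta> = biduality R E M x"
      using matlis_dualizable_reflexive(1)[OF M(3)] unfolding reflexive_def by blast
    have "\<phi> = \<epsilon> x"
    proof (rule linear_maps_eqI[OF \<phi> \<epsilon>_mem[OF x(1)]])
      fix b assume b: "b \<in> carrier B"
      show "\<phi> b = \<epsilon> x b"
        using fun_cong[OF x(2), of "\<psi> b"] \<theta>\<psi>[OF b] x(1) b
        by (simp add: compose_def biduality_apply \<epsilon>_app)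
    qed
    then show "\<phi> \<in> \<epsilon> ` carrier M" using x(1) by blast
  qed (use \<epsilon>_mem in auto)
  ultimately have \<epsilon>: "\<epsilon> \<in> linear_isos R M ?BD" by (simp add: linear_isos_def bij_betw_def)
  \<comment> \<open>This inverse makes \<open>M\<close> itself a copy of the dual of
    \<open>B\<close>, so \<open>extended_pairs\<close> and \<open>dual_op\<close> are evaluated at
    the given pair \<open>(L, M)\<close>.\<close>
  define \<eta> where "\<eta> = iso_inv M ?BD \<epsilon>"
  have \<eta>: "\<eta> \<in> linear_isos R ?BD M" unfolding \<eta>_def by (rule iso_inv_linear_isos[OF M(1) \<epsilon>])
  have \<eta>\<epsilon>: "\<eta> (\<epsilon> x) = x" if "x \<in> carrier M" for x
    using iso_inv_simps(1)[OF \<epsilon> that] by (simp add: \<eta>_def)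
  have \<epsilon>\<eta>: "\<epsilon> (\<eta> \<phi>) = \<phi>" "\<eta> \<phi> \<in> carrier M" if "\<phi> \<in> linear_maps R B E" for \<phi>
    using iso_inv_simps(2,3)[OF \<epsilon>] that by (simp_all add: \<eta>_def)
  have A: "submodule (\<theta> ` ?Q) R B"
    by (rule submodule_image[OF D Bm linear_isosD(1)[OF \<theta>] submodule_dual_quotient[OF E_module M(1,2)]])
  have Q_eq: "?Q = {f \<in> linear_maps R M E. \<forall>l\<in>L. f l = \<zero>\<^bsub>E\<^esub>}"
    by (rule dual_quotient_eq[OF E_module M(1,2)])
  \<comment> \<open>The double annihilator of \<open>L\<close> is \<open>L\<close>: an element
    outside \<open>L\<close> would be detected by a functional that kills \<open>L\<close>.\<close>
  have QA: "dual_quotient R E (\<theta> ` ?Q) B = \<epsilon> ` L"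
    unfolding dual_quotient_eq[OF E_module Bm A]
  proof (intro equalityI subsetI)
    fix \<phi> assume "\<phi> \<in> {\<phi> \<in> linear_maps R B E. \<forall>a\<in>\<theta> ` ?Q. \<phi> a = \<zero>\<^bsub>E\<^esub>}"
    then have \<phi>: "\<phi> \<in> linear_maps R B E" "\<And>f. f \<in> ?Q \<Longrightarrow> \<phi> (\<theta> f) = \<zero>\<^bsub>E\<^esub>" by blast+
    have "\<eta> \<phi> \<in> L"
    proof (rule ccontr)
      assume "\<eta> \<phi> \<notin> L"
      then obtain f where f: "f \<in> linear_maps R M E" "\<forall>l\<in>L. f l = \<zero>\<^bsub>E\<^esub>" "f (\<eta> \<phi>) \<noteq> \<zero>\<^bsub>E\<^esub>"
        using cogenerator[OF M(1,2) \<epsilon>\<eta>(2)[OF \<phi>(1)]] by blast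
      have "\<phi> (\<theta> f) = f (\<eta> \<phi>)"
        using \<epsilon>_app[OF \<epsilon>\<eta>(2)[OF \<phi>(1)] \<psi>\<theta>(2)[OF f(1)]] \<epsilon>\<eta>(1)[OF \<phi>(1)] \<psi>\<theta>(1)[OF f(1)] by simp
      then show False using \<phi>(2)[of f] f unfolding Q_eq by simp
    qed
    then show "\<phi> \<in> \<epsilon> ` L" using \<epsilon>\<eta>(1)[OF \<phi>(1)] by (metis imageI)
  next
    fix \<phi> assume "\<phi> \<in> \<epsilon> ` L"
    then obtain l where l: "l \<in> L" "\<phi> = \<epsilon> l" by blast
    have "\<epsilon> l (\<theta> f) = \<zero>\<^bsub>E\<^esub>" if "f \<in> ?Q" for f
    proof -
      have "f \<in> linear_maps R M E" "f l = \<zero>\<^bsub>E\<^esub>" using that l(1) unfolding Q_eq by blast+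
      then show ?thesis using \<epsilon>_app[OF LD(2)[OF l(1)]] \<psi>\<theta>[of f] by simp
    qed
    then show "\<phi> \<in> {\<phi> \<in> linear_maps R B E. \<forall>a\<in>\<theta> ` ?Q. \<phi> a = \<zero>\<^bsub>E\<^esub>}"
      using \<epsilon>_mem[OF LD(2)[OF l(1)]] l(2) by blast
  qed
  have \<eta>L: "\<eta> ` dual_quotient R E (\<theta> ` ?Q) B = L"
    unfolding QA \<eta>_def by (rule iso_inv_image[OF \<epsilon> LD(1)])
  have "submodule (dual_quotient R E (\<theta> ` ?Q) B) R ?BD"
    by (rule submodule_dual_quotient[OF E_module Bm A])
  then have "(dual_quotient R E (\<theta> ` ?Q) B, ?BD) \<in> extended_pairs R P"
    unfolding extended_pairs_def using BD \<eta> LM \<eta>L by (auto intro!: exI[of _ M] bexI[of _ \<eta>])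
  moreover have "cat_pair R C (\<theta> ` ?Q) B"
    unfolding cat_pair_def
    using A dualizable_obj[OF B] dualizable_obj[OF submodule_matlis_dualizable[OF B A]] by blast
  ultimately show "(\<theta> ` ?Q, B) \<in> dual_pairs R C E P" unfolding dual_pairs_def by blast
  have "dual_op R E P p (\<theta> ` ?Q) B =
      {b \<in> carrier B. \<forall>\<phi>\<in>linear_maps R B E. \<eta> \<phi> \<in> p L M \<longrightarrow> \<phi> b = \<zero>\<^bsub>E\<^esub>}"
    using dual_op_eq[OF Bm A \<eta>] LM unfolding \<eta>L by blast
  also have "\<dots> = {b \<in> carrier B. \<forall>x\<in>p L M. \<psi> b x = \<zero>\<^bsub>E\<^esub>}"
  proof -
    have "(\<forall>\<phi>\<in>linear_maps R B E. \<eta> \<phi> \<in> p L M \<longrightarrow> \<phi> b = \<zero>\<^bsub>E\<^esub>) \<longleftrightarrow> (\<forall>x\<in>p L M. \<psi> b x = \<zero>\<^bsub>E\<^esub>)"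
      if b: "b \<in> carrier B" for b
    proof (intro iffI ballI impI)
      fix x assume *: "\<forall>\<phi>\<in>linear_maps R B E. \<eta> \<phi> \<in> p L M \<longrightarrow> \<phi> b = \<zero>\<^bsub>E\<^esub>" and x: "x \<in> p L M"
      have "x \<in> carrier M" using submoduleD(2)[OF M(1,4) x] .
      then show "\<psi> b x = \<zero>\<^bsub>E\<^esub>" using * x \<epsilon>_mem \<eta>\<epsilon> \<epsilon>_app b by metis
    next
      fix \<phi> assume *: "\<forall>x\<in>p L M. \<psi> b x = \<zero>\<^bsub>E\<^esub>" and \<phi>: "\<phi> \<in> linear_maps R B E" "\<eta> \<phi> \<in> p L M"
      then show "\<phi> b = \<zero>\<^bsub>E\<^esub>" using \<epsilon>\<eta>[OF \<phi>(1)] \<epsilon>_app b by metis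
    qed
    then show ?thesis by blast
  qed
  also have "\<dots> = \<theta> ` dual_quotient R E (p L M) M"
    unfolding dual_quotient_eq[OF E_module M(1,4)]
  proof (intro equalityI subsetI)
    fix b assume "b \<in> {b \<in> carrier B. \<forall>x\<in>p L M. \<psi> b x = \<zero>\<^bsub>E\<^esub>}"
    then show "b \<in> \<theta> ` {f \<in> linear_maps R M E. \<forall>x\<in>p L M. f x = \<zero>\<^bsub>E\<^esub>}"
      using \<theta>\<psi>[of b] by (intro image_eqI[of _ _ "\<psi> b"]) auto
  next
    fix b assume "b \<in> \<theta> ` {f \<in> linear_maps R M E. \<forall>x\<in>p L M. f x = \<zero>\<^bsub>E\<^esub>}"
    then show "b \<in> {b \<in> carrier B. \<forall>x\<in>p L M. \<psi> b x = \<zero>\<^bsub>E\<^esub>}" using \<psi>\<theta> by auto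
  qed
  finally show "dual_op R E P p (\<theta> ` ?Q) B = \<theta> ` dual_quotient R E (p L M) M" .
qed

text \<open>Cofunctoriality at the dual of \<open>g\<close> says that a functional killing
  \<open>p (g\<close> L) M'\<open>kills\<close>g \<open>p L M\<close> as well. As functionals
  separate points from submodules, the inclusion follows.\<close>

lemma cofunctorial_imp_functorial:
  assumes "cofunctorial C (dual_pairs R C E P) (dual_op R E P p)"
  shows "functorial C P p"
  unfolding functorial_def
proof (intro allI impI)
  fix L M M' g
  assume asm: "g \<in> Mor C M M' \<and> (L, M) \<in> P \<and> (g ` L, M') \<in> P"
  then have LM: "(L, M) \<in> P" and LM': "(g ` L, M') \<in> P" by blast+
  note M = pairsD[OF LM] and M' = pairsD[OF LM']
  have g: "g \<in> linear_maps R M M'" using asm dualizable_mor[OF M(3) M'(3)] by blast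
  let ?D = "dual R E M" and ?D' = "dual R E M'"
  have D: "module R ?D" and D': "module R ?D'" using dual_module[OF E_module] M(1) M'(1) by blast+
  obtain B :: "('a, 'u) module" and \<theta> where B: "matlis_dualizable R B" "\<theta> \<in> linear_isos R ?D B"
    using matlis_dual_exists[OF M(3)] .
  obtain B' :: "('a, 'u) module" and \<theta>' where B': "matlis_dualizable R B'" "\<theta>' \<in> linear_isos R ?D' B'"
    using matlis_dual_exists[OF M'(3)] .
  have Bm': "module R B'" by (rule matlis_dualizable_module[OF B'(1)])
  let ?Q = "dual_quotient R E L M" and ?Q' = "dual_quotient R E (g ` L) M'"
  let ?g = "dual_map R E M M' g"
  have gl: "?g \<in> linear_maps R ?D' ?D" by (rule dual_map_linear[OF E_module M(1) M'(1) g])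
  have g_mem: "?g f \<in> linear_maps R M E" if "f \<in> linear_maps R M' E" for f
    using linear_mapsD(2)[OF gl] that by simp
  define \<gamma> where "\<gamma> = compose (carrier B') (compose (carrier ?D') \<theta> ?g) (iso_inv ?D' B' \<theta>')"
  have "\<gamma> \<in> linear_maps R B' B"
    unfolding \<gamma>_def
    by (rule linear_maps_compose[OF Bm' linear_isosD(1)[OF iso_inv_linear_isos[OF D' B'(2)]]
          linear_maps_compose[OF D' gl linear_isosD(1)[OF B(2)]]])
  then have \<gamma>: "\<gamma> \<in> Mor C B' B" using dualizable_mor[OF B'(1) B(1)] by simp
  have \<theta>'_mem: "\<theta>' f \<in> carrier B'" if "f \<in> linear_maps R M' E" for f
    using linear_mapsD(2)[OF linear_isosD(1)[OF B'(2)]] that by simp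
  have \<gamma>\<theta>': "\<gamma> (\<theta>' f) = \<theta> (?g f)" if "f \<in> linear_maps R M' E" for f
    using that iso_inv_simps(1)[OF B'(2)] \<theta>'_mem by (simp add: \<gamma>_def compose_def)
  \<comment> \<open>Used twice: for \<open>V = L\<close> it computes the preimage that
    cofunctoriality requires, and for \<open>V = p L M\<close> it reads off the conclusion.\<close>
  have mem_iff: "\<gamma> (\<theta>' f) \<in> \<theta> ` dual_quotient R E V M \<longleftrightarrow> (\<forall>l\<in>V. f (g l) = \<zero>\<^bsub>E\<^esub>)"
    if f: "f \<in> linear_maps R M' E" and V: "submodule V R M" for f V
  proof -
    have Vq: "dual_quotient R E V M = {f \<in> linear_maps R M E. \<forall>l\<in>V. f l = \<zero>\<^bsub>E\<^esub>}"
      by (rule dual_quotient_eq[OF E_module M(1) V])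
    then have "dual_quotient R E V M \<subseteq> carrier ?D" by simp
    then have "\<theta> (?g f) \<in> \<theta> ` dual_quotient R E V M \<longleftrightarrow> ?g f \<in> dual_quotient R E V M"
      using inj_on_image_mem_iff[OF linear_isosD(3)[OF B(2)]] g_mem[OF f] by simp
    moreover have "?g f l = f (g l)" if "l \<in> V" for l
      using dual_map_apply[OF f submoduleD(2)[OF M(1) V that]] .
    ultimately show ?thesis unfolding \<gamma>\<theta>'[OF f] Vq using g_mem[OF f] by simp
  qed
  have A': "\<gamma> -` (\<theta> ` ?Q) \<inter> carrier B' = \<theta>' ` ?Q'"
    unfolding dual_quotient_eq[OF E_module M'(1,2)]
  proof (intro equalityI subsetI)
    fix b assume b: "b \<in> \<gamma> -` (\<theta> ` ?Q) \<inter> carrier B'"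
    then obtain f where f: "f \<in> linear_maps R M' E" "b = \<theta>' f"
      using linear_isosD(4)[OF B'(2)] by auto
    then show "b \<in> \<theta>' ` {f \<in> linear_maps R M' E. \<forall>a\<in>g ` L. f a = \<zero>\<^bsub>E\<^esub>}"
      using b mem_iff[OF f(1) M(2)] by blast
  next
    fix b assume "b \<in> \<theta>' ` {f \<in> linear_maps R M' E. \<forall>a\<in>g ` L. f a = \<zero>\<^bsub>E\<^esub>}"
    then obtain f where f: "f \<in> linear_maps R M' E" "b = \<theta>' f" "\<forall>a\<in>g ` L. f a = \<zero>\<^bsub>E\<^esub>" by blast
    then show "b \<in> \<gamma> -` (\<theta> ` ?Q) \<inter> carrier B'" using \<theta>'_mem mem_iff[OF f(1) M(2)] by blast
  qed
  have "dual_op R E P p (\<theta>' ` ?Q') B' \<subseteq> \<gamma> -` dual_op R E P p (\<theta> ` ?Q) B \<inter> carrier B'"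
    using assms[unfolded cofunctorial_def, rule_format, of \<gamma> B' B "\<theta> ` ?Q"] \<gamma>
      dual_of_pair(1)[OF LM B] dual_of_pair(1)[OF LM' B'] unfolding A' by blast
  then have incl: "\<theta>' ` dual_quotient R E (p (g ` L) M') M' \<subseteq>
      \<gamma> -` (\<theta> ` dual_quotient R E (p L M) M) \<inter> carrier B'"
    unfolding dual_of_pair(2)[OF LM B] dual_of_pair(2)[OF LM' B'] .
  show "g ` p L M \<subseteq> p (g ` L) M'"
  proof (rule image_subsetI, rule ccontr)
    fix x assume x: "x \<in> p L M" "g x \<notin> p (g ` L) M'"
    have "g x \<in> carrier M'" using linear_mapsD(2)[OF g submoduleD(2)[OF M(1,4) x(1)]] .
    then obtain f where f: "f \<in> linear_maps R M' E" "\<forall>v\<in>p (g ` L) M'. f v = \<zero>\<^bsub>E\<^esub>" "f (g x) \<noteq> \<zero>\<^bsub>E\<^esub>"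
      using cogenerator[OF M'(1,4) _ x(2)] by blast
    have "f \<in> dual_quotient R E (p (g ` L) M') M'"
      unfolding dual_quotient_eq[OF E_module M'(1,4)] using f by blast
    then have "\<gamma> (\<theta>' f) \<in> \<theta> ` dual_quotient R E (p L M) M" using incl by blast
    then show False using mem_iff[OF f(1) M(4)] x(1) f(3) by blast
  qed
qed

end

theorem proposition3p9:
  fixes R :: "('a, 'r) ring_scheme"
    and \<mm> :: "'a set"
    and E :: "('a, 'u) module"
    and C :: "('a, 'u) module_cat"
    and P :: "('u set \<times> ('a, 'u) module) set"
    and p :: "'u set \<Rightarrow> ('a, 'u) module \<Rightarrow> 'u set"
  assumes "infinite (UNIV :: 'u set)"
    and "carrier R \<lesssim> (UNIV :: 'u set)"
    and "complete_noetherian_local_ring R \<mm>"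
    and "injective_hull R (residue_field R \<mm>) E"
    and "module_category R C"
    and "contains_matlis_dualizable R C"
    and "pair_operation R C P p"
    and "\<And>L M. (L, M) \<in> P \<Longrightarrow>
           matlis_dualizable R M \<and> matlis_dualizable R (M\<lparr>carrier := L\<rparr>)"
  shows "functorial C P p \<longleftrightarrow> cofunctorial C (dual_pairs R C E P) (dual_op R E P p)"
proof -
  obtain u where "matlis R \<mm> E u" using matlis_exists[OF assms(1-4)] .
  then interpret matlis_pair_operation R \<mm> E u C P p
    using assms(6-8) by (simp add: matlis_pair_operation_def matlis_pair_operation_axioms_def)
  show ?thesis using functorial_imp_cofunctorial cofunctorial_imp_functorial by blast
qed

end
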